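(* Let $n,m,\Delta\in\mathbb{N}$ and let $p$ be a bounded induced graph counting polynomial (BIGCP) with parameters $\alpha$ and $\beta$. Then there is a deterministic algorithm running in time $\tilde{O}\big(n(e\Delta)^{\alpha m}\beta_m 4^{\alpha m}\big)$ which, given any $n$-vertex graph $G$ of maximum degree at most $\Delta$, computes the first $m$ coefficients $e_1(G),\dots,e_m(G)$ of $p(G)$. Here the $\tilde{O}$-notation suppresses polynomial factors in $m$, and the algorithm accesses $p$ only through the procedure (from condition (ii) below) that computes the numbers $\lambda_{H,i}$.
   Context: For graphs $H,G$, $\mathrm{ind}(H,G)$ is the number of subsets $S\subseteq V(G)$ with $G[S]$ isomorphic to $H$. Let $\mathcal{G}$ be the class of all (finite) graphs and $\mathcal{G}_k$ the class of graphs with at most $k$ vertices. A graph polynomial is a map $p:\mathcal{G}\to\mathbb{C}[z]$ taking equal values on isomorphic graphs; it is multiplicative if $p(\emptyset)=1$ and $p(G_1\cup G_2)=p(G_1)p(G_2)$ for all graphs $G_1,G_2$, where $\cup$ denotes disjoint union. A multiplicative graph polynomial $p(G)(z)=\sum_{i=0}^{d(G)}e_i(G)z^i$ with $e_0(G)=1$ for all $G$ is a bounded induced graph counting polynomial (BIGCP) with parameters $\alpha\in\mathbb{N}$ and a non-decreasing sequence $\beta=(\beta_i)\in\mathbb{N}^{\mathbb{N}}$ if (i) for every graph $G$ and every $i$, $e_i(G)=\sum_{H\in\mathcal{G}_{\alpha i}}\lambda_{H,i}\,\mathrm{ind}(H,G)$ for certain complex numbers $\lambda_{H,i}$ (independent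 of $G$); and (ii) for each $i$ and $H\in\mathcal{G}_{\alpha i}$, $\lambda_{H,i}$ can be computed in time $\beta_i$. The computational model is the word-RAM model with logarithmic-sized words. *)

theory Defs
  imports Complex_Main "HOL-Computational_Algebra.Polynomial"
begin

section \<open>Graphs\<close>

text \<open>Finite simple undirected graphs. Every finite graph is isomorphic to one whose vertices are
  natural numbers, so the class of all finite graphs is represented on vertex type \<^typ>\<open>nat\<close>.\<close>

datatype graph = Graph (verts: "nat set") (edges: "nat set set")

definition simple_graph :: "graph \<Rightarrow> bool" where
  "simple_graph G \<longleftrightarrow> finite (verts G) \<and>
     (\<forall>e\<in>edges G. \<exists>u\<in>verts G. \<exists>v\<in>verts G. u \<noteq> v \<and> e = {u, v})"

definition iso :: "graph \<Rightarrow> graph \<Rightarrow> bool" where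
  "iso G H \<longleftrightarrow> (\<exists>f. bij_betw f (verts G) (verts H) \<and>
     (\<forall>u\<in>verts G. \<forall>v\<in>verts G. {u, v} \<in> edges G \<longleftrightarrow> {f u, f v} \<in> edges H))"

definition induced :: "graph \<Rightarrow> nat set \<Rightarrow> graph" where
  "induced G S = Graph S {e \<in> edges G. e \<subseteq> S}"

definition ind :: "graph \<Rightarrow> graph \<Rightarrow> nat" where
  "ind H G = card {S. S \<subseteq> verts G \<and> iso (induced G S) H}"

definition empty_graph :: graph where
  "empty_graph = Graph {} {}"

definition graph_union :: "graph \<Rightarrow> graph \<Rightarrow> graph" where
  "graph_union G H = Graph (verts G \<union> verts H) (edges G \<union> edges H)"

definition nbrs :: "graph \<Rightarrow> nat \<Rightarrow> nat set" where
  "nbrs G v = {u. {u, v} \<in> edges G}"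

definition max_degree_at_most :: "graph \<Rightarrow> nat \<Rightarrow> bool" where
  "max_degree_at_most G D \<longleftrightarrow> (\<forall>v\<in>verts G. card (nbrs G v) \<le> D)"

text \<open>Sums over the graphs with at most \<open>k\<close> vertices run over isomorphism types.
  Isomorphic graphs satisfy the same predicate under the choice operator in \<open>canon\<close>, hence have
  the same representative.\<close>

definition canon :: "graph \<Rightarrow> graph" where
  "canon G = (SOME H. simple_graph H \<and> verts H = {..<card (verts G)} \<and> iso G H)"

definition iso_types :: "nat \<Rightarrow> graph set" where
  "iso_types k = canon ` {G. simple_graph G \<and> card (verts G) \<le> k}"

lemma iso_refl: "iso G G"
  unfolding iso_def by (intro exI[of _ id]) auto

lemma iso_sym: assumes "iso G H" shows "iso H G"
proof -
  obtain f where f: "bij_betw f (verts G) (verts H)"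
    and e: "\<forall>u\<in>verts G. \<forall>v\<in>verts G. {u, v} \<in> edges G \<longleftrightarrow> {f u, f v} \<in> edges H"
    using assms unfolding iso_def by blast
  let ?g = "inv_into (verts G) f"
  have g: "bij_betw ?g (verts H) (verts G)" using f by (rule bij_betw_inv_into)
  have "\<forall>u\<in>verts H. ?g u \<in> verts G \<and> f (?g u) = u"
    using f g by (metis bij_betwE bij_betw_inv_into_right)
  then show ?thesis unfolding iso_def using e g by (intro exI[of _ ?g]) auto
qed

lemma iso_trans: assumes "iso G H" "iso H K" shows "iso G K"
proof -
  obtain f where f: "bij_betw f (verts G) (verts H)"
    and e: "\<forall>u\<in>verts G. \<forall>v\<in>verts G. {u, v} \<in> edges G \<longleftrightarrow> {f u, f v} \<in> edges H"
    using assms(1) unfolding iso_def by blast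
  obtain g where g: "bij_betw g (verts H) (verts K)"
    and e': "\<forall>u\<in>verts H. \<forall>v\<in>verts H. {u, v} \<in> edges H \<longleftrightarrow> {g u, g v} \<in> edges K"
    using assms(2) unfolding iso_def by blast
  show ?thesis unfolding iso_def
    using bij_betw_trans[OF f g] e e' f by (intro exI[of _ "g \<circ> f"]) (auto dest: bij_betwE)
qed

lemma canon_props:
  assumes "simple_graph G"
  shows "simple_graph (canon G)" "verts (canon G) = {..<card (verts G)}" "iso G (canon G)"
proof -
  have fin: "finite (verts G)" using assms by (simp add: simple_graph_def)
  obtain f where f: "bij_betw f (verts G) {..<card (verts G)}"
    using ex_bij_betw_finite_nat[OF fin] by (auto simp: atLeast0LessThan)
  let ?H = "Graph {..<card (verts G)} ((`) f ` edges G)"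
  have inj: "inj_on f (verts G)" using f by (simp add: bij_betw_def)
  have E: "\<exists>u\<in>verts G. \<exists>v\<in>verts G. u \<noteq> v \<and> e = {u, v}" if "e \<in> edges G" for e
    using assms that unfolding simple_graph_def by blast
  have mem: "f u \<in> {..<card (verts G)}" if "u \<in> verts G" for u
    using f that by (rule bij_betwE[rule_format])
  have "\<exists>x\<in>{..<card (verts G)}. \<exists>y\<in>{..<card (verts G)}. x \<noteq> y \<and> f ` e = {x, y}"
    if e: "e \<in> edges G" for e
  proof -
    obtain u v where uv: "u \<in> verts G" "v \<in> verts G" "u \<noteq> v" "e = {u, v}" using E[OF e] by blast
    have "f u \<noteq> f v" using uv inj by (simp add: inj_on_eq_iff)
    moreover have "f ` e = {f u, f v}" using uv(4) by simp
    ultimately show ?thesis using mem[OF uv(1)] mem[OF uv(2)] by blast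
  qed
  then have "simple_graph ?H" unfolding simple_graph_def by simp
  moreover have "iso G ?H"
  proof -
    have "{u, v} \<in> edges G \<longleftrightarrow> {f u, f v} \<in> (`) f ` edges G"
      if uv: "u \<in> verts G" "v \<in> verts G" for u v
    proof
      assume "{u, v} \<in> edges G"
      then have "f ` {u, v} \<in> (`) f ` edges G" by (rule imageI)
      then show "{f u, f v} \<in> (`) f ` edges G" by simp
    next
      assume "{f u, f v} \<in> (`) f ` edges G"
      then obtain e where e: "e \<in> edges G" "f ` {u, v} = f ` e" by auto
      have "e \<subseteq> verts G" using E[OF e(1)] by auto
      with e(2) uv have "{u, v} = e" using inj_on_image_eq_iff[OF inj] by (metis empty_subsetI insert_subset)
      with e(1) show "{u, v} \<in> edges G" by simp
    qed
    with f show ?thesis unfolding iso_def by (intro exI[of _ f]) simp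
  qed
  ultimately have "\<exists>H. simple_graph H \<and> verts H = {..<card (verts G)} \<and> iso G H"
    by (intro exI[of _ ?H]) simp
  from someI_ex[OF this] show "simple_graph (canon G)" "verts (canon G) = {..<card (verts G)}"
    "iso G (canon G)" unfolding canon_def by blast+
qed

lemma canon_eq_iff:
  assumes "simple_graph G" "simple_graph H"
  shows "canon G = canon H \<longleftrightarrow> iso G H"
proof
  assume "canon G = canon H"
  then show "iso G H" using canon_props(3)[OF assms(1)] canon_props(3)[OF assms(2)]
    by (metis iso_sym iso_trans)
next
  assume *: "iso G H"
  then have "card (verts G) = card (verts H)" unfolding iso_def by (auto dest: bij_betw_same_card)
  moreover have "iso G K \<longleftrightarrow> iso H K" for K using * by (metis iso_sym iso_trans)
  ultimately show "canon G = canon H" unfolding canon_def by simp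
qed

lemma finite_iso_types: "finite (iso_types k)"
proof (rule finite_subset)
  show "iso_types k \<subseteq> (\<lambda>(V, E). Graph V E) ` (Pow {..<k} \<times> Pow (Pow {..<k}))"
  proof
    fix H assume "H \<in> iso_types k"
    then obtain G where G: "simple_graph G" "card (verts G) \<le> k" "H = canon G"
      unfolding iso_types_def by blast
    have v: "verts H \<subseteq> {..<k}" using canon_props(2)[OF G(1)] G by auto
    have "edges H \<subseteq> Pow (verts H)"
      using canon_props(1)[OF G(1)] G(3) unfolding simple_graph_def by fastforce
    with v have "(verts H, edges H) \<in> Pow {..<k} \<times> Pow (Pow {..<k})" by auto
    then show "H \<in> (\<lambda>(V, E). Graph V E) ` (Pow {..<k} \<times> Pow (Pow {..<k}))"
      by (metis (mono_tags, lifting) case_prod_conv graph.collapse image_eqI)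
  qed
qed auto


section \<open>A word-RAM with complex registers\<close>

text \<open>Word registers and the word memory hold \<open>w\<close>-bit words, i.e. natural numbers below \<open>2 ^ w\<close>;
  addresses are words. The usual word operations cost one time unit each. Since the numbers
  \<open>\<lambda>\<^sub>H\<^sub>,\<^sub>i\<close> are arbitrary complex numbers, there are also complex registers and a complex memory
  (addressed by words) with exact field arithmetic and a zero test at unit cost; apart from the zero
  test no instruction turns a complex number into a word. Control flow is structured, which differs from
  jumps only in constant factors.\<close>

datatype wop = Add | Sub | Mul | Div | Mod | And | Or | Xor | Shl | Shr | Eq | Less

datatype wexp = WConst nat | WReg nat | WMem wexp | WBin wop wexp wexp

datatype cop = CAdd | CSub | CMul | CDiv

datatype cexp = CConst complex | CReg nat | CMem wexp | CWord wexp | CBin cop cexp cexp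

datatype com =
    Skip
  | WAssign nat wexp
  | WStore wexp wexp         \<comment> \<open>address, value\<close>
  | CAssign nat cexp
  | CStore wexp cexp         \<comment> \<open>address, value\<close>
  | CIsZero nat cexp         \<comment> \<open>word register receiving 1 if the value is 0, and 0 otherwise\<close>
  | Query nat wexp wexp      \<comment> \<open>complex register receiving the answer; address, length of the query\<close>
  | Seq com com
  | If wexp com com
  | While wexp com

record state =
  wreg :: "nat \<Rightarrow> nat"
  wmem :: "nat \<Rightarrow> nat"
  creg :: "nat \<Rightarrow> complex"
  cmem :: "nat \<Rightarrow> complex"

fun wop_val :: "nat \<Rightarrow> wop \<Rightarrow> nat \<Rightarrow> nat \<Rightarrow> nat" where
  "wop_val w Add a b = (a + b) mod 2 ^ w"
| "wop_val w Sub a b = (a + (2 ^ w - b)) mod 2 ^ w"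
| "wop_val w Mul a b = (a * b) mod 2 ^ w"
| "wop_val w Div a b = a div b"
| "wop_val w Mod a b = a mod b"
| "wop_val w And a b = semiring_bit_operations_class.and a b"
| "wop_val w Or a b = semiring_bit_operations_class.or a b"
| "wop_val w Xor a b = semiring_bit_operations_class.xor a b"
| "wop_val w Shl a b = push_bit b a mod 2 ^ w"
| "wop_val w Shr a b = drop_bit b a"
| "wop_val w Eq a b = (if a = b then 1 mod 2 ^ w else 0)"
| "wop_val w Less a b = (if a < b then 1 mod 2 ^ w else 0)"

fun wval :: "nat \<Rightarrow> wexp \<Rightarrow> state \<Rightarrow> nat" where
  "wval w (WConst k) s = k mod 2 ^ w"
| "wval w (WReg r) s = wreg s r"
| "wval w (WMem e) s = wmem s (wval w e s)"
| "wval w (WBin f e1 e2) s = wop_val w f (wval w e1 s) (wval w e2 s)"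

fun cop_val :: "cop \<Rightarrow> complex \<Rightarrow> complex \<Rightarrow> complex" where
  "cop_val CAdd x y = x + y"
| "cop_val CSub x y = x - y"
| "cop_val CMul x y = x * y"
| "cop_val CDiv x y = x / y"

fun cval :: "nat \<Rightarrow> cexp \<Rightarrow> state \<Rightarrow> complex" where
  "cval w (CConst z) s = z"
| "cval w (CReg r) s = creg s r"
| "cval w (CMem e) s = cmem s (wval w e s)"
| "cval w (CWord e) s = of_nat (wval w e s)"
| "cval w (CBin f e1 e2) s = cop_val f (cval w e1 s) (cval w e2 s)"

fun wcost :: "wexp \<Rightarrow> nat" where
  "wcost (WConst k) = 1"
| "wcost (WReg r) = 1"
| "wcost (WMem e) = 1 + wcost e"
| "wcost (WBin f e1 e2) = 1 + wcost e1 + wcost e2"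

fun ccost :: "cexp \<Rightarrow> nat" where
  "ccost (CConst z) = 1"
| "ccost (CReg r) = 1"
| "ccost (CMem e) = 1 + wcost e"
| "ccost (CWord e) = 1 + wcost e"
| "ccost (CBin f e1 e2) = 1 + ccost e1 + ccost e2"

text \<open>\<open>exec w orc c s s' t\<close>: with word length \<open>w\<close>, the program \<open>c\<close> started in \<open>s\<close> halts in \<open>s'\<close>
  after \<open>t\<close> time units. The parameter \<open>orc inp z t\<close> says that the external procedure answers the
  query \<open>inp\<close> by \<open>z\<close> after \<open>t\<close> time units; a query costs this time plus the length of the query.
  A query that is never answered makes the program not halt.\<close>

inductive exec :: "nat \<Rightarrow> (nat list \<Rightarrow> complex \<Rightarrow> nat \<Rightarrow> bool) \<Rightarrow> com \<Rightarrow> state \<Rightarrow> state \<Rightarrow> nat \<Rightarrow> bool"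
  for w :: nat and orc :: "nat list \<Rightarrow> complex \<Rightarrow> nat \<Rightarrow> bool" where
  Skip: "exec w orc Skip s s 1"
| WAssign: "exec w orc (WAssign r e) s (s\<lparr>wreg := (wreg s)(r := wval w e s)\<rparr>) (1 + wcost e)"
| WStore: "exec w orc (WStore a e) s
     (s\<lparr>wmem := (wmem s)(wval w a s := wval w e s)\<rparr>) (1 + wcost a + wcost e)"
| CAssign: "exec w orc (CAssign r e) s (s\<lparr>creg := (creg s)(r := cval w e s)\<rparr>) (1 + ccost e)"
| CStore: "exec w orc (CStore a e) s
     (s\<lparr>cmem := (cmem s)(wval w a s := cval w e s)\<rparr>) (1 + wcost a + ccost e)"
| CIsZero: "exec w orc (CIsZero r e) s
     (s\<lparr>wreg := (wreg s)(r := (if cval w e s = 0 then 1 mod 2 ^ w else 0))\<rparr>) (1 + ccost e)"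
| Query: "orc (map (\<lambda>j. wmem s ((wval w a s + j) mod 2 ^ w)) [0..<wval w l s]) z t \<Longrightarrow>
     exec w orc (Query r a l) s (s\<lparr>creg := (creg s)(r := z)\<rparr>)
       (1 + wcost a + wcost l + wval w l s + t)"
| Seq: "exec w orc c1 s s' t1 \<Longrightarrow> exec w orc c2 s' s'' t2 \<Longrightarrow>
     exec w orc (Seq c1 c2) s s'' (t1 + t2)"
| IfTrue: "wval w b s \<noteq> 0 \<Longrightarrow> exec w orc c1 s s' t \<Longrightarrow>
     exec w orc (If b c1 c2) s s' (1 + wcost b + t)"
| IfFalse: "wval w b s = 0 \<Longrightarrow> exec w orc c2 s s' t \<Longrightarrow>
     exec w orc (If b c1 c2) s s' (1 + wcost b + t)"
| WhileFalse: "wval w b s = 0 \<Longrightarrow> exec w orc (While b c) s s (1 + wcost b)"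
| WhileTrue: "wval w b s \<noteq> 0 \<Longrightarrow> exec w orc c s s' t1 \<Longrightarrow> exec w orc (While b c) s' s'' t2 \<Longrightarrow>
     exec w orc (While b c) s s'' (1 + wcost b + t1 + t2)"

inductive_cases exec_elims:
  "exec w orc Skip s s' t"
  "exec w orc (WAssign r e) s s' t"
  "exec w orc (WStore a e) s s' t"
  "exec w orc (CAssign r e) s s' t"
  "exec w orc (CStore a e) s s' t"
  "exec w orc (CIsZero r e) s s' t"
  "exec w orc (Query r a l) s s' t"
  "exec w orc (Seq c1 c2) s s' t"
  "exec w orc (If b c1 c2) s s' t"

inductive_cases exec_While: "exec w orc (While b c) s s' t"

lemma exec_deterministic:
  assumes orc: "\<And>inp z t z' t'. orc inp z t \<Longrightarrow> orc inp z' t' \<Longrightarrow> z = z' \<and> t = t'"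
  assumes "exec w orc c s s1 t1" "exec w orc c s s2 t2"
  shows "s1 = s2 \<and> t1 = t2"
  using assms(2,3)
proof (induction arbitrary: s2 t2 rule: exec.induct)
  case Skip
  then show ?case by (rule exec_elims(1)) (simp only: simp_thms)
next
  case WAssign
  then show ?case by (rule exec_elims(2)) (simp only: simp_thms)
next
  case WStore
  then show ?case by (rule exec_elims(3)) (simp only: simp_thms)
next
  case CAssign
  then show ?case by (rule exec_elims(4)) (simp only: simp_thms)
next
  case CStore
  then show ?case by (rule exec_elims(5)) (simp only: simp_thms)
next
  case CIsZero
  from CIsZero.prems show ?case by (rule exec_elims(6)) (simp only: simp_thms)
next
  case (Query s a l z t r)
  from Query.prems show ?case by (rule exec_elims(7)) (use orc[OF Query.hyps] in auto)
next
  case (Seq c1 s s' t1 c2 s'' t2')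
  from Seq.prems show ?case by (rule exec_elims(8)) (use Seq.IH in metis)
next
  case (IfTrue b s c1 s' t c2)
  from IfTrue.prems show ?case by (rule exec_elims(9)) (use IfTrue.hyps in \<open>auto dest!: IfTrue.IH\<close>)
next
  case (IfFalse b s c2 s' t c1)
  from IfFalse.prems show ?case by (rule exec_elims(9)) (use IfFalse.hyps in \<open>auto dest!: IfFalse.IH\<close>)
next
  case (WhileFalse b s c)
  from WhileFalse.prems show ?case by (rule exec_While) (use WhileFalse.hyps in auto)
next
  case (WhileTrue b s c s' t1 s'' t2')
  from WhileTrue.prems show ?case by (rule exec_While) (use WhileTrue.hyps in \<open>auto dest!: WhileTrue.IH\<close>)
qed

text \<open>The input is placed at address 0, and everything else is 0. The reduction modulo \<open>2 ^ w\<close>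
  only matters for inputs that do not consist of words.\<close>

definition init_state :: "nat \<Rightarrow> nat list \<Rightarrow> state" where
  "init_state w inp = \<lparr>wreg = (\<lambda>_. 0),
     wmem = (\<lambda>a. if a < length inp then inp ! a mod 2 ^ w else 0),
     creg = (\<lambda>_. 0), cmem = (\<lambda>_. 0)\<rparr>"

text \<open>The procedure given by a program \<open>Q\<close> runs on its own memory, cannot make queries itself, and
  returns the content of complex register 0.\<close>

definition procedure :: "nat \<Rightarrow> com \<Rightarrow> nat list \<Rightarrow> complex \<Rightarrow> nat \<Rightarrow> bool" where
  "procedure w Q inp z t \<longleftrightarrow>
     (\<exists>s. exec w (\<lambda>_ _ _. False) Q (init_state w inp) s t \<and> z = creg s 0)"

lemma procedure_deterministic:
  assumes "procedure w Q inp z t" "procedure w Q inp z' t'"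
  shows "z = z' \<and> t = t'"
  using assms exec_deterministic[of "\<lambda>_ _ _. False"] unfolding procedure_def by blast

text \<open>Words of length at least \<open>\<kappa>\<close> times the logarithm of the size parameter \<open>N\<close>.\<close>

definition log_sized :: "nat \<Rightarrow> nat \<Rightarrow> nat \<Rightarrow> bool" where
  "log_sized \<kappa> N w \<longleftrightarrow> real w \<ge> real \<kappa> * log 2 (real N)"

text \<open>A graph on \<open>{..<k}\<close> is given by adjacency lists, listed in any order. In memory these
  are \<open>k + 1\<close> offsets followed by the concatenated lists.\<close>

definition adjacency_lists :: "graph \<Rightarrow> nat list list \<Rightarrow> bool" where
  "adjacency_lists G xss \<longleftrightarrow> verts G = {..<length xss} \<and>
     (\<forall>v<length xss. distinct (xss ! v) \<and> set (xss ! v) = nbrs G v)"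

definition encode_lists :: "nat list list \<Rightarrow> nat list" where
  "encode_lists xss =
     map (\<lambda>v. sum_list (map length (take v xss))) [0..<length xss + 1] @ concat xss"


section \<open>Bounded induced graph counting polynomials\<close>

definition graph_polynomial :: "(graph \<Rightarrow> complex poly) \<Rightarrow> bool" where
  "graph_polynomial p \<longleftrightarrow>
     (\<forall>G H. simple_graph G \<and> simple_graph H \<and> iso G H \<longrightarrow> p G = p H)"

text \<open>By isomorphism invariance it is enough to consider unions of graphs whose vertex sets are
  already disjoint.\<close>

definition multiplicative :: "(graph \<Rightarrow> complex poly) \<Rightarrow> bool" where
  "multiplicative p \<longleftrightarrow> p empty_graph = 1 \<and>
     (\<forall>G H. simple_graph G \<and> simple_graph H \<and> verts G \<inter> verts H = {} \<longrightarrow>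
        p (graph_union G H) = p G * p H)"

text \<open>Given \<open>i\<close> and (adjacency lists of) a graph \<open>H\<close> with at most \<open>\<alpha> i\<close> vertices, the program \<open>Q\<close>
  computes \<open>lam H i\<close> in time \<open>\<beta> i\<close>.\<close>

definition computes_coefficients ::
    "nat \<Rightarrow> nat \<Rightarrow> (nat \<Rightarrow> nat) \<Rightarrow> (graph \<Rightarrow> nat \<Rightarrow> complex) \<Rightarrow> com \<Rightarrow> bool" where
  "computes_coefficients \<kappa> \<alpha> \<beta> lam Q \<longleftrightarrow>
     (\<forall>i\<ge>1. \<forall>H xss w. simple_graph H \<and> card (verts H) \<le> \<alpha> * i \<and> adjacency_lists H xss \<and>
        log_sized \<kappa> (i + \<alpha> * i + \<beta> i) w \<longrightarrow>
        (\<exists>t \<le> \<beta> i. procedure w Q ([length xss, i] @ encode_lists xss) (lam H i) t))"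

text \<open>\<open>BIGCP \<kappa> \<alpha> \<beta> p lam Q\<close>: the polynomial \<open>p\<close> is a BIGCP with parameters \<open>\<alpha>\<close> and \<open>\<beta>\<close>, as witnessed
  by the numbers \<open>lam H i\<close> and the procedure \<open>Q\<close> computing them on machines whose words have
  length at least \<open>\<kappa>\<close> times a logarithm. As \<open>\<lambda>\<^sub>H\<^sub>,\<^sub>i\<close> belongs to the isomorphism type of \<open>H\<close>, \<open>lam\<close> is
  invariant. The index \<open>i\<close> starts at 1 since the coefficient at 0 is prescribed.\<close>

definition BIGCP ::
    "nat \<Rightarrow> nat \<Rightarrow> (nat \<Rightarrow> nat) \<Rightarrow> (graph \<Rightarrow> complex poly) \<Rightarrow> (graph \<Rightarrow> nat \<Rightarrow> complex) \<Rightarrow> com \<Rightarrow> bool"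
where
  "BIGCP \<kappa> \<alpha> \<beta> p lam Q \<longleftrightarrow>
     graph_polynomial p \<and> multiplicative p \<and>
     (\<forall>G. simple_graph G \<longrightarrow> coeff (p G) 0 = 1) \<and>
     mono \<beta> \<and>
     (\<forall>H H'. simple_graph H \<and> simple_graph H' \<and> iso H H' \<longrightarrow> lam H = lam H') \<and>
     (\<forall>G. \<forall>i\<ge>1. simple_graph G \<longrightarrow>
        coeff (p G) i = (\<Sum>H\<in>iso_types (\<alpha> * i). lam H i * of_nat (ind H G))) \<and>
     computes_coefficients \<kappa> \<alpha> \<beta> lam Q"

end

theory Submission
  imports Defs "HOL-Computational_Algebra.Formal_Power_Series" "HOL-Computational_Algebra.Polynomial_FPS"
begin

text \<open>
  Let \<open>s\<^sub>i(S)\<close> be the \<open>i\<close>-th coefficient of \<open>z P'/P\<close> for \<open>P = p(G[S])\<close>; Newton's identities turn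
  \<open>e\<^sub>1, \<dots>, e\<^sub>i\<close> into \<open>s\<^sub>1, \<dots>, s\<^sub>i\<close> and back. Multiplicativity makes \<open>s\<^sub>i\<close> additive over disjoint
  unions, so its Moebius transform \<open>\<mu>\<^sub>i(U) = \<Sum>\<^sub>S\<^sub>\<subseteq>\<^sub>U (-1)\<^bsup>|U| - |S|\<^esup> s\<^sub>i(S)\<close> vanishes unless \<open>G[U]\<close> is connected,
  and since \<open>e\<^sub>j(S)\<close> is a sum over subsets of \<open>S\<close> of size at most \<open>\<alpha> j\<close>, it also vanishes for \<open>|U| > \<alpha> i\<close>.
  Hence \<open>s\<^sub>i(G)\<close> is the sum of \<open>\<mu>\<^sub>i(U)\<close> over the connected \<open>U\<close> with at most \<open>K = \<alpha> m\<close> vertices.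

  A connected \<open>U\<close> is determined by its least vertex and by the set of fewer than \<open>K\<close> slots, out of \<open>K \<Delta>\<close>, at which
  a breadth-first search discovers its other vertices. As \<open>K\<^sup>t / t! \<le> e\<^sup>K\<close>, there are at most
  \<open>n K (e \<Delta>)\<^sup>K\<close> candidates. For each, \<open>\<mu>\<^sub>i(U)\<close> takes one query per pair \<open>T \<subseteq> S \<subseteq> U\<close> and \<open>i \<le> m\<close>, that
  is \<open>3\<^sup>K m\<close> queries, and the gap between \<open>3\<^sup>K\<close> and \<open>4\<^sup>K\<close> absorbs the factors polynomial in \<open>K\<close>.

  Words of logarithmic length address only polynomially many cells, while there may be exponentially many
  \<open>U\<close>; therefore nothing is tabulated, and everything is enumerated in polynomial space.
\<close>

section \<open>Moebius inversion and power sums\<close>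

text \<open>Working with vertex sets instead of isomorphism types frees the algorithm from
  isomorphism tests: the number attached to a set U depends on G[U] alone and is simply added up.
  What needs an argument is the size bound for power sums, which are polynomials in the
  coefficients. Under the Moebius transform a pointwise product becomes a sum over pairs of sets
  with union U, so the size bounds of the factors add; Newton's identities are homogeneous of weight
  i, so the bound \<alpha> i of the i-th coefficient passes to the i-th power sum. In the final sum
  it does no harm to list a set whose transform is 0, but listing a set twice would falsify the
  result. Hence the codes have to be unique as well as complete, and uniqueness has to be ensured by
  local checks, because a table of the sets already seen would not fit into the addressable
  memory.\<close>

text \<open>The exponent is a sum instead of the difference \<open>card U - card S\<close>: the
  parity is the same for subsets of a finite \<open>U\<close>, and no truncated subtraction
  occurs.\<close>

definition mob :: "('a set \<Rightarrow> 'b::comm_ring_1) \<Rightarrow> 'a set \<Rightarrow> 'b" where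
  "mob f U = (\<Sum>S\<in>Pow U. (-1) ^ (card U + card S) * f S)"

lemma sum_Pow_insert:
  fixes g :: "'a set \<Rightarrow> 'b::comm_monoid_add"
  assumes "finite U" "x \<notin> U"
  shows "(\<Sum>S\<in>Pow (insert x U). g S) = (\<Sum>S\<in>Pow U. g S) + (\<Sum>S\<in>Pow U. g (insert x S))"
proof -
  have "inj_on (insert x) (Pow U)" using assms(2) by (auto simp: inj_on_def)
  moreover have "Pow U \<inter> insert x ` Pow U = {}" using assms(2) by auto
  ultimately show ?thesis
    using assms(1) by (simp add: Pow_insert sum.union_disjoint sum.reindex)
qed

text \<open>Splitting the subsets by whether they contain \<open>x\<close> exhibits the transform as
  a finite difference in the direction of \<open>x\<close>; the subsets without \<open>x\<close>
  change sign because \<open>card U\<close> grows by one. Both inversion formulas are inductions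
  along this recursion, with \<open>f\<close> arbitrary.\<close>

lemma mob_insert:
  assumes "finite U" "x \<notin> U"
  shows "mob f (insert x U) = mob (\<lambda>S. f (insert x S)) U - mob f U"
proof -
  have "card (insert x S) = Suc (card S)" if "S \<in> Pow U" for S
    using that assms by (metis PowD card_insert_disjoint finite_subset subsetD)
  then have "(\<Sum>S\<in>Pow U. (-1) ^ (card (insert x U) + card (insert x S)) * f (insert x S))
      = mob (\<lambda>S. f (insert x S)) U"
    unfolding mob_def using assms by (intro sum.cong) auto
  then show ?thesis
    unfolding mob_def using assms by (simp add: sum_Pow_insert sum_negf)
qed

text \<open>The recursion telescopes: the sets with and without \<open>x\<close> together contribute
  the transforms of the shifted function.\<close>

lemma sum_mob:
  assumes "finite V"
  shows "(\<Sum>U\<in>Pow V. mob f U) = f V"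
  using assms
proof (induction V arbitrary: f rule: finite_induct)
  case empty
  then show ?case by (simp add: mob_def)
next
  case (insert x V)
  have "(\<Sum>U\<in>Pow V. mob f (insert x U)) = (\<Sum>U\<in>Pow V. mob (\<lambda>S. f (insert x S)) U - mob f U)"
    using insert.hyps by (intro sum.cong refl mob_insert) (auto intro: finite_subset)
  then show ?case
    using insert by (simp add: sum_Pow_insert sum_subtractf)
qed

text \<open>Uniqueness of the inversion. The hypothesis is restricted to subsets of \<open>U\<close>
  because the coefficients are known to be such sums only on subsets of the vertex set.\<close>

lemma mob_sum:
  assumes "finite U" "\<And>S. S \<subseteq> U \<Longrightarrow> f S = (\<Sum>T\<in>Pow S. g T)"
  shows "mob f U = g U"
  using assms
proof (induction U arbitrary: f g rule: finite_induct)
  case empty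
  then show ?case by (simp add: mob_def)
next
  case (insert x U)
  have "f (insert x S) = (\<Sum>T\<in>Pow S. g T + g (insert x T))" if "S \<subseteq> U" for S
  proof -
    have "finite S" "x \<notin> S" using that insert.hyps by (auto intro: finite_subset)
    moreover have "f (insert x S) = (\<Sum>T\<in>Pow (insert x S). g T)" using that by (intro insert.prems) auto
    ultimately show ?thesis by (simp add: sum_Pow_insert sum.distrib)
  qed
  then have "mob (\<lambda>S. f (insert x S)) U = g U + g (insert x U)" by (rule insert.IH)
  moreover have "mob f U = g U" using insert.prems by (intro insert.IH) auto
  ultimately show ?case using insert.hyps by (simp add: mob_insert)
qed

text \<open>A function that does not notice \<open>x\<close> has difference 0 in the direction of
  \<open>x\<close>.\<close>

lemma mob_eq_0:
  assumes "finite U" "x \<in> U" "\<And>S. S \<subseteq> U \<Longrightarrow> f (insert x S) = f S"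
  shows "mob f U = 0"
proof -
  have "mob (\<lambda>S. f (insert x S)) (U - {x}) = mob f (U - {x})"
  proof (unfold mob_def, intro sum.cong refl)
    fix S assume "S \<in> Pow (U - {x})"
    then have "S \<subseteq> U" by auto
    then show "(- 1) ^ (card (U - {x}) + card S) * f (insert x S) = (- 1) ^ (card (U - {x}) + card S) * f S"
      by (simp add: assms(3))
  qed
  then show ?thesis
    using mob_insert[of "U - {x}" x f] assms(1,2) by (simp add: insert_absorb)
qed

lemma mob_cong: "(\<And>S. S \<subseteq> U \<Longrightarrow> f S = g S) \<Longrightarrow> mob f U = mob g U"
  unfolding mob_def by (intro sum.cong) auto

lemma mob_add: "mob (\<lambda>S. f S + g S) U = mob f U + mob g U"
  unfolding mob_def by (simp add: sum.distrib algebra_simps)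

lemma mob_diff: "mob (\<lambda>S. f S - g S) U = mob f U - mob g U"
  unfolding mob_def by (simp add: sum_subtractf algebra_simps)

lemma mob_cmult: "mob (\<lambda>S. c * f S) U = c * mob f U"
  unfolding mob_def by (simp add: sum_distrib_left algebra_simps)

lemma mob_setsum: "mob (\<lambda>S. \<Sum>j\<in>J. f j S) U = (\<Sum>j\<in>J. mob (f j) U)"
  unfolding mob_def by (subst sum.swap) (simp add: sum_distrib_left)

text \<open>Expanding both factors by inversion and grouping the pairs by their union shows that the
  transform of the product at \<open>U\<close> sums over all pairs with
  \<open>T1 \<union> T2 = U\<close>. A set with more than \<open>a + b\<close> elements is not a
  union of sets of sizes at most \<open>a\<close> and \<open>b\<close>, so every term has a
  vanishing factor.\<close>

lemma mob_mult_eq_0: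
  assumes fin: "finite U" and
    f: "\<And>T. T \<subseteq> U \<Longrightarrow> a < card T \<Longrightarrow> mob f T = 0" and
    g: "\<And>T. T \<subseteq> U \<Longrightarrow> b < card T \<Longrightarrow> mob g T = 0" and
    U: "a + b < card U"
  shows "mob (\<lambda>S. f S * g S) U = 0"
proof -
  define h where "h T = (\<Sum>(T1, T2)\<in>{(T1, T2)\<in>Pow T \<times> Pow T. T1 \<union> T2 = T}. mob f T1 * mob g T2)" for T
  have "f S * g S = (\<Sum>T\<in>Pow S. h T)" if S: "S \<subseteq> U" for S
  proof -
    have finS: "finite S" using fin S by (rule rev_finite_subset)
    have "f S * g S = (\<Sum>x\<in>Pow S \<times> Pow S. mob f (fst x) * mob g (snd x))"
      using sum_mob[OF finS, of f, symmetric] sum_mob[OF finS, of g, symmetric]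
      by (simp add: sum_product sum.cartesian_product case_prod_beta)
    also have "\<dots> = (\<Sum>T\<in>Pow S. \<Sum>x\<in>{x\<in>Pow S \<times> Pow S. fst x \<union> snd x = T}. mob f (fst x) * mob g (snd x))"
      using finS by (intro sum.group[symmetric]) auto
    also have "\<dots> = (\<Sum>T\<in>Pow S. h T)"
      unfolding h_def by (intro sum.cong) (auto simp: case_prod_beta)
    finally show ?thesis .
  qed
  then have "mob (\<lambda>S. f S * g S) U = h U" using fin by (intro mob_sum)
  also have "\<dots> = 0"
    unfolding h_def
  proof (intro sum.neutral ballI)
    fix x assume "x \<in> {(T1, T2) \<in> Pow U \<times> Pow U. T1 \<union> T2 = U}"
    then obtain T1 T2 where x: "x = (T1, T2)" and T: "T1 \<subseteq> U" "T2 \<subseteq> U" "U = T1 \<union> T2" by blast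
    have "card U \<le> card T1 + card T2" using T(3) card_Un_le by metis
    then have "a < card T1 \<or> b < card T2" using U by linarith
    then show "(case x of (T1, T2) \<Rightarrow> mob f T1 * mob g T2) = 0" using f[OF T(1)] g[OF T(2)] x by auto
  qed
  finally show ?thesis .
qed

section \<open>Power sums as logarithmic derivatives\<close>

context
  includes fps_syntax
begin

text \<open>The series z E'/E. If E is a product of factors 1 - x z, its coefficient at a positive k
  is minus the k-th power sum of the x. No roots are needed: a formal series with constant
  coefficient 1 is invertible.\<close>

definition psum :: "complex fps \<Rightarrow> complex fps" where
  "psum E = fps_X * fps_deriv E * inverse E"

text \<open>Newton's identities, by comparing coefficients in
  \<open>psum E * E = fps_X * fps_deriv E\<close>. The term at 0 vanishes because
  \<open>psum E\<close> has no constant coefficient, and the term at \<open>i\<close> is isolated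
  because \<open>E $ 0 = 1\<close>. The way back divides by \<open>i\<close>.\<close>

lemma psum_rec:
  assumes "E $ 0 = 1"
  shows "psum E $ i = of_nat i * E $ i - (\<Sum>j\<in>{1..<i}. psum E $ j * E $ (i - j))"
proof (cases "i = 0")
  case True
  then show ?thesis by (simp add: psum_def)
next
  case False
  have "of_nat i * E $ i = (fps_X * fps_deriv E) $ i" using False by (cases i) auto
  also have "fps_X * fps_deriv E = psum E * E"
    unfolding psum_def using assms by (simp add: mult.assoc inverse_mult_eq_1)
  also have "(psum E * E) $ i = (\<Sum>j=0..i. psum E $ j * E $ (i - j))" by (simp add: fps_mult_nth)
  also have "{0..i} = insert 0 (insert i {1..<i})" using False by auto
  also have "(\<Sum>j\<in>insert 0 (insert i {1..<i}). psum E $ j * E $ (i - j))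
      = psum E $ i + (\<Sum>j\<in>{1..<i}. psum E $ j * E $ (i - j))"
    using False assms by (simp add: psum_def)
  finally show ?thesis by simp
qed

lemma psum_mult:
  assumes "E $ 0 = 1" "F $ 0 = 1"
  shows "psum (E * F) = psum E + psum F"
proof -
  have "psum (E * F) = fps_X * fps_deriv E * inverse E * (F * inverse F)
      + fps_X * fps_deriv F * inverse F * (E * inverse E)"
    unfolding psum_def fps_deriv_mult fps_inverse_mult by (simp only: ring_distribs mult_ac add_ac)
  moreover have "E * inverse E = 1" "F * inverse F = 1"
    using assms by (simp_all add: inverse_mult_eq_1')
  ultimately show ?thesis unfolding psum_def by simp
qed

end

section \<open>Coefficients on induced subgraphs\<close>

lemma verts_induced [simp]: "verts (induced G S) = S"
  by (simp add: induced_def)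

lemma induced_induced: "T \<subseteq> S \<Longrightarrow> induced (induced G S) T = induced G T"
  by (auto simp: induced_def)

lemma simple_graph_induced:
  assumes "simple_graph G" "S \<subseteq> verts G"
  shows "simple_graph (induced G S)"
  using assms unfolding simple_graph_def induced_def
  by (auto intro: finite_subset) (metis insert_subset)

lemma induced_verts: "simple_graph G \<Longrightarrow> induced G (verts G) = G"
  by (cases G) (fastforce simp: induced_def simple_graph_def)

text \<open>Connectedness in the form of cuts. Its negation directly hands over the split needed for
  additivity, and applied to the part that a search has discovered it hands over an edge leaving
  that part; paths never occur.\<close>

definition indecomposable :: "graph \<Rightarrow> nat set \<Rightarrow> bool" where
  "indecomposable G U \<longleftrightarrow>
     (\<forall>A B. U = A \<union> B \<and> A \<inter> B = {} \<and> A \<noteq> {} \<and> B \<noteq> {} \<longrightarrow> (\<exists>a\<in>A. \<exists>b\<in>B. {a, b} \<in> edges G))"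

lemma induced_union:
  assumes "simple_graph G" "\<And>a b. a \<in> S \<Longrightarrow> b \<in> T \<Longrightarrow> {a, b} \<notin> edges G"
  shows "induced G (S \<union> T) = graph_union (induced G S) (induced G T)"
proof -
  have "e \<subseteq> S \<or> e \<subseteq> T" if "e \<in> edges G" "e \<subseteq> S \<union> T" for e
  proof -
    obtain u v where "e = {u, v}" using assms(1) \<open>e \<in> edges G\<close> unfolding simple_graph_def by blast
    then show ?thesis using assms(2)[of u v] assms(2)[of v u] that by (auto simp: insert_commute)
  qed
  then show ?thesis by (auto simp: induced_def graph_union_def)
qed

locale bigcp =
  fixes \<kappa> \<alpha> :: nat and \<beta> :: "nat \<Rightarrow> nat" and p :: "graph \<Rightarrow> complex poly"
    and lam :: "graph \<Rightarrow> nat \<Rightarrow> complex" and Q :: com and G :: graph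
  assumes bigcp: "BIGCP \<kappa> \<alpha> \<beta> p lam Q" and simple: "simple_graph G"
begin

definition coeffs_on :: "nat set \<Rightarrow> complex fps" where
  "coeffs_on S = fps_of_poly (p (induced G S))"

definition power_sum :: "nat \<Rightarrow> nat set \<Rightarrow> complex" where
  "power_sum i S = fps_nth (psum (coeffs_on S)) i"

lemma finite_verts: "finite (verts G)"
  using simple by (simp add: simple_graph_def)

lemma lam_iso: "simple_graph H \<Longrightarrow> simple_graph H' \<Longrightarrow> iso H H' \<Longrightarrow> lam H = lam H'"
  using bigcp unfolding BIGCP_def by blast

lemma coeffs_on_0: "S \<subseteq> verts G \<Longrightarrow> fps_nth (coeffs_on S) 0 = 1"
  using bigcp simple_graph_induced[OF simple] unfolding BIGCP_def coeffs_on_def by simp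

text \<open>\<open>ind\<close> counts the vertex sets of each isomorphism type, so the sum over
  types can be regrouped as a sum over vertex sets, with \<open>lam\<close> evaluated at the induced
  subgraph. This is the form to which \<open>mob_sum\<close> applies.\<close>

lemma coeffs_on_eq:
  assumes S: "S \<subseteq> verts G" and i: "i \<ge> 1"
  shows "fps_nth (coeffs_on S) i = (\<Sum>T\<in>Pow S. if card T \<le> \<alpha> * i then lam (induced G T) i else 0)"
proof -
  have fin: "finite S" using S finite_verts by (rule finite_subset)
  have sg: "simple_graph (induced G T)" if "T \<subseteq> S" for T
    using that S by (intro simple_graph_induced simple) auto
  let ?A = "{T\<in>Pow S. card T \<le> \<alpha> * i}"
  have "fps_nth (coeffs_on S) i = (\<Sum>H\<in>iso_types (\<alpha> * i). lam H i * of_nat (ind H (induced G S)))"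
    using bigcp i sg[of S] unfolding BIGCP_def coeffs_on_def by simp
  also have "\<dots> = (\<Sum>H\<in>iso_types (\<alpha> * i). \<Sum>T\<in>{T\<in>?A. canon (induced G T) = H}. lam (induced G T) i)"
  proof (intro sum.cong refl)
    fix H assume "H \<in> iso_types (\<alpha> * i)"
    then obtain H' where H': "simple_graph H'" "card (verts H') \<le> \<alpha> * i" "H = canon H'"
      unfolding iso_types_def by blast
    have "T \<in> {T \<in> ?A. canon (induced G T) = H} \<longleftrightarrow> T \<subseteq> S \<and> iso (induced G T) H" for T
    proof (cases "T \<subseteq> S")
      case True
      have "canon (induced G T) = H \<longleftrightarrow> iso (induced G T) H'"
        unfolding H'(3) by (rule canon_eq_iff[OF sg[OF True] H'(1)])
      also have "\<dots> \<longleftrightarrow> iso (induced G T) H"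
        using canon_props(3)[OF H'(1)] unfolding H'(3) by (metis iso_sym iso_trans)
      moreover have "card T = card (verts H')" if "iso (induced G T) H'"
        using that unfolding iso_def by (auto dest: bij_betw_same_card)
      ultimately show ?thesis using True H'(2) by auto
    qed auto
    then have eq: "{T \<in> ?A. canon (induced G T) = H} = {T. T \<subseteq> S \<and> iso (induced G T) H}" by blast
    have "lam (induced G T) i = lam H i" if "T \<subseteq> S" "iso (induced G T) H" for T
      using lam_iso[OF sg _ that(2)] canon_props(1)[OF H'(1)] that H'(3) by simp
    then have "(\<Sum>T\<in>{T\<in>?A. canon (induced G T) = H}. lam (induced G T) i)
        = (\<Sum>T\<in>{T. T \<subseteq> S \<and> iso (induced G T) H}. lam H i)"
      unfolding eq by (intro sum.cong) auto
    moreover have "ind H (induced G S) = card {T. T \<subseteq> S \<and> iso (induced G T) H}"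
      unfolding ind_def by (intro arg_cong[where f = card]) (auto simp: induced_induced)
    ultimately show "lam H i * of_nat (ind H (induced G S))
        = (\<Sum>T\<in>{T\<in>?A. canon (induced G T) = H}. lam (induced G T) i)" by simp
  qed
  also have "\<dots> = (\<Sum>T\<in>?A. lam (induced G T) i)"
    using fin sg by (intro sum.group finite_iso_types) (auto simp: iso_types_def)
  also have "\<dots> = (\<Sum>T\<in>Pow S. if card T \<le> \<alpha> * i then lam (induced G T) i else 0)"
    using fin by (intro sum.mono_neutral_cong_left) auto
  finally show ?thesis .
qed

text \<open>By \<open>mob_sum\<close> the transform at \<open>U\<close> is the single summand of
  \<open>coeffs_on_eq\<close> belonging to \<open>U\<close>.\<close>

lemma mob_coeffs_on_eq_0:
  assumes "U \<subseteq> verts G" "i \<ge> 1" "\<alpha> * i < card U"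
  shows "mob (\<lambda>S. fps_nth (coeffs_on S) i) U = 0"
proof -
  have "mob (\<lambda>S. fps_nth (coeffs_on S) i) U = (if card U \<le> \<alpha> * i then lam (induced G U) i else 0)"
    using assms(1,2) finite_verts by (intro mob_sum coeffs_on_eq) (auto intro: finite_subset)
  then show ?thesis using assms(3) by simp
qed

text \<open>Strong induction through Newton's identities: a product of the \<open>j\<close>-th power
  sum and the \<open>(i - j)\<close>-th coefficient has size bound
  \<open>\<alpha> * j + \<alpha> * (i - j) = \<alpha> * i\<close> by \<open>mob_mult_eq_0\<close>,
  the same as the \<open>i\<close>-th coefficient itself.\<close>

lemma mob_power_sum_eq_0_large:
  assumes "U \<subseteq> verts G" "\<alpha> * i < card U"
  shows "mob (power_sum i) U = 0"
  using assms
proof (induction i arbitrary: U rule: less_induct)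
  case (less i)
  show ?case
  proof (cases "i = 0")
    case True
    then show ?thesis by (simp add: mob_def power_sum_def psum_def)
  next
    case False
    have "mob (power_sum i) U = mob (\<lambda>S. of_nat i * fps_nth (coeffs_on S) i
        - (\<Sum>j\<in>{1..<i}. power_sum j S * fps_nth (coeffs_on S) (i - j))) U"
      unfolding power_sum_def using less.prems(1) coeffs_on_0 psum_rec by (intro mob_cong) auto
    also have "\<dots> = of_nat i * mob (\<lambda>S. fps_nth (coeffs_on S) i) U
        - (\<Sum>j\<in>{1..<i}. mob (\<lambda>S. power_sum j S * fps_nth (coeffs_on S) (i - j)) U)"
      by (simp only: mob_diff mob_setsum mob_cmult)
    also have "\<dots> = 0"
    proof -
      have "mob (\<lambda>S. power_sum j S * fps_nth (coeffs_on S) (i - j)) U = 0" if j: "j \<in> {1..<i}" for j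
      proof (rule mob_mult_eq_0)
        show "finite U" using less.prems(1) finite_verts by (rule finite_subset)
        show "mob (power_sum j) T = 0" if "T \<subseteq> U" "\<alpha> * j < card T" for T
          using that j less.prems(1) by (intro less.IH) auto
        show "mob (\<lambda>S. fps_nth (coeffs_on S) (i - j)) T = 0" if "T \<subseteq> U" "\<alpha> * (i - j) < card T" for T
          using that j less.prems(1) by (intro mob_coeffs_on_eq_0) auto
        show "\<alpha> * j + \<alpha> * (i - j) < card U"
          using j less.prems(2) by (simp add: diff_mult_distrib2)
      qed
      then show ?thesis using mob_coeffs_on_eq_0[of U i] less.prems False by simp
    qed
    finally show ?thesis .
  qed
qed

lemma power_sum_union:
  assumes "S \<union> T \<subseteq> verts G" "S \<inter> T = {}" "\<And>a b. a \<in> S \<Longrightarrow> b \<in> T \<Longrightarrow> {a, b} \<notin> edges G"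
  shows "power_sum i (S \<union> T) = power_sum i S + power_sum i T"
proof -
  have un: "induced G (S \<union> T) = graph_union (induced G S) (induced G T)"
    using simple assms(3) by (rule induced_union)
  have "p (induced G (S \<union> T)) = p (induced G S) * p (induced G T)"
    unfolding un
    using bigcp simple_graph_induced[OF simple, of S] simple_graph_induced[OF simple, of T] assms(1,2)
    unfolding BIGCP_def multiplicative_def by simp
  then have "coeffs_on (S \<union> T) = coeffs_on S * coeffs_on T"
    by (simp add: coeffs_on_def fps_of_poly_mult)
  then show ?thesis using assms(1) by (simp add: power_sum_def psum_mult coeffs_on_0)
qed

text \<open>On subsets of \<open>U\<close> the power sum splits into a function of
  \<open>S \<inter> A\<close>, which does not notice any element of \<open>B\<close>, and a function
  of \<open>S \<inter> B\<close>, which does not notice any element of \<open>A\<close>. Both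
  transforms vanish by \<open>mob_eq_0\<close>.\<close>

lemma mob_power_sum_eq_0_decomposable:
  assumes U: "U \<subseteq> verts G" and "\<not> indecomposable G U"
  shows "mob (power_sum i) U = 0"
proof -
  obtain A B where AB: "U = A \<union> B" "A \<inter> B = {}" "A \<noteq> {}" "B \<noteq> {}"
    and E: "\<And>a b. a \<in> A \<Longrightarrow> b \<in> B \<Longrightarrow> {a, b} \<notin> edges G"
    using assms(2) unfolding indecomposable_def by blast
  have fin: "finite U" using U finite_verts by (rule finite_subset)
  obtain a b where ab: "a \<in> A" "b \<in> B" using AB by blast
  have "power_sum i S = power_sum i (S \<inter> A) + power_sum i (S \<inter> B)" if "S \<subseteq> U" for S
  proof -
    have S: "(S \<inter> A) \<union> (S \<inter> B) = S" using that AB(1) by blast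
    have "power_sum i ((S \<inter> A) \<union> (S \<inter> B)) = power_sum i (S \<inter> A) + power_sum i (S \<inter> B)"
      using S E AB(2) U that by (intro power_sum_union) auto
    then show ?thesis unfolding S .
  qed
  then have "mob (power_sum i) U = mob (\<lambda>S. power_sum i (S \<inter> A) + power_sum i (S \<inter> B)) U"
    by (rule mob_cong)
  also have "\<dots> = mob (\<lambda>S. power_sum i (S \<inter> A)) U + mob (\<lambda>S. power_sum i (S \<inter> B)) U"
    by (rule mob_add)
  also have "mob (\<lambda>S. power_sum i (S \<inter> A)) U = 0"
    using ab AB by (intro mob_eq_0[OF fin, of b]) (auto simp: Int_insert_left)
  also have "mob (\<lambda>S. power_sum i (S \<inter> B)) U = 0"
    using ab AB by (intro mob_eq_0[OF fin, of a]) (auto simp: Int_insert_left)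
  finally show ?thesis by simp
qed

text \<open>\<open>F\<close> only has to contain the sets that can contribute; further members add
  0. So an enumeration of \<open>F\<close> has to be complete but need not be exact.\<close>

lemma power_sum_verts:
  assumes F: "F \<subseteq> Pow (verts G)" "\<alpha> * i \<le> K"
    "\<And>U. U \<subseteq> verts G \<Longrightarrow> U \<noteq> {} \<Longrightarrow> card U \<le> K \<Longrightarrow> indecomposable G U \<Longrightarrow> U \<in> F"
  shows "power_sum i (verts G) = (\<Sum>U\<in>F. mob (power_sum i) U)"
proof -
  have "mob (power_sum i) {} = 0"
  proof -
    \<comment> \<open>Additivity for the empty union reads s = s + s, which forces s = 0 on the
      empty set.\<close>
    have "power_sum i ({} \<union> {}) = power_sum i {} + power_sum i {}" by (rule power_sum_union) auto
    then show ?thesis by (simp add: mob_def)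
  qed
  then have "mob (power_sum i) U = 0" if "U \<in> Pow (verts G) - F" for U
    using that assms mob_power_sum_eq_0_large mob_power_sum_eq_0_decomposable
    by (metis DiffD1 DiffD2 PowD le_trans linorder_not_le)
  then show ?thesis
    unfolding sum_mob[OF finite_verts, symmetric] using finite_verts F(1)
    by (intro sum.mono_neutral_right) auto
qed

lemma coeff_eq: "coeff (p G) i = fps_nth (coeffs_on (verts G)) i"
  by (simp add: coeffs_on_def induced_verts simple)

end

section \<open>Enumeration of subsets\<close>

text \<open>Increasing lists are enumerated depth first, every list before its extensions. On a stack the successor
  then takes a bounded number of operations, and the enumeration needs no memory besides the current list.\<close>

primrec incs :: "nat \<Rightarrow> nat \<Rightarrow> nat \<Rightarrow> nat list list" where
  "incs u 0 a = [[]]"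
| "incs u (Suc c) a = [] # concat (map (\<lambda>x. map ((#) x) (incs u c x)) [Suc a..<Suc u])"

lemma incs_not_Nil [simp]: "incs u c a \<noteq> []"
  by (cases c) auto

lemma hd_incs [simp]: "hd (incs u c a) = []"
  by (cases c) auto

text \<open>\<open>a\<close> acts as a strict lower bound, which is what the recursion hands down.
  At \<open>a = 0\<close> all entries are positive, so 0 stays free as a marker below a
  stack.\<close>

lemma set_incs: "set (incs u c a) = {xs. sorted_wrt (<) (a # xs) \<and> set xs \<subseteq> {..u} \<and> length xs \<le> c}"
proof (induction c arbitrary: a)
  case (Suc c)
  have "xs \<in> set (incs u (Suc c) a) \<longleftrightarrow> sorted_wrt (<) (a # xs) \<and> set xs \<subseteq> {..u} \<and> length xs \<le> Suc c" for xs
  proof (cases xs)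
    case (Cons y ys)
    have "xs \<in> set (incs u (Suc c) a) \<longleftrightarrow> y \<in> {Suc a..<Suc u} \<and> ys \<in> set (incs u c y)"
      unfolding Cons by (auto simp del: upt_Suc)
    also have "\<dots> \<longleftrightarrow> sorted_wrt (<) (a # xs) \<and> set xs \<subseteq> {..u} \<and> length xs \<le> Suc c"
      unfolding Cons Suc.IH by auto
    finally show ?thesis .
  qed simp
  then show ?case by blast
qed auto

lemma distinct_incs: "distinct (incs u c a)"
proof (induction c arbitrary: a)
  case (Suc c)
  have "distinct (concat (map (\<lambda>x. map ((#) x) (incs u c x)) xs))" if "distinct xs" for xs
    using that
  proof (induction xs)
    case (Cons x xs)
    then show ?case using Suc.IH[of x] by (auto simp: distinct_map)
  qed simp
  then show ?case by (auto simp del: upt_Suc)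
qed simp

text \<open>One removal is enough: the entries increase strictly, so once a last entry
  \<open>u\<close> is removed, the entry before it is below \<open>u\<close> and can be
  incremented.\<close>

definition next_inc :: "nat \<Rightarrow> nat \<Rightarrow> nat \<Rightarrow> nat list \<Rightarrow> nat list option" where
  "next_inc u c a xs =
     (if length xs < c \<and> last (a # xs) < u then Some (xs @ [Suc (last (a # xs))])
      else let ys = (if xs \<noteq> [] \<and> last xs = u then butlast xs else xs)
        in if ys = [] then None else Some (butlast ys @ [Suc (last ys)]))"

text \<open>The successor acts on the tail until the tail is exhausted, and then moves the head.
  This mirrors the recursion of \<open>incs\<close>.\<close>

lemma next_inc_Cons:
  assumes "sorted_wrt (<) (x # xs)" "set (x # xs) \<subseteq> {..u}"
  shows "next_inc u (Suc c) a (x # xs) = (case next_inc u c x xs of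
     Some ys \<Rightarrow> Some (x # ys) | None \<Rightarrow> if x < u then Some [Suc x] else None)"
proof (cases xs rule: rev_cases)
  case Nil
  then show ?thesis using assms by (auto simp: next_inc_def)
next
  case (snoc zs z)
  then have "x < z" "z \<le> u" using assms by (auto simp: sorted_wrt_append)
  then show ?thesis using snoc by (cases zs rule: rev_cases) (auto simp: next_inc_def Let_def)
qed

lemma successively_incs:
  "successively (\<lambda>xs ys. next_inc u c a xs = Some ys) (incs u c a) \<and> next_inc u c a (last (incs u c a)) = None"
proof (induction c arbitrary: a)
  case 0
  then show ?case by (simp add: next_inc_def)
next
  case (Suc c)
  let ?R = "\<lambda>xs ys. next_inc u (Suc c) a xs = Some ys"
  \<comment> \<open>\<open>L x\<close> is the part of the enumeration whose lists begin with an
    entry at least \<open>x\<close>, so that the claim can be proved by downward induction on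
    \<open>x\<close> from \<open>u\<close>.\<close>
  define L where "L x = concat (map (\<lambda>x. map ((#) x) (incs u c x)) [x..<Suc u])" for x
  \<comment> \<open>The equation with the constantly false predicate says that the last list has no
    successor.\<close>
  have "successively ?R (L x) \<and> (x \<le> u \<longrightarrow> hd (L x) = [x] \<and> L x \<noteq> [] \<and> ?R (last (L x)) = (\<lambda>ys. False))"
    for x
  proof (cases "x \<le> u")
    case False
    then show ?thesis by (simp add: L_def)
  next
    case True
    then show ?thesis
    proof (induction x rule: inc_induct)
      case base
      have "incs u c u = [[]]" by (cases c) auto
      then have "L u = [[u]]" by (simp add: L_def)
      then show ?case by (auto simp: next_inc_def)
    next
      case (step x)
      define M where "M = map ((#) x) (incs u c x)"
      have Lx: "L x = M @ L (Suc x)"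
        using step.hyps unfolding L_def M_def by (simp add: upt_conv_Cons del: upt_Suc)
      have R: "next_inc u (Suc c) a (x # xs) = (case next_inc u c x xs of
          Some ys \<Rightarrow> Some (x # ys) | None \<Rightarrow> if x < u then Some [Suc x] else None)"
        if "xs \<in> set (incs u c x)" for xs
        using that step.hyps by (intro next_inc_Cons) (auto simp: set_incs)
      have "successively ?R M"
        unfolding M_def successively_map
        by (rule successively_mono[OF conjunct1[OF Suc.IH]]) (simp add: R)
      moreover have "?R (last M) (hd (L (Suc x)))"
        using R[of "last (incs u c x)"] conjunct2[OF Suc.IH[of x]] step
        by (simp add: M_def last_map)
      moreover have "hd M = [x]" "M \<noteq> []" by (simp_all add: M_def hd_map)
      ultimately show ?case using step by (auto simp: Lx successively_append_iff)
    qed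
  qed
  note L = this
  have inc: "incs u (Suc c) a = [] # L (Suc a)" by (simp add: L_def del: upt_Suc)
  show ?case
  proof (cases "a < u")
    case True
    then have "?R [] [Suc a]" by (simp add: next_inc_def)
    then show ?thesis using L[of "Suc a"] True unfolding inc
      by (auto simp: successively_Cons fun_eq_iff)
  next
    case False
    then show ?thesis by (simp add: next_inc_def)
  qed
qed

lemma bij_betw_set_incs: "bij_betw set (set (incs u c 0)) {A. A \<subseteq> {1..u} \<and> card A \<le> c}"
proof (rule bij_betwI[where g = sorted_list_of_set])
  show "set \<in> set (incs u c 0) \<rightarrow> {A. A \<subseteq> {1..u} \<and> card A \<le> c}"
  proof (intro Pi_I CollectI conjI)
    fix xs assume xs: "xs \<in> set (incs u c 0)"
    then show "set xs \<subseteq> {1..u}" by (auto simp: set_incs Suc_le_eq)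
    have "card (set xs) \<le> length xs" by (rule card_length)
    then show "card (set xs) \<le> c" using xs by (auto simp: set_incs)
  qed
  show "sorted_list_of_set \<in> {A. A \<subseteq> {1..u} \<and> card A \<le> c} \<rightarrow> set (incs u c 0)"
  proof (intro Pi_I)
    fix A assume A: "A \<in> {A. A \<subseteq> {1..u} \<and> card A \<le> c}"
    then have "finite A" by (auto intro: finite_subset)
    then show "sorted_list_of_set A \<in> set (incs u c 0)"
      using A by (fastforce simp: set_incs)
  qed
  fix xs assume "xs \<in> set (incs u c 0)"
  then have "sorted_wrt (<) xs" by (auto simp: set_incs)
  then show "sorted_list_of_set (set xs) = xs"
    by (simp add: sorted_list_of_set_sort_remdups strict_sorted_iff sorted_sort_id distinct_remdups_id)
next
  fix A assume "A \<in> {A. A \<subseteq> {1..u} \<and> card A \<le> c}"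
  then have "finite A" by (auto intro: finite_subset)
  then show "set (sorted_list_of_set A) = A" by simp
qed

lemma sum_incs:
  fixes g :: "nat set \<Rightarrow> 'b::comm_monoid_add"
  shows "(\<Sum>xs\<leftarrow>incs u c 0. g (set xs)) = (\<Sum>A | A \<subseteq> {1..u} \<and> card A \<le> c. g A)"
  unfolding sum_list_distinct_conv_sum_set[OF distinct_incs]
  using sum.reindex_bij_betw[OF bij_betw_set_incs, of g u c] .

section \<open>Counting the enumerated lists\<close>

lemma length_incs: "length (incs u c 0) = (\<Sum>t\<le>c. u choose t)"
proof -
  have "length (incs u c 0) = card {A. A \<subseteq> {1..u} \<and> card A \<le> c}"
    using sum_incs[of "\<lambda>_. 1::nat" u c] by (simp add: sum_list_triv)
  also have "{A. A \<subseteq> {1..u} \<and> card A \<le> c} = (\<Union>t\<in>{..c}. {A. A \<subseteq> {1..u} \<and> card A = t})" by auto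
  also have "card \<dots> = (\<Sum>t\<le>c. card {A. A \<subseteq> {1..u} \<and> card A = t})"
    by (intro card_UN_disjoint) (auto intro: finite_subset[of _ "Pow {1..u}"])
  also have "\<dots> = (\<Sum>t\<le>c. u choose t)" by (simp add: n_subsets)
  finally show ?thesis .
qed

text \<open>\<open>x ^ t / fact t\<close> is one term of the exponential series, whose terms are all
  non-negative here.\<close>

lemma power_le_fact_exp:
  fixes x :: real
  assumes "x \<ge> 0"
  shows "x ^ t \<le> fact t * exp x"
proof -
  have "(\<Sum>k\<in>{t}. x ^ k /\<^sub>R fact k) \<le> (\<Sum>k. x ^ k /\<^sub>R fact k)"
    using assms by (intro sum_le_suminf sums_summable[OF exp_converges]) auto
  then have "x ^ t / fact t \<le> exp x" by (simp add: exp_def divide_inverse mult.commute)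
  then show ?thesis by (simp add: divide_le_eq mult.commute)
qed

text \<open>Each binomial coefficient is at most \<open>(K * D) ^ t / fact t\<close>; the factor
  \<open>K\<close> counts the lengths \<open>t\<close> from 0 to \<open>K - 1\<close>.\<close>

lemma length_incs_le:
  assumes "K \<ge> 1" "D \<ge> 1"
  shows "real (length (incs (K * D) (K - 1) 0)) \<le> real K * (exp 1 * real D) ^ K"
proof -
  have "real ((K * D) choose t) \<le> (exp 1 * real D) ^ K" if "t \<le> K - 1" for t
  proof -
    have "real ((K * D) choose t) * fact t \<le> real K ^ t * real D ^ t"
    proof -
      have "real (((K * D) choose t) * fact t) \<le> real ((K * D) ^ t)"
        by (rule of_nat_mono[OF binomial_fact_pow])
      then show ?thesis by (simp add: power_mult_distrib)
    qed
    also have "\<dots> \<le> (fact t * exp (real K)) * real D ^ K"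
      using assms that by (intro mult_mono power_le_fact_exp power_increasing) auto
    finally have "real ((K * D) choose t) \<le> exp (real K) * real D ^ K"
      by (simp add: mult.assoc mult.commute[of _ "fact t"])
    moreover have "exp (real K) = exp 1 ^ K" using exp_of_nat_mult[of K "1::real"] by simp
    ultimately show ?thesis by (simp add: power_mult_distrib)
  qed
  then have "(\<Sum>t\<le>K - 1. real ((K * D) choose t)) \<le> (\<Sum>t\<le>K - 1. (exp 1 * real D) ^ K)"
    by (intro sum_mono) auto
  then show ?thesis using assms by (simp add: length_incs)
qed

text \<open>Positions are counted from 1 because the enumerated lists have positive entries.\<close>

definition pick :: "'a list \<Rightarrow> nat list \<Rightarrow> 'a list" where
  "pick zs xs = map (\<lambda>i. zs ! (i - 1)) xs"

lemma length_pick [simp]: "length (pick zs xs) = length xs"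
  by (simp add: pick_def)

lemma bij_betw_nth_pred: "distinct zs \<Longrightarrow> bij_betw (\<lambda>i. zs ! (i - 1)) {1..length zs} (set zs)"
proof -
  assume "distinct zs"
  moreover have "bij_betw (\<lambda>i. i - 1) {1..length zs} {..<length zs}"
    by (rule bij_betwI[where g = Suc]) auto
  ultimately show ?thesis
    using bij_betw_trans[of "\<lambda>i. i - 1" "{1..length zs}" "{..<length zs}" "(!) zs" "set zs"]
    by (simp add: bij_betw_nth comp_def)
qed

lemma pick_props:
  assumes "distinct zs" "xs \<in> set (incs (length zs) c 0)"
  shows "distinct (pick zs xs)" "set (pick zs xs) \<subseteq> set zs" "card (set (pick zs xs)) = length xs"
proof -
  have xs: "set xs \<subseteq> {1..length zs}" "distinct xs"
    using assms(2) bij_betwE[OF bij_betw_set_incs] by (auto simp: set_incs strict_sorted_iff)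
  show "distinct (pick zs xs)"
    using xs bij_betw_imp_inj_on[OF bij_betw_nth_pred[OF assms(1)]]
    by (auto simp: pick_def distinct_map intro: inj_on_subset)
  then show "card (set (pick zs xs)) = length xs" by (simp add: distinct_card)
  show "set (pick zs xs) \<subseteq> set zs"
    using xs(1) bij_betwE[OF bij_betw_nth_pred[OF assms(1)]] by (auto simp: pick_def)
qed

lemma sum_pick:
  fixes g :: "'a set \<Rightarrow> 'b::comm_monoid_add"
  assumes "distinct zs"
  shows "(\<Sum>xs\<leftarrow>incs (length zs) (length zs) 0. g (set (pick zs xs))) = (\<Sum>A\<in>Pow (set zs). g A)"
proof -
  let ?f = "\<lambda>i. zs ! (i - 1)"
  have "(\<Sum>xs\<leftarrow>incs (length zs) (length zs) 0. g (set (pick zs xs)))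
      = (\<Sum>A | A \<subseteq> {1..length zs} \<and> card A \<le> length zs. g (?f ` A))"
    using sum_incs[of "\<lambda>A. g (?f ` A)"] by (simp add: pick_def)
  also have "{A. A \<subseteq> {1..length zs} \<and> card A \<le> length zs} = Pow {1..length zs}"
    using card_mono[of "{1..length zs}"] by auto
  also have "(\<Sum>A\<in>Pow {1..length zs}. g (?f ` A)) = (\<Sum>A\<in>Pow (set zs). g A)"
    by (intro sum.reindex_bij_betw bij_betw_Pow bij_betw_nth_pred assms)
  finally show ?thesis .
qed

lemma sum_Pow_power_card:
  fixes a :: nat
  assumes "finite U"
  shows "(\<Sum>S\<in>Pow U. a ^ card S) = (a + 1) ^ card U"
  using assms
proof (induction U rule: finite_induct)
  case (insert x U)
  have "(\<Sum>S\<in>Pow U. a ^ card (insert x S)) = (\<Sum>S\<in>Pow U. a * a ^ card S)"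
  proof (intro sum.cong refl)
    fix S assume "S \<in> Pow U"
    then have "finite S" "x \<notin> S" using insert.hyps(1,2) finite_subset by blast+
    then show "a ^ card (insert x S) = a * a ^ card S" by simp
  qed
  also have "\<dots> = a * (\<Sum>S\<in>Pow U. a ^ card S)" by (simp add: sum_distrib_left)
  finally show ?case using insert by (simp add: sum_Pow_insert)
qed simp

text \<open>A form of the binomial theorem. With \<open>a = 1\<close> it counts subsets, with
  \<open>a = 2\<close> it counts nested pairs of subsets, which gives the base 3 in the running
  time.\<close>

lemma sum_power_length_incs: "(\<Sum>xs\<leftarrow>incs k k 0. (a::nat) ^ length xs) = (a + 1) ^ k"
proof -
  have "(\<Sum>xs\<leftarrow>incs k k 0. a ^ length xs) = (\<Sum>xs\<leftarrow>incs k k 0. a ^ card (set xs))"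
  proof (intro arg_cong[where f = sum_list] map_cong refl)
    fix xs assume "xs \<in> set (incs k k 0)"
    then have "distinct xs" unfolding set_incs strict_sorted_iff by simp
    then show "a ^ length xs = a ^ card (set xs)" by (simp add: distinct_card)
  qed
  also have "\<dots> = (\<Sum>A | A \<subseteq> {1..k} \<and> card A \<le> k. a ^ card A)"
    by (rule sum_incs[of "\<lambda>A. a ^ card A"])
  also have "{A. A \<subseteq> {1..k} \<and> card A \<le> k} = Pow {1..k}"
    using card_mono[of "{1..k}"] by auto
  also have "(\<Sum>A\<in>Pow {1..k}. a ^ card A) = (a + 1) ^ k" by (simp add: sum_Pow_power_card)
  finally show ?thesis .
qed

section \<open>Breadth-first codes of connected vertex sets\<close>

text \<open>A slot \<open>y \<ge> 1\<close> stands for neighbour \<open>(y - 1) mod D\<close> of the vertex discovered at position \<open>(y - 1) div D\<close>.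
  The two last conditions say that the new vertex was not reachable from an earlier slot, which makes the
  code of a vertex set unique; \<open>v < x\<close> makes the root unique.\<close>

definition bfs_step :: "nat list list \<Rightarrow> nat \<Rightarrow> nat \<Rightarrow> nat list \<Rightarrow> nat \<Rightarrow> nat list option" where
  "bfs_step xss D v L y =
     (let i = (y - 1) div D; j = (y - 1) mod D; x = xss ! (L ! i) ! j
      in if i < length L \<and> j < length (xss ! (L ! i)) \<and> v < x \<and> x \<notin> set L \<and>
            (\<forall>i'<i. x \<notin> set (xss ! (L ! i')))
         then Some (L @ [x]) else None)"

definition decode :: "nat list list \<Rightarrow> nat \<Rightarrow> nat \<Rightarrow> nat list \<Rightarrow> nat list option" where
  "decode xss D v ys = foldl (\<lambda>r y. Option.bind r (\<lambda>L. bfs_step xss D v L y)) (Some [v]) ys"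

lemma decode_Nil [simp]: "decode xss D v [] = Some [v]"
  by (simp add: decode_def)

lemma decode_snoc: "decode xss D v (ys @ [y]) = Option.bind (decode xss D v ys) (\<lambda>L. bfs_step xss D v L y)"
  by (simp add: decode_def)

lemma bfs_step_SomeE:
  assumes "bfs_step xss D v L y = Some L'"
  obtains i j x where "i = (y - 1) div D" "j = (y - 1) mod D" "i < length L"
    "j < length (xss ! (L ! i))" "x = xss ! (L ! i) ! j" "v < x" "x \<notin> set L"
    "\<And>i'. i' < i \<Longrightarrow> x \<notin> set (xss ! (L ! i'))" "L' = L @ [x]"
  using assms unfolding bfs_step_def Let_def by (auto split: if_splits)

text \<open>All later vertices exceed the root, so the root is the minimum of the decoded set and
  can be recovered from it.\<close>

lemma decode_props:
  assumes "decode xss D v ys = Some L"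
  shows "length L = Suc (length ys) \<and> distinct L \<and> v \<in> set L \<and> (\<forall>x\<in>set L. v \<le> x)"
  using assms
proof (induction ys arbitrary: L rule: rev_induct)
  case (snoc y ys)
  then obtain L0 where L0: "decode xss D v ys = Some L0" "bfs_step xss D v L0 y = Some L"
    by (auto simp: decode_snoc bind_eq_Some_conv)
  from L0(2) snoc.IH[OF L0(1)] show ?case by (elim bfs_step_SomeE) auto
qed auto

lemma decode_take:
  assumes "decode xss D v ys = Some L" "k \<le> length ys"
  shows "decode xss D v (take k ys) = Some (take (Suc k) L)"
  using assms
proof (induction ys arbitrary: L rule: rev_induct)
  case (snoc y ys)
  then obtain L0 where L0: "decode xss D v ys = Some L0" "bfs_step xss D v L0 y = Some L"
    by (auto simp: decode_snoc bind_eq_Some_conv)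
  have len: "length L0 = Suc (length ys)" using decode_props[OF L0(1)] by blast
  from L0(2) obtain x where L: "L = L0 @ [x]" by (elim bfs_step_SomeE)
  show ?case
  proof (cases "k \<le> length ys")
    case True
    then show ?thesis using snoc.IH[OF L0(1)] len L by simp
  next
    case False
    then have "k = Suc (length ys)" using snoc.prems by simp
    then show ?thesis using snoc.prems(1) L len by simp
  qed
qed auto

lemma decode_nth:
  assumes "decode xss D v ys = Some L" "k < length ys"
  shows "bfs_step xss D v (take (Suc k) L) (ys ! k) = Some (take (Suc (Suc k)) L)"
  using decode_take[OF assms(1), of k] decode_take[OF assms(1), of "Suc k"] assms(2)
  by (simp add: take_Suc_conv_app_nth[of k ys] decode_snoc)

section \<open>Uniqueness and existence of codes\<close>

locale adj_lists =
  fixes G :: graph and xss :: "nat list list" and D n :: nat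
  assumes simple: "simple_graph G" and adj: "adjacency_lists G xss"
    and deg: "max_degree_at_most G D" and card_verts: "card (verts G) = n"
begin

lemma length_xss: "length xss = n" and verts_eq: "verts G = {..<n}"
  using adj card_verts by (auto simp: adjacency_lists_def)

lemma set_nth: "v < n \<Longrightarrow> set (xss ! v) = {u. {u, v} \<in> edges G}"
  and distinct_nth: "v < n \<Longrightarrow> distinct (xss ! v)"
  using adj length_xss by (auto simp: adjacency_lists_def nbrs_def)

lemma edge_less: "{u, v} \<in> edges G \<Longrightarrow> u < n \<and> v < n \<and> u \<noteq> v"
  using simple unfolding simple_graph_def verts_eq by (fastforce simp: doubleton_eq_iff)

lemma length_nth_le: "v < n \<Longrightarrow> length (xss ! v) \<le> D"
  using deg set_nth[of v] distinct_card[OF distinct_nth[of v]]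
  by (metis lessThan_iff max_degree_at_most_def nbrs_def verts_eq)

lemma nth_nth_less: "v < n \<Longrightarrow> j < length (xss ! v) \<Longrightarrow> xss ! v ! j < n"
  using set_nth[of v] nth_mem[of j "xss ! v"] edge_less by auto

lemma decode_less:
  assumes "decode xss D v ys = Some L" "v < n"
  shows "set L \<subseteq> {..<n}"
  using assms
proof (induction ys arbitrary: L rule: rev_induct)
  case (snoc y ys)
  then obtain L0 where L0: "decode xss D v ys = Some L0" "bfs_step xss D v L0 y = Some L"
    by (auto simp: decode_snoc bind_eq_Some_conv)
  then have "set L0 \<subseteq> {..<n}" using snoc by blast
  with L0(2) show ?case
    by (elim bfs_step_SomeE) (auto intro!: nth_nth_less simp: subset_iff)
qed auto

text \<open>Let \<open>x\<close> be the vertex found by the smaller slot at the first difference. If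
  the other run also finds \<open>x\<close>, it does so later and by a larger slot. From the same
  position that is impossible, as adjacency lists have no repetitions; from a later position it is
  forbidden, as \<open>x\<close> is a neighbour of an earlier one.\<close>

lemma decode_set_less:
  assumes L: "decode xss D v ys = Some L" and L': "decode xss D v ys' = Some L'" and v: "v < n"
    and sorted: "sorted_wrt (<) ys'"
    and k: "k < length ys" "k < length ys'" "take k ys = take k ys'" "0 < ys ! k" "ys ! k < ys' ! k"
  shows "set L \<noteq> set L'"
proof
  assume eq: "set L = set L'"
  have len: "length L = Suc (length ys)" "length L' = Suc (length ys')"
    using decode_props[OF L] decode_props[OF L'] by auto
  have tk: "take (Suc k) L = take (Suc k) L'"
    using decode_take[OF L, of k] decode_take[OF L', of k] k by simp
  have lt: "L' ! i = L ! i" if "i \<le> k" for i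
    using tk that len k nth_take[of i "Suc k" L] nth_take[of i "Suc k" L'] by simp
  obtain i j x where x: "i = (ys ! k - 1) div D" "j = (ys ! k - 1) mod D" "i \<le> k"
      "j < length (xss ! (L ! i))" "x = xss ! (L ! i) ! j" "x \<notin> set (take (Suc k) L)"
      "take (Suc (Suc k)) L = take (Suc k) L @ [x]"
    using decode_nth[OF L k(1)] len k by (elim bfs_step_SomeE) auto
  have "x \<in> set (take (Suc (Suc k)) L)" unfolding x(7) by simp
  then have "x \<in> set L'" using eq set_take_subset by fastforce
  then obtain l' where l': "l' < length L'" "L' ! l' = x" by (auto simp: in_set_conv_nth)
  \<comment> \<open>\<open>x\<close> lies outside the common prefix, so the second run discovers it
    at some step \<open>l \<ge> k\<close>.\<close>
  have "\<not> l' < Suc k" using x(6) l' tk by (metis in_set_conv_nth length_take min_less_iff_conj nth_take)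
  then obtain l where l: "l' = Suc l" "k \<le> l" "l < length ys'" using l' len by (cases l') auto
  obtain i' j' where x': "i' = (ys' ! l - 1) div D" "j' = (ys' ! l - 1) mod D" "i' \<le> l"
      "j' < length (xss ! (L' ! i'))" "x = xss ! (L' ! i') ! j'"
      "\<And>i''. i'' < i' \<Longrightarrow> x \<notin> set (xss ! (L' ! i''))"
  proof -
    have "take (Suc (Suc l)) L' = take (Suc l) L' @ [x]"
      using l l' len by (simp add: take_Suc_conv_app_nth)
    then show thesis using decode_nth[OF L' l(3)] len l
      by (elim bfs_step_SomeE) (rule that, auto)
  qed
  have Li: "L ! i < n"
  proof -
    have "L ! i \<in> set L" using x(3) len k by (intro nth_mem) simp
    then show ?thesis using decode_less[OF L v] by auto
  qed
  \<comment> \<open>The slots of the second run increase, so step \<open>l\<close> uses a slot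
    strictly behind \<open>ys ! k\<close>.\<close>
  have "ys' ! k \<le> ys' ! l" using sorted l by (cases "k = l") (auto simp: sorted_wrt_iff_nth_less less_imp_le)
  then have less: "ys ! k - 1 < ys' ! l - 1" using k(4,5) by simp
  then have "i \<le> i'" unfolding x(1) x'(1) by (intro div_le_mono) simp
  show False
  proof (cases "i = i'")
    case True
    then have "j = j'"
      using x(4,5) x'(4,5) lt[OF x(3)] distinct_nth[OF Li] by (simp add: nth_eq_iff_index_eq)
    then have "ys ! k - 1 = ys' ! l - 1"
      using True x(1,2) x'(1,2) by (metis div_mult_mod_eq)
    then show False using less by simp
  next
    case False
    then have "x \<notin> set (xss ! (L ! i))" using x'(6)[of i] \<open>i \<le> i'\<close> lt[OF x(3)] by simp
    then show False using x(4,5) by simp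
  qed
qed

text \<open>Equal sets force equal lengths, so two different codes differ at a first common
  position, and \<open>decode_set_less\<close> applies in one of the two directions.\<close>

lemma decode_inj:
  assumes "decode xss D v ys = Some L" "decode xss D v ys' = Some L'" "v < n"
    "sorted_wrt (<) (0 # ys)" "sorted_wrt (<) (0 # ys')" "set L = set L'"
  shows "ys = ys'"
proof (rule ccontr)
  assume neq: "ys \<noteq> ys'"
  have "length L = length L'"
    using decode_props[OF assms(1)] decode_props[OF assms(2)] assms(6) by (metis distinct_card)
  then have len: "length ys = length ys'"
    using decode_props[OF assms(1)] decode_props[OF assms(2)] by simp
  define k where "k = (LEAST k. k < length ys \<and> ys ! k \<noteq> ys' ! k)"
  have "\<exists>k. k < length ys \<and> ys ! k \<noteq> ys' ! k" using neq len nth_equalityI by blast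
  from LeastI_ex[OF this] have k: "k < length ys" "ys ! k \<noteq> ys' ! k" by (simp_all add: k_def)
  have "ys ! i = ys' ! i" if "i < k" for i
    using not_less_Least[of i "\<lambda>k. k < length ys \<and> ys ! k \<noteq> ys' ! k"] that k by (auto simp: k_def)
  then have tk: "take k ys = take k ys'" using k len by (intro nth_equalityI) auto
  have "0 < ys ! k" "0 < ys' ! k" using assms(4,5) k len by auto
  then show False
    using decode_set_less[OF assms(1,2,3), of k] decode_set_less[OF assms(2,1,3), of k] assms(4-6) k tk len
    by (cases "ys ! k < ys' ! k") auto
qed

text \<open>Greedy search from the least vertex: always use the least slot that shows a vertex of
  \<open>U\<close> not yet discovered. Indecomposability provides such a slot as long as vertices
  are missing, and minimality provides the checks of \<open>bfs_step\<close>.\<close>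

lemma decode_exists:
  assumes U: "U \<subseteq> {..<n}" "U \<noteq> {}" "card U \<le> K" and ind: "indecomposable G U"
  shows "\<exists>ys\<in>set (incs (K * D) (K - 1) 0). \<exists>L. decode xss D (Min U) ys = Some L \<and> set L = U"
proof -
  let ?v = "Min U"
  have finU: "finite U" using U(1) by (auto intro: finite_subset)
  have cardU: "card U > 0" using finU U(2) by (simp add: card_gt_0_iff)
  \<comment> \<open>The last clause is saturation: up to the last slot used, every neighbour in
    \<open>U\<close> is already discovered. Slots count from 1 and \<open>i * D + j\<close> from 0,
    so the strict inequality includes the last slot itself.\<close>
  have "\<exists>ys L. decode xss D ?v ys = Some L \<and> length ys = k \<and> sorted_wrt (<) (0 # ys) \<and> set L \<subseteq> U \<and>
      (\<forall>y\<in>set ys. y \<le> k * D) \<and>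
      (\<forall>i<length L. \<forall>j<length (xss ! (L ! i)). i * D + j < last (0 # ys) \<longrightarrow> xss ! (L ! i) ! j \<in> U \<longrightarrow>
         xss ! (L ! i) ! j \<in> set L)"
    if "k < card U" for k
    using that
  proof (induction k)
    case 0
    then show ?case using finU U(2) by (intro exI[of _ "[]"] exI[of _ "[?v]"]) auto
  next
    case (Suc k)
    then obtain ys L where L: "decode xss D ?v ys = Some L" "length ys = k" "sorted_wrt (<) (0 # ys)"
      "set L \<subseteq> U" "\<forall>y\<in>set ys. y \<le> k * D"
      and sat: "\<And>i j. i < length L \<Longrightarrow> j < length (xss ! (L ! i)) \<Longrightarrow> i * D + j < last (0 # ys) \<Longrightarrow>
        xss ! (L ! i) ! j \<in> U \<Longrightarrow> xss ! (L ! i) ! j \<in> set L" by auto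
    have len: "length L = Suc k" "distinct L" "?v \<in> set L" using decode_props[OF L(1)] L(2) by auto
    have Ln: "L ! i < n" if "i < length L" for i
      using nth_mem[OF that] L(4) U(1) by auto
    \<comment> \<open>\<open>P z\<close> says that the slot with number \<open>z\<close>, counted
      from 0, shows a vertex of \<open>U\<close> still to be discovered.\<close>
    define P where "P z \<longleftrightarrow> (\<exists>i<length L. \<exists>j<length (xss ! (L ! i)).
        z = i * D + j \<and> xss ! (L ! i) ! j \<in> U - set L)" for z
    have PI: "P (i * D + j)" if "i < length L" "j < length (xss ! (L ! i))" "xss ! (L ! i) ! j \<in> U - set L" for i j
      using that unfolding P_def by blast
    have "card (set L) < card U" using Suc.prems len by (simp add: distinct_card)
    then have "U - set L \<noteq> {}" using L(4) by auto
    moreover have "U = set L \<union> (U - set L)" "set L \<inter> (U - set L) = {}" "set L \<noteq> {}" using L(4) len by auto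
    ultimately obtain a b where ab: "a \<in> set L" "b \<in> U - set L" "{a, b} \<in> edges G"
      using ind unfolding indecomposable_def by metis
    obtain i where i: "i < length L" "L ! i = a" using ab(1) by (auto simp: in_set_conv_nth)
    have "b \<in> set (xss ! a)" using ab(3) set_nth[of a] Ln[OF i(1)] i(2) by (simp add: insert_commute)
    then obtain j where "j < length (xss ! a)" "xss ! a ! j = b" by (auto simp: in_set_conv_nth)
    then have exP: "\<exists>z. P z" using i ab(2) unfolding P_def by blast
    define z where "z = (LEAST z. P z)"
    have "P z" unfolding z_def using exP by (rule LeastI_ex)
    then obtain i j where ij: "i < length L" "j < length (xss ! (L ! i))" "z = i * D + j"
      "xss ! (L ! i) ! j \<in> U - set L" unfolding P_def by blast
    have minz: "z \<le> z'" if "P z'" for z' unfolding z_def using that by (rule Least_le)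
    define x where "x = xss ! (L ! i) ! j"
    have jD: "j < D" using ij(2) length_nth_le[OF Ln[OF ij(1)]] by simp
    have dm: "z div D = i" "z mod D = j" using ij(3) jD by auto
    \<comment> \<open>Saturated slots show nothing new, so the chosen slot lies behind all slots
      used before.\<close>
    have "last (0 # ys) \<le> z" using sat[OF ij(1,2)] ij(3,4) by force
    have "?v < x" using ij(4) len(3) finU x_def
      by (metis DiffD1 DiffD2 Min_le le_neq_implies_less)
    have "x \<notin> set (xss ! (L ! i'))" if "i' < i" for i'
    proof
      assume "x \<in> set (xss ! (L ! i'))"
      then obtain j' where j': "j' < length (xss ! (L ! i'))" "xss ! (L ! i') ! j' = x"
        by (auto simp: in_set_conv_nth)
      then have "P (i' * D + j')" using that ij(1,4) x_def by (intro PI) auto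
      then have "i * D + j \<le> i' * D + j'" using minz ij(3) by simp
      moreover have "j' < D" using j'(1) length_nth_le[OF Ln[of i']] that ij(1) by simp
      moreover have "Suc i' * D \<le> i * D" using that by (intro mult_right_mono) auto
      ultimately show False unfolding mult_Suc by linarith
    qed
    then have step: "bfs_step xss D ?v L (Suc z) = Some (L @ [x])"
      using ij dm \<open>?v < x\<close> unfolding bfs_step_def by (auto simp: x_def Let_def)
    have "Suc z \<le> Suc k * D"
    proof -
      have "i * D \<le> k * D" using ij(1) len(1) by (intro mult_right_mono) auto
      then have "Suc (i * D + j) \<le> D + k * D" using jD by linarith
      then show ?thesis using ij(3) by simp
    qed
    moreover have "y < Suc z" if "y \<in> set (0 # ys)" for y
    proof -
      have "y \<le> last (0 # ys)"
        using L(3) that by (cases ys rule: rev_cases) (auto simp: sorted_wrt_append less_imp_le)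
      then show ?thesis using \<open>last (0 # ys) \<le> z\<close> by simp
    qed
    moreover have "xss ! ((L @ [x]) ! i') ! j' \<in> set (L @ [x])"
      if a: "i' < length (L @ [x])" "j' < length (xss ! ((L @ [x]) ! i'))" "i' * D + j' < Suc z"
        "xss ! ((L @ [x]) ! i') ! j' \<in> U" for i' j'
    proof (cases "i' < length L")
      case True
      show ?thesis
      proof (rule ccontr)
        assume "\<not> ?thesis"
        then have "P (i' * D + j')" and ne: "xss ! (L ! i') ! j' \<noteq> x"
          using True a by (auto simp: nth_append intro!: PI)
        then have "i' * D + j' = z" using minz[of "i' * D + j'"] a(3) by simp
        moreover have "j' < D"
          using a(2) True length_nth_le[OF Ln[OF True]] by (simp add: nth_append)
        ultimately have "i' = i" "j' = j" using dm by auto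
        then show False using ne x_def by simp
      qed
    next
      case False
      \<comment> \<open>The slots of the newly added vertex begin at \<open>Suc k * D\<close>, which
        is beyond \<open>z\<close>, so saturation says nothing about them.\<close>
      then have "i' = Suc k" using a(1) len by simp
      moreover have "z < Suc k * D" using \<open>Suc z \<le> Suc k * D\<close> by simp
      ultimately show ?thesis using a(3) by simp
    qed
    ultimately show ?case
      using L ij(4) step
      by (intro exI[of _ "ys @ [Suc z]"] exI[of _ "L @ [x]"])
        (auto simp: decode_snoc x_def sorted_wrt_append intro: le_trans[of _ "k * D"])
  qed
  from this[of "card U - 1"] cardU obtain ys L where L: "decode xss D ?v ys = Some L"
    "length ys = card U - 1" "sorted_wrt (<) (0 # ys)" "set L \<subseteq> U" "\<forall>y\<in>set ys. y \<le> (card U - 1) * D"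
    by auto
  have "card (set L) = card U" using decode_props[OF L(1)] L(2) cardU by (simp add: distinct_card)
  then have "set L = U" using L(4) finU by (simp add: card_subset_eq)
  moreover have "(card U - 1) * D \<le> K * D" using U(3) by (intro mult_right_mono) auto
  then have "ys \<in> set (incs (K * D) (K - 1) 0)"
    using L U(3) unfolding set_incs by (auto intro: le_trans)
  ultimately show ?thesis using L(1) by blast
qed

end

section \<open>Running time of programs\<close>

text \<open>A weakest precondition with the time as a further argument of the postcondition. The
  existential includes termination.\<close>

definition run :: "nat \<Rightarrow> (nat list \<Rightarrow> complex \<Rightarrow> nat \<Rightarrow> bool) \<Rightarrow> com \<Rightarrow> state \<Rightarrow> (state \<Rightarrow> nat \<Rightarrow> bool) \<Rightarrow> bool" where
  "run w orc c s Q \<longleftrightarrow> (\<exists>s' t. exec w orc c s s' t \<and> Q s' t)"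

lemma run_mono: "run w orc c s Q \<Longrightarrow> (\<And>s' t. Q s' t \<Longrightarrow> Q' s' t) \<Longrightarrow> run w orc c s Q'"
  unfolding run_def by blast

lemma run_simps [simp]:
  "run w orc Skip s Q \<longleftrightarrow> Q s 1"
  "run w orc (WAssign r e) s Q \<longleftrightarrow> Q (s\<lparr>wreg := (wreg s)(r := wval w e s)\<rparr>) (1 + wcost e)"
  "run w orc (WStore a e) s Q \<longleftrightarrow>
     Q (s\<lparr>wmem := (wmem s)(wval w a s := wval w e s)\<rparr>) (1 + wcost a + wcost e)"
  "run w orc (CAssign r f) s Q \<longleftrightarrow> Q (s\<lparr>creg := (creg s)(r := cval w f s)\<rparr>) (1 + ccost f)"
  "run w orc (CStore a f) s Q \<longleftrightarrow>
     Q (s\<lparr>cmem := (cmem s)(wval w a s := cval w f s)\<rparr>) (1 + wcost a + ccost f)"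
  unfolding run_def
  by (auto simp del: One_nat_def plus_1_eq_Suc elim!: exec_elims intro: exec.intros) simp_all

lemma run_Seq [simp]:
  "run w orc (Seq c1 c2) s Q \<longleftrightarrow> run w orc c1 s (\<lambda>s1 t1. run w orc c2 s1 (\<lambda>s2 t2. Q s2 (t1 + t2)))"
  unfolding run_def by (blast intro: exec.intros elim: exec_elims)

lemma run_If [simp]:
  "run w orc (If b c1 c2) s Q \<longleftrightarrow>
     (if wval w b s \<noteq> 0 then run w orc c1 s (\<lambda>s' t. Q s' (1 + wcost b + t))
      else run w orc c2 s (\<lambda>s' t. Q s' (1 + wcost b + t)))"
proof -
  have "exec w orc (If b c1 c2) s s' t \<longleftrightarrow>
      (\<exists>t'. t = 1 + wcost b + t' \<and> (if wval w b s \<noteq> 0 then exec w orc c1 s s' t' else exec w orc c2 s s' t'))" for s' t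
    by (auto elim!: exec_elims simp del: One_nat_def plus_1_eq_Suc intro: exec.intros)
  then show ?thesis unfolding run_def by (auto simp del: One_nat_def plus_1_eq_Suc)
qed

lemma run_Query:
  assumes "orc (map (\<lambda>j. wmem s ((wval w a s + j) mod 2 ^ w)) [0..<wval w l s]) z t"
    "Q (s\<lparr>creg := (creg s)(r := z)\<rparr>) (1 + wcost a + wcost l + wval w l s + t)"
  shows "run w orc (Query r a l) s Q"
  using assms exec.Query unfolding run_def by blast

text \<open>The invariant is indexed by the number of completed rounds; fixing the total number of
  rounds yields termination and the time together. The test is evaluated once more than the
  body.\<close>

lemma run_while:
  assumes "\<And>j s. j < n \<Longrightarrow> I j s \<Longrightarrow> wval w b s \<noteq> 0 \<and> run w orc c s (\<lambda>s' t. I (Suc j) s' \<and> t \<le> \<tau> j)"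
    and "\<And>s. I n s \<Longrightarrow> wval w b s = 0" and "I 0 s"
  shows "run w orc (While b c) s (\<lambda>s' t. I n s' \<and> t \<le> (\<Sum>j<n. \<tau> j) + (n + 1) * (1 + wcost b))"
proof -
  have "run w orc (While b c) s (\<lambda>s' t. I n s' \<and> t \<le> (\<Sum>j\<in>{k..<n}. \<tau> j) + (n - k + 1) * (1 + wcost b))"
    if "k \<le> n" "I k s" for k s
    using that
  proof (induction arbitrary: s rule: inc_induct)
    case base
    then show ?case using assms(2) exec.WhileFalse[of w b s orc c] unfolding run_def by fastforce
  next
    case (step k)
    obtain s1 t1 where 1: "wval w b s \<noteq> 0" "exec w orc c s s1 t1" "I (Suc k) s1" "t1 \<le> \<tau> k"
      using assms(1)[OF step.hyps(2) step.prems] unfolding run_def by blast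
    from step.IH[OF 1(3)] obtain s2 t2 where 2: "exec w orc (While b c) s1 s2 t2" "I n s2"
      "t2 \<le> (\<Sum>j\<in>{Suc k..<n}. \<tau> j) + (n - Suc k + 1) * (1 + wcost b)"
      unfolding run_def by blast
    have "(\<Sum>j\<in>{k..<n}. \<tau> j) = \<tau> k + (\<Sum>j\<in>{Suc k..<n}. \<tau> j)"
      using step.hyps by (simp add: sum.atLeast_Suc_lessThan)
    moreover have "n - k + 1 = Suc (n - Suc k + 1)" using step.hyps by simp
    ultimately have "1 + wcost b + t1 + t2 \<le> (\<Sum>j\<in>{k..<n}. \<tau> j) + (n - k + 1) * (1 + wcost b)"
      using 1(4) 2(3) by simp
    then show ?case using exec.WhileTrue[OF 1(1,2) 2(1)] 2(2) unfolding run_def by blast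
  qed
  from this[of 0 s] assms(3) show ?thesis by (simp add: atLeast0LessThan)
qed

section \<open>Counting loops\<close>

abbreviation wadd (infixl "[+]" 65) where "a [+] b \<equiv> WBin Add a b"
abbreviation wsub (infixl "[-]" 65) where "a [-] b \<equiv> WBin Sub a b"
abbreviation wmul (infixl "[*]" 70) where "a [*] b \<equiv> WBin Mul a b"
abbreviation wless (infix "[<]" 50) where "a [<] b \<equiv> WBin Less a b"
abbreviation weq (infix "[=]" 50) where "a [=] b \<equiv> WBin Eq a b"

definition for_prog :: "nat \<Rightarrow> wexp \<Rightarrow> wexp \<Rightarrow> com \<Rightarrow> com" where
  "for_prog r a l c = Seq (WAssign r a) (While (WReg r [<] l) (Seq c (WAssign r (WReg r [+] WConst 1))))"

text \<open>A round costs 4 for the increment and \<open>3 + wcost l\<close> for the test. The body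
  has to preserve the counter, and \<open>b < 2 ^ w\<close> excludes a wrap-around of the
  increment.\<close>

lemma run_for:
  assumes w: "b < 2 ^ w" "w > 0"
    and init: "wval w a0 s = a" "a \<le> b" "I a s"
    and reg: "\<And>j s v. I j s \<Longrightarrow> I j (s\<lparr>wreg := (wreg s)(r := v)\<rparr>)"
    and lim: "\<And>j s. I j s \<Longrightarrow> wval w l s = b"
    and body: "\<And>j s. a \<le> j \<Longrightarrow> j < b \<Longrightarrow> I j s \<Longrightarrow> wreg s r = j \<Longrightarrow>
      run w orc c s (\<lambda>s' t. I (Suc j) s' \<and> wreg s' r = j \<and> t \<le> T)"
  shows "run w orc (for_prog r a0 l c) s
    (\<lambda>s' t. I b s' \<and> wreg s' r = b \<and> t \<le> (b - a) * (T + 7 + wcost l) + 4 + wcost a0 + wcost l)"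
proof -
  have "run w orc (While (WReg r [<] l) (Seq c (WAssign r (WReg r [+] WConst 1)))) (s\<lparr>wreg := (wreg s)(r := a)\<rparr>)
    (\<lambda>s' t. (I (a + (b - a)) s' \<and> wreg s' r = a + (b - a)) \<and>
       t \<le> (\<Sum>j<b - a. T + 4) + (b - a + 1) * (1 + wcost (WReg r [<] l)))"
  proof (rule run_while[where I = "\<lambda>j s. I (a + j) s \<and> wreg s r = a + j"])
    fix j s assume j: "j < b - a" and I: "I (a + j) s \<and> wreg s r = a + j"
    then have jb: "a + j < b" by simp
    have "wval w (WReg r [<] l) s \<noteq> 0"
      using lim[of "a + j" s] I jb w by simp
    moreover have "run w orc c s (\<lambda>s' t. I (Suc (a + j)) s' \<and> wreg s' r = a + j \<and> t \<le> T)" (is "run _ _ _ _ ?L1")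
      using body[of "a + j" s] I jb by simp
    then have "run w orc (Seq c (WAssign r (WReg r [+] WConst 1))) s
      (\<lambda>s' t. (I (a + Suc j) s' \<and> wreg s' r = a + Suc j) \<and> t \<le> T + 4)" (is "run _ _ _ _ ?L2")
      unfolding run_Seq
    proof (rule run_mono)
      fix s' t assume "?L1 s' t"
      moreover have "(a + j + 1) mod 2 ^ w = Suc (a + j)" using jb w by simp
      moreover have "Suc 0 mod 2 ^ w = Suc 0" using w by simp
      ultimately show "run w orc (WAssign r (WReg r [+] WConst 1)) s'
        (\<lambda>s2 t2. ?L2 s2 (t + t2))"
        using reg by simp
    qed
    ultimately show "wval w (WReg r [<] l) s \<noteq> 0 \<and> run w orc (Seq c (WAssign r (WReg r [+] WConst 1))) s
      (\<lambda>s' t. ?L2 s' t)" by blast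
  next
    fix s assume "I (a + (b - a)) s \<and> wreg s r = a + (b - a)"
    then show "wval w (WReg r [<] l) s = 0" using lim[of "a + (b - a)" s] init(2) by simp
  next
    show "I (a + 0) (s\<lparr>wreg := (wreg s)(r := a)\<rparr>) \<and> wreg (s\<lparr>wreg := (wreg s)(r := a)\<rparr>) r = a + 0"
      using reg init(3) by simp
  qed
  moreover obtain q where "b = a + q" using init(2) le_Suc_ex by blast
  ultimately show ?thesis
    unfolding for_prog_def run_Seq run_simps init(1)
    by (elim run_mono) (auto simp: algebra_simps)
qed

text \<open>Word memory is used in eight blocks of \<open>B\<close> cells. The first bound makes all
  their addresses words and lets intermediate values below \<open>8 * B\<close> be computed without
  wrap-around; the second leaves room for the small constants of the programs.\<close>

locale word_blocks =
  fixes w B :: nat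
  assumes w_bound: "8 * B < 2 ^ w" and B_ge: "16 \<le> B"
begin

text \<open>A frame condition: registers outside \<open>R\<close> and blocks outside
  \<open>J\<close> are unchanged. The complex part is left free, its changes being stated explicitly
  each time.\<close>

definition chg :: "nat set \<Rightarrow> nat set \<Rightarrow> state \<Rightarrow> state \<Rightarrow> bool" where
  "chg R J s s' \<longleftrightarrow> (\<forall>r. r \<notin> R \<longrightarrow> wreg s' r = wreg s r) \<and>
     (\<forall>a. a div B \<notin> J \<longrightarrow> wmem s' a = wmem s a)"

text \<open>Entries begin at cell 1, which keeps cell 0 for the sentinel of a stack.\<close>

definition vec :: "nat \<Rightarrow> nat list \<Rightarrow> state \<Rightarrow> bool" where
  "vec b xs s \<longleftrightarrow> (\<forall>i<length xs. wmem s (b * B + Suc i) = xs ! i)"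

definition stack :: "nat \<Rightarrow> nat \<Rightarrow> nat list \<Rightarrow> state \<Rightarrow> bool" where
  "stack b L xs s \<longleftrightarrow> wreg s L = length xs \<and> wmem s (b * B) = 0 \<and> vec b xs s"

end

section \<open>Programs that enumerate increasing lists\<close>

definition addr :: "nat \<Rightarrow> wexp \<Rightarrow> wexp" where
  "addr b e = (WConst b [*] WReg 5) [+] e"

definition fetch :: "nat \<Rightarrow> wexp \<Rightarrow> wexp" where
  "fetch b e = WMem (addr b e)"

text \<open>The entry 0 below the stack is a sentinel, so that the top of the empty stack is 0.\<close>

definition next_prog :: "nat \<Rightarrow> nat \<Rightarrow> nat \<Rightarrow> wexp \<Rightarrow> wexp \<Rightarrow> com" where
  "next_prog b L d c u =
     If ((WReg L [<] c) [*] (fetch b (WReg L) [<] u))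
       (Seq (WStore (addr b (WReg L [+] WConst 1)) (fetch b (WReg L) [+] WConst 1))
            (WAssign L (WReg L [+] WConst 1)))
       (Seq (If ((fetch b (WReg L) [=] u) [*] (WConst 0 [<] WReg L)) (WAssign L (WReg L [-] WConst 1)) Skip)
            (If (WReg L) (WStore (addr b (WReg L)) (fetch b (WReg L) [+] WConst 1)) (WAssign d (WConst 0))))"

definition enum_prog :: "nat \<Rightarrow> nat \<Rightarrow> nat \<Rightarrow> wexp \<Rightarrow> wexp \<Rightarrow> com \<Rightarrow> com" where
  "enum_prog b L d c u body =
     Seq (WStore (addr b (WConst 0)) (WConst 0)) (Seq (WAssign L (WConst 0)) (Seq (WAssign d (WConst 1))
       (While (WReg d) (Seq body (next_prog b L d c u)))))"

context word_blocks
begin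

lemma w_pos: "w > 0"
  using w_bound B_ge by (cases w) auto

lemma word_mod [simp]: "x < 8 * B \<Longrightarrow> x mod 2 ^ w = x"
  using w_bound by simp

lemma word_diff [simp]: "y \<le> x \<Longrightarrow> x < 8 * B \<Longrightarrow> wop_val w Sub x y = x - y"
proof -
  assume *: "y \<le> x" "x < 8 * B"
  then have "x + (2 ^ w - y) = (x - y) + 2 ^ w" using w_bound by simp
  then show ?thesis using * w_bound by (simp only: wop_val.simps mod_add_self2 mod_less)
qed

declare wop_val.simps(2) [simp del]

lemma block_div [simp]: "x < B \<Longrightarrow> (b * B + x) div B = b" "Suc x < B \<Longrightarrow> Suc (b * B + x) div B = b" "x < B \<Longrightarrow> x div B = 0" "(b * B) div B = b"
proof -
  show "Suc (b * B + x) div B = b" if "Suc x < B"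
    using that div_mult_self3[of B b "Suc x"] B_ge by (simp add: add.commute)
qed (use B_ge in auto)

lemma wval_addr [simp]:
  assumes "wreg s 5 = B" "b < 8" "wval w e s < B"
  shows "wval w (addr b e) s = b * B + wval w e s"
proof -
  have "b * B \<le> 7 * B" using assms(2) by (intro mult_right_mono) auto
  then have "b * B < 8 * B" "b * B + wval w e s < 8 * B" "b < 8 * B" using assms B_ge by linarith+
  then show ?thesis using assms(1) by (simp add: addr_def)
qed

lemma wval_fetch [simp]:
  "wreg s 5 = B \<Longrightarrow> b < 8 \<Longrightarrow> wval w e s < B \<Longrightarrow> wval w (fetch b e) s = wmem s (b * B + wval w e s)"
  by (simp add: fetch_def)

lemma wcost_addr [simp]: "wcost (addr b e) = 4 + wcost e" "wcost (fetch b e) = 5 + wcost e"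
  by (simp_all add: addr_def fetch_def)

lemma chg_refl [simp]: "chg R J s s"
  by (simp add: chg_def)

lemma chg_trans: "chg R J s s' \<Longrightarrow> chg R' J' s' s'' \<Longrightarrow> R' \<subseteq> R \<Longrightarrow> J' \<subseteq> J \<Longrightarrow> chg R J s s''"
  unfolding chg_def by (metis subsetD)

lemma chg_mono: "chg R J s s' \<Longrightarrow> R \<subseteq> R' \<Longrightarrow> J \<subseteq> J' \<Longrightarrow> chg R' J' s s'"
  unfolding chg_def by blast

lemma chg_wreg: "chg R J s s' \<Longrightarrow> r \<notin> R \<Longrightarrow> wreg s' r = wreg s r"
  unfolding chg_def by blast

lemma chg_wmem: "chg R J s s' \<Longrightarrow> x < B \<Longrightarrow> b \<notin> J \<Longrightarrow> wmem s' (b * B + x) = wmem s (b * B + x)"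
  unfolding chg_def by simp

lemma chg_vec: "chg R J s s' \<Longrightarrow> b \<notin> J \<Longrightarrow> length xs < B \<Longrightarrow> vec b xs s' = vec b xs s"
  unfolding vec_def by (auto simp: chg_wmem simp flip: add_Suc_right)

lemma chg_stack:
  "chg R J s s' \<Longrightarrow> b \<notin> J \<Longrightarrow> L \<notin> R \<Longrightarrow> length xs < B \<Longrightarrow> stack b L xs s' = stack b L xs s"
  using chg_wmem[of R J s s' 0 b] B_ge unfolding stack_def by (simp add: chg_vec chg_wreg)

text \<open>With the sentinel the block is an array holding \<open>0 # xs\<close>.\<close>

lemma stack_nth: "stack b L xs s \<Longrightarrow> i \<le> length xs \<Longrightarrow> wmem s (b * B + i) = (0 # xs) ! i"
  unfolding stack_def vec_def by (cases i) auto

lemma run_Seq_mono: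
  "run w orc c1 s Q1 \<Longrightarrow> (\<And>s1 t1. Q1 s1 t1 \<Longrightarrow> run w orc c2 s1 (\<lambda>s2 t2. Q s2 (t1 + t2))) \<Longrightarrow>
    run w orc (Seq c1 c2) s Q"
  unfolding run_Seq by (rule run_mono)

text \<open>The cell at offset \<open>length xs\<close> holds the last entry, or the sentinel for
  the empty stack, which plays the part of the lower bound 0 in \<open>next_inc u c 0\<close>.
  Products of tests act as conjunctions; testing that the stack is non-empty before a removal
  matters when \<open>u = 0\<close>, since then the sentinel equals \<open>u\<close>.\<close>

lemma run_next:
  assumes st: "stack b L xs s" "wreg s 5 = B" "xs \<in> set (incs u c 0)"
    and e: "wval w ce s = c" "wval w ue s = u"
    and bd: "c < B" "u < B" "0 < b" "b < 8" "L \<noteq> 5" "d \<noteq> 5" "L \<noteq> d"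
  shows "run w orc (next_prog b L d ce ue) s (\<lambda>s' t. chg {L, d} {b} s s' \<and> cmem s' = cmem s \<and>
    (case next_inc u c 0 xs of None \<Rightarrow> wreg s' d = 0 | Some ys \<Rightarrow> stack b L ys s' \<and> wreg s' d = wreg s d) \<and>
    t \<le> 60 + 2 * wcost ce + 2 * wcost ue)"
proof -
  have len: "length xs \<le> c" and srt: "sorted_wrt (<) (0 # xs)" and le: "set xs \<subseteq> {..u}"
    using st(3) by (auto simp: set_incs)
  have L: "wreg s L = length xs" using st(1) by (simp add: stack_def)
  have z: "wmem s (b * B) = 0" using st(1) by (simp add: stack_def)
  have top: "wmem s (b * B + length xs) = last (0 # xs)"
    using stack_nth[OF st(1), of "length xs"] by (simp add: last_conv_nth)
  have top_le: "last (0 # xs) \<le> u" using le by (cases xs rule: rev_cases) auto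
  show ?thesis
  proof (cases "length xs < c \<and> last (0 # xs) < u")
    case True
    then have "next_inc u c 0 xs = Some (xs @ [Suc (last (0 # xs))])" by (simp add: next_inc_def)
    moreover have "stack b L (xs @ [Suc (last (0 # xs))])
        (s\<lparr>wmem := (wmem s)(b * B + Suc (length xs) := Suc (last (0 # xs))),
           wreg := (wreg s)(L := Suc (length xs))\<rparr>)"
      using st(1) unfolding stack_def vec_def by (auto simp: nth_append less_Suc_eq)
    moreover have "chg {L, d} {b} s
        (s\<lparr>wmem := (wmem s)(b * B + Suc (length xs) := Suc (last (0 # xs))),
           wreg := (wreg s)(L := Suc (length xs))\<rparr>)"
      using True bd unfolding chg_def by (auto simp del: mult_Suc_right add_Suc_right)
    ultimately show ?thesis
      using True bd st(2) L top e w_pos B_ge unfolding next_prog_def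
      by simp
  next
    case False
    define ys where "ys = (if xs \<noteq> [] \<and> last xs = u then butlast xs else xs)"
    have nx: "next_inc u c 0 xs = (if ys = [] then None else Some (butlast ys @ [Suc (last ys)]))"
      unfolding next_inc_def ys_def Let_def by (simp only: False if_False)
    have ys: "length ys \<le> length xs" "\<And>i. i < length ys \<Longrightarrow> ys ! i = xs ! i"
      by (auto simp: ys_def nth_butlast)
    have c1: "wval w ((WReg L [<] ce) [*] (fetch b (WReg L) [<] ue)) s = 0"
      using False bd st(2) L top e len w_pos by auto
    define s1 where "s1 = s\<lparr>wreg := (wreg s)(L := length ys)\<rparr>"
    have r1: "run w orc (If ((fetch b (WReg L) [=] ue) [*] (WConst 0 [<] WReg L)) (WAssign L (WReg L [-] WConst 1)) Skip) s
        (\<lambda>s' t. s' = s1 \<and> t \<le> 20 + wcost ue)"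
    proof (cases "xs \<noteq> [] \<and> last xs = u")
      case True
      then have "Suc 0 \<le> length xs" by (simp add: Suc_le_eq)
      then show ?thesis
        using True bd st(2) L top e len w_pos B_ge by (auto simp: s1_def ys_def)
    next
      case False
      then have "ys = xs" by (simp only: ys_def if_False)
      then have "s1 = s" using L by (simp add: s1_def fun_upd_idem)
      then show ?thesis
        using False bd st(2) L top e len w_pos B_ge by (auto simp: s1_def ys_def)
    qed
    have r2: "run w orc (If (WReg L) (WStore (addr b (WReg L)) (fetch b (WReg L) [+] WConst 1)) (WAssign d (WConst 0))) s1
      (\<lambda>s' t. chg {L, d} {b} s s' \<and> cmem s' = cmem s \<and>
       (case next_inc u c 0 xs of None \<Rightarrow> wreg s' d = 0 | Some ys \<Rightarrow> stack b L ys s' \<and> wreg s' d = wreg s d) \<and> t \<le> 20)"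
    proof (cases "ys = []")
      case True
      then show ?thesis using nx bd by (auto simp: s1_def chg_def)
    next
      case False
      then obtain k where k: "length ys = Suc k" by (cases ys) auto
      have kB: "Suc k < B" using k ys(1) len bd by simp
      have "wmem s (b * B + Suc k) = xs ! k"
        using st(1) k ys(1) unfolding stack_def vec_def by simp
      moreover have lst: "last ys = xs ! k" using False k ys(2) by (simp add: last_conv_nth)
      moreover have "last ys \<le> u"
      proof -
        have "xs ! k \<in> set xs" using k ys(1) by (intro nth_mem) simp
        then show ?thesis using le lst by auto
      qed
      moreover have "stack b L (butlast ys @ [Suc (xs ! k)]) (s1\<lparr>wmem := (wmem s)(b * B + Suc k := Suc (xs ! k))\<rparr>)"
        using st(1) k ys unfolding stack_def vec_def s1_def
        by (auto simp: nth_append nth_butlast less_Suc_eq)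
      moreover have "chg {L, d} {b} s (s1\<lparr>wmem := (wmem s)(b * B + Suc k := Suc (xs ! k))\<rparr>)"
        using kB unfolding chg_def s1_def by (auto simp del: mult_Suc_right add_Suc_right)
      ultimately show ?thesis
        using nx False bd k kB st(2) B_ge w_pos by (simp add: s1_def)
    qed
    have "run w orc (Seq (If ((fetch b (WReg L) [=] ue) [*] (WConst 0 [<] WReg L)) (WAssign L (WReg L [-] WConst 1)) Skip)
        (If (WReg L) (WStore (addr b (WReg L)) (fetch b (WReg L) [+] WConst 1)) (WAssign d (WConst 0)))) s
      (\<lambda>s' t. (chg {L, d} {b} s s' \<and> cmem s' = cmem s \<and>
       (case next_inc u c 0 xs of None \<Rightarrow> wreg s' d = 0 | Some ys \<Rightarrow> stack b L ys s' \<and> wreg s' d = wreg s d)) \<and>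
       t \<le> 40 + wcost ue)"
      unfolding run_Seq
      by (rule run_mono[OF r1], elim conjE, hypsubst, rule run_mono[OF r2]) simp
    then show ?thesis
      unfolding next_prog_def by (subst run_If) (simp only: c1 simp_thms if_False, elim run_mono, simp)
  qed
qed

text \<open>\<open>P\<close> is indexed by the number of lists processed and must survive changes of
  the stack and the flag, which belong to the enumeration. Of the 110 units per list, 100 pay for
  the successor, whose limit expressions cost at most 10 each, and 10 for the loop test.\<close>

lemma run_enum:
  assumes init: "P 0 s" "wreg s 5 = B"
    and chg: "\<And>j s s'. P j s \<Longrightarrow> chg {L, d} {b} s s' \<Longrightarrow> cmem s' = cmem s \<Longrightarrow> P j s'"
    and e: "\<And>j s. P j s \<Longrightarrow> wreg s 5 = B \<and> wval w ce s = c \<and> wval w ue s = u"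
    and bd: "c < B" "u < B" "0 < b" "b < 8" "L \<noteq> 5" "d \<noteq> 5" "L \<noteq> d" "wcost ce \<le> 10" "wcost ue \<le> 10"
    and body: "\<And>j xs s. j < length (incs u c 0) \<Longrightarrow> xs = incs u c 0 ! j \<Longrightarrow> P j s \<Longrightarrow> stack b L xs s \<Longrightarrow>
      wreg s d = 1 \<Longrightarrow>
      run w orc body s (\<lambda>s' t. P (Suc j) s' \<and> stack b L xs s' \<and> wreg s' d = 1 \<and> t \<le> \<tau> xs)"
  shows "run w orc (enum_prog b L d ce ue body) s
    (\<lambda>s' t. P (length (incs u c 0)) s' \<and> t \<le> (\<Sum>xs\<leftarrow>incs u c 0. \<tau> xs + 110) + 20)"
proof -
  define E where "E = incs u c 0"
  \<comment> \<open>The flag stays 1 while the stack holds the next list to be processed and becomes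
    0 after the last one.\<close>
  define I where "I j s \<longleftrightarrow> P j s \<and> (if j < length E then stack b L (E ! j) s \<and> wreg s d = 1 else wreg s d = 0)"
    for j s
  have E: "length E > 0" "E ! 0 = []" using hd_incs[of u c 0] by (simp_all add: E_def flip: hd_conv_nth)
  have loop: "run w orc (While (WReg d) (Seq body (next_prog b L d ce ue))) s0
      (\<lambda>s' t. I (length E) s' \<and> t \<le> (\<Sum>j<length E. \<tau> (E ! j) + 100) + (length E + 1) * (1 + wcost (WReg d)))"
    if "I 0 s0" for s0
  proof (rule run_while)
    fix j s assume j: "j < length E" and I: "I j s"
    have body': "run w orc body s (\<lambda>s' t. P (Suc j) s' \<and> stack b L (E ! j) s' \<and> wreg s' d = 1 \<and> t \<le> \<tau> (E ! j))"
      using body[of j "E ! j" s] I j by (auto simp: I_def E_def)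
    have "run w orc (Seq body (next_prog b L d ce ue)) s (\<lambda>s' t. I (Suc j) s' \<and> t \<le> \<tau> (E ! j) + 100)"
      unfolding run_Seq
    proof (rule run_mono[OF body'])
      fix s1 t1 assume s1: "P (Suc j) s1 \<and> stack b L (E ! j) s1 \<and> wreg s1 d = 1 \<and> t1 \<le> \<tau> (E ! j)"
      have "run w orc (next_prog b L d ce ue) s1 (\<lambda>s' t. chg {L, d} {b} s1 s' \<and> cmem s' = cmem s1 \<and>
         (case next_inc u c 0 (E ! j) of None \<Rightarrow> wreg s' d = 0
          | Some ys \<Rightarrow> stack b L ys s' \<and> wreg s' d = wreg s1 d) \<and> t \<le> 60 + 2 * wcost ce + 2 * wcost ue)" (is "run _ _ _ _ ?L1")
        using s1 e[of "Suc j" s1] j bd by (intro run_next) (auto simp: E_def)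
      then show "run w orc (next_prog b L d ce ue) s1 (\<lambda>s2 t2. I (Suc j) s2 \<and> t1 + t2 \<le> \<tau> (E ! j) + 100)"
      proof (rule run_mono)
        fix s2 t2 assume s2: "?L1 s2 t2"
        have P: "P (Suc j) s2" using chg s1 s2 by blast
        show "I (Suc j) s2 \<and> t1 + t2 \<le> \<tau> (E ! j) + 100"
        proof (cases "Suc j < length E")
          case True
          then have "next_inc u c 0 (E ! j) = Some (E ! Suc j)"
            using successively_incs[of u c 0] by (auto simp: successively_conv_nth E_def)
          then show ?thesis using P s1 s2 True bd by (simp add: I_def)
        next
          case False
          then have "j = length E - 1" using j by simp
          then have "E ! j = last E" by (simp add: last_conv_nth E_def)
          then have "next_inc u c 0 (E ! j) = None" using successively_incs[of u c 0] by (simp add: E_def)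
          then show ?thesis using P s1 s2 False bd by (simp add: I_def)
        qed
      qed
    qed
    then show "wval w (WReg d) s \<noteq> 0 \<and>
        run w orc (Seq body (next_prog b L d ce ue)) s (\<lambda>s' t. I (Suc j) s' \<and> t \<le> \<tau> (E ! j) + 100)"
      using I j by (simp add: I_def)
  qed (use that in \<open>auto simp: I_def\<close>)
  let ?s = "s\<lparr>wmem := (wmem s)(b * B := 0), wreg := (wreg s)(L := 0, d := 1)\<rparr>"
  have "P 0 ?s" using init(1) by (rule chg) (auto simp: chg_def)
  then have "I 0 ?s" using E bd by (auto simp: I_def stack_def vec_def)
  have sums: "(\<Sum>xs\<leftarrow>E. \<tau> xs + 110) = (\<Sum>j<length E. \<tau> (E ! j) + 100) + 10 * length E"
    by (simp add: sum_list_sum_nth atLeast0LessThan sum.distrib)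
  show ?thesis
    using loop[OF \<open>I 0 ?s\<close>] init(2) bd B_ge w_pos sums unfolding enum_prog_def
    by (auto simp: I_def E_def[symmetric] elim!: run_mono)
qed

end

section \<open>The algorithm\<close>

text \<open>Registers: 0--5 hold \<open>n, m, \<Delta>, \<alpha>, K = \<alpha> m\<close> and the block size \<open>B\<close>; 6 is the root \<open>v\<close>; 7, 9, 11 are the
  lengths of the stacks and 8, 10, 12 their continuation flags; the others are temporary. Blocks of the word
  memory: 0 input, 2 code of \<open>U\<close>, 3 the vertices of \<open>U\<close>, 4 \<open>S\<close> as positions in \<open>U\<close>, 5 \<open>T\<close> as positions in \<open>S\<close>,
  6 query, 7 adjacency matrix, which costs only \<open>O(n \<Delta>)\<close> because the memory is initially 0. Positions are
  counted from 1. Blocks of the complex memory: 0 coefficients, 2 power sums on \<open>S\<close>, 3 accumulated power sums.\<close>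

definition edge_exp :: "wexp \<Rightarrow> wexp \<Rightarrow> wexp" where
  "edge_exp x y = fetch 7 (x [*] WReg 0 [+] y)"

definition vert_exp :: "wexp \<Rightarrow> wexp" where
  "vert_exp e = fetch 3 (fetch 4 (fetch 5 e))"

section \<open>Building and asking one query\<close>

definition build_cell :: com where
  "build_cell =
     If (edge_exp (vert_exp (WReg 13 [+] WConst 1)) (vert_exp (WReg 14 [+] WConst 1)))
       (Seq (WStore (addr 6 (WConst 3 [+] WReg 11 [+] WReg 15)) (WReg 14)) (WAssign 15 (WReg 15 [+] WConst 1)))
       Skip"

definition build_row :: com where
  "build_row = Seq (for_prog 14 (WConst 0) (WReg 11) build_cell) (WStore (addr 6 (WConst 3 [+] WReg 13)) (WReg 15))"

definition build_prog :: com where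
  "build_prog =
     Seq (WStore (addr 6 (WConst 0)) (WReg 11)) (Seq (WStore (addr 6 (WConst 2)) (WConst 0))
       (Seq (WAssign 15 (WConst 0)) (for_prog 13 (WConst 0) (WReg 11) build_row)))"

text \<open>A set with more than \<open>A * i\<close> elements does not enter the
  \<open>i\<close>-th coefficient, and no answer is promised for it; hence the test. The index in
  cell 1 is the only part of the query that changes from round to round.\<close>

definition query_prog :: com where
  "query_prog = for_prog 16 (WConst 1) (WReg 1 [+] WConst 1)
     (If (WReg 11 [<] (WReg 3 [*] WReg 16 [+] WConst 1))
        (Seq (WStore (addr 6 (WConst 1)) (WReg 16))
          (Seq (Query 0 (addr 6 (WConst 0)) (WConst 3 [+] WReg 11 [+] WReg 15))
            (CStore (WReg 16) (CBin CAdd (CMem (WReg 16)) (CReg 0)))))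
        Skip)"

text \<open>\<open>B\<close> is a square so that one block holds the \<open>n * n\<close> matrix, or
  the input with at most \<open>n * D\<close> list entries, or a query of at most
  \<open>3 + K + K * K\<close> words. \<open>Lam i\<close> depends on the vertex set alone, although
  a query presents its vertices in some order; invariance of \<open>lam\<close> will justify
  this.\<close>

locale ram_ctx = adj_lists G xss D n + word_blocks w B for G xss D n w B +
  fixes m A K \<beta>m :: nat and orc :: "nat list \<Rightarrow> complex \<Rightarrow> nat \<Rightarrow> bool"
    and Lam :: "nat \<Rightarrow> nat set \<Rightarrow> complex"
  assumes pos: "n \<ge> 1" "m \<ge> 1" "D \<ge> 1"
    and B_eq: "B = (n + m + D + K + 4)\<^sup>2" and K_eq: "K = A * m"
    and answers: "\<And>i ys. i \<in> {1..m} \<Longrightarrow> distinct ys \<Longrightarrow> set ys \<subseteq> {..<n} \<Longrightarrow> length ys \<le> A * i \<Longrightarrow>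
      \<exists>t\<le>\<beta>m. orc ([length ys, i] @ encode_lists
        (map (\<lambda>a. filter (\<lambda>b. {ys ! a, ys ! b} \<in> edges G) [0..<length ys]) [0..<length ys])) (Lam i (set ys)) t"
begin

lemma B_bounds:
  "n + m + D + K + 4 < B" "n * n < B" "m * m < B" "3 + K + K * K < B" "5 + n + n * D < B" "K * D < B" "A \<le> K"
proof -
  have B: "B = (n + m + D + K + 4) * (n + m + D + K + 4)" by (simp add: B_eq power2_eq_square)
  show "n + m + D + K + 4 < B" "n * n < B" "m * m < B" "3 + K + K * K < B" "5 + n + n * D < B" "K * D < B"
    unfolding B by (simp_all add: algebra_simps)
  show "A \<le> K" using pos by (simp add: K_eq)
qed

definition off :: "nat \<Rightarrow> nat" where
  "off v = sum_list (map length (take v xss))"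

lemma off_Suc: "v < n \<Longrightarrow> off (Suc v) = off v + length (xss ! v)"
  by (simp add: off_def take_Suc_conv_app_nth length_xss)

lemma off_le: "v \<le> n \<Longrightarrow> off v \<le> v * D"
proof (induction v)
  case (Suc v)
  then show ?case using length_nth_le[of v] by (simp add: off_Suc)
qed (simp add: off_def)

lemma off_add_less: "v < n \<Longrightarrow> j < length (xss ! v) \<Longrightarrow> 5 + n + off v + j < B"
proof -
  assume a: "v < n" "j < length (xss ! v)"
  have "off (Suc v) \<le> Suc v * D" using a(1) by (intro off_le) simp
  also have "\<dots> \<le> n * D" using a(1) by (intro mult_right_mono) auto
  finally show ?thesis using a B_bounds(5) by (simp add: off_Suc)
qed

lemma pair_less: "x < n \<Longrightarrow> y < n \<Longrightarrow> x * n + y < B"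
proof -
  assume a: "x < n" "y < n"
  then have "Suc x * n \<le> n * n" by (intro mult_right_mono) auto
  then have "x * n + y < n * n" using a by simp
  then show ?thesis using B_bounds(2) by simp
qed

text \<open>The four parameters fill cells 0 to 3 and the \<open>n + 1\<close> offsets follow, hence
  the starting points 4 and \<open>5 + n\<close>.\<close>

definition params :: "state \<Rightarrow> bool" where
  "params s \<longleftrightarrow> wreg s 0 = n \<and> wreg s 1 = m \<and> wreg s 2 = D \<and> wreg s 3 = A \<and> wreg s 4 = K \<and> wreg s 5 = B \<and>
     (\<forall>v\<le>n. wmem s (4 + v) = off v) \<and>
     (\<forall>v<n. \<forall>j<length (xss ! v). wmem s (5 + n + off v + j) = xss ! v ! j)"

definition base :: "state \<Rightarrow> bool" where
  "base s \<longleftrightarrow> params s \<and> (\<forall>x<n. \<forall>y<n. wmem s (7 * B + (x * n + y)) = of_bool ({x, y} \<in> edges G))"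

lemma params_chg:
  assumes "chg R J s s'" "R \<inter> {..5} = {}" "0 \<notin> J" "params s"
  shows "params s'"
proof -
  have "wreg s' r = wreg s r" if "r \<le> 5" for r using assms(1,2) that by (auto simp: chg_def)
  moreover have "wmem s' a = wmem s a" if "a < B" for a using chg_wmem[OF assms(1) that assms(3)] by simp
  moreover have "4 + v < B" if "v \<le> n" for v using that B_bounds(1) by simp
  ultimately show ?thesis using assms(4) off_add_less by (auto simp: params_def)
qed

lemma base_chg:
  assumes "chg R J s s'" "R \<inter> {..5} = {}" "0 \<notin> J" "7 \<notin> J" "base s"
  shows "base s'"
  using assms params_chg[OF assms(1-3)] by (auto simp: base_def chg_wmem pair_less)

lemma base_regs:
  assumes "base s"
  shows "wreg s 0 = n" "wreg s (Suc 0) = m" "wreg s 2 = D" "wreg s 3 = A" "wreg s 4 = K" "wreg s 5 = B"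
  using assms by (simp_all add: base_def params_def)

lemma wval_edge:
  assumes "base s" "wval w e s = x" "wval w f s = y" "x < n" "y < n"
  shows "wval w (edge_exp e f) s = of_bool ({x, y} \<in> edges G)"
proof -
  have "x * n + y < B" "x * n < B" using pair_less[of x y] assms by auto
  then show ?thesis using assms by (simp add: edge_exp_def base_def params_def)
qed

text \<open>A vertex of the innermost set is reached by three lookups, as positions in one set refer
  to positions in the next. The bounds keep the intermediate values inside a block, so that they can
  serve as offsets.\<close>

definition verts_at :: "nat list \<Rightarrow> state \<Rightarrow> bool" where
  "verts_at ys s \<longleftrightarrow> (\<forall>a<length ys. wmem s (5 * B + (a + 1)) < B \<and>
     wmem s (4 * B + wmem s (5 * B + (a + 1))) < B \<and>
     wmem s (3 * B + wmem s (4 * B + wmem s (5 * B + (a + 1)))) = ys ! a)"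

lemma verts_at_chg: "chg R J s s' \<Longrightarrow> J \<inter> {3, 4, 5} = {} \<Longrightarrow> length ys < B \<Longrightarrow> verts_at ys s \<Longrightarrow> verts_at ys s'"
  using chg_wmem[of R J s s'] unfolding verts_at_def by (simp del: Suc_eq_plus1_left One_nat_def add_Suc_right)

lemma wval_vert:
  assumes "wreg s 5 = B" "verts_at ys s" "wval w e s = Suc a" "a < length ys" "length ys < B"
  shows "wval w (vert_exp e) s = ys ! a"
  using assms unfolding verts_at_def vert_exp_def by (simp add: Suc_lessI)

definition sub_lists :: "nat list \<Rightarrow> nat list list" where
  "sub_lists ys = map (\<lambda>a. filter (\<lambda>b. {ys ! a, ys ! b} \<in> edges G) [0..<length ys]) [0..<length ys]"

definition sub_off :: "nat list \<Rightarrow> nat \<Rightarrow> nat" where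
  "sub_off ys a = length (concat (take a (sub_lists ys)))"

text \<open>A partially written query: \<open>a\<close> rows are complete and \<open>zs\<close> is
  the part of the concatenated lists already stored. Cell 1 is left open for the index, since one
  block serves all the queries about the same set.\<close>

definition built :: "nat list \<Rightarrow> state \<Rightarrow> nat \<Rightarrow> nat list \<Rightarrow> state \<Rightarrow> bool" where
  "built ys s0 a zs s \<longleftrightarrow> chg {13, 14, 15} {6} s0 s \<and> cmem s = cmem s0 \<and>
     wmem s (6 * B) = length ys \<and> wreg s 15 = length zs \<and>
     (\<forall>v\<le>a. wmem s (6 * B + (2 + v)) = sub_off ys v) \<and>
     (\<forall>p<length zs. wmem s (6 * B + (3 + length ys + p)) = zs ! p)"

lemma length_sub_lists_nth: "a < length ys \<Longrightarrow> length (sub_lists ys ! a) \<le> length ys"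
  using length_filter_le[of _ "[0..<length ys]"] by (simp add: sub_lists_def)

lemma sub_off_Suc: "a < length ys \<Longrightarrow> sub_off ys (Suc a) = sub_off ys a + length (sub_lists ys ! a)"
  unfolding sub_off_def by (simp add: take_Suc_conv_app_nth sub_lists_def)

lemma sub_off_le: "a \<le> length ys \<Longrightarrow> sub_off ys a \<le> a * length ys"
proof (induction a)
  case (Suc a)
  then show ?case using length_sub_lists_nth[of a ys] by (simp add: sub_off_Suc)
qed (simp add: sub_off_def)

text \<open>The adjacency matrix makes each pair of positions a constant-time test, so a query takes
  time quadratic in \<open>K\<close>, independent of \<open>n\<close> and \<open>D\<close>.\<close>

lemma run_build:
  assumes base: "base s" and ys: "verts_at ys s" "set ys \<subseteq> {..<n}" "length ys \<le> K" and reg: "wreg s 11 = length ys"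
  shows "run w orc build_prog s (\<lambda>s' t. built ys s (length ys) (concat (sub_lists ys)) s' \<and> t \<le> 200 * (K + 1)\<^sup>2)"
proof -
  let ?k = "length ys"
  note bds = B_bounds B_ge w_pos
  have kB: "?k < B" using ys(3) bds by simp
  have kk: "?k * ?k \<le> K * K" using ys(3) by (intro mult_mono) auto
  have pB: "3 + ?k + p < B" if "p \<le> ?k * ?k" for p using that kk ys(3) bds by linarith
  have built_base: "base s'" "verts_at ys s'" "wreg s' 11 = ?k" if "built ys s a zs s'" for a zs s'
    using that base ys(1) reg kB verts_at_chg[of "{13, 14, 15}" "{6}" s s' ys]
      base_chg[of "{13, 14, 15}" "{6}" s s']
    by (auto simp: built_def chg_def)
  let ?row = "\<lambda>a b. filter (\<lambda>b. {ys ! a, ys ! b} \<in> edges G) [0..<b]"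
  let ?pre = "\<lambda>a. concat (take a (sub_lists ys))"
  have inner: "run w orc build_cell s1
       (\<lambda>s' t. (built ys s a (?pre a @ ?row a (Suc b)) s' \<and> wreg s' 13 = a) \<and> wreg s' 14 = b \<and> t \<le> 80)"
    if a: "a < ?k" and b: "b < ?k" and I: "built ys s a (?pre a @ ?row a b) s1" "wreg s1 13 = a" "wreg s1 14 = b" for a b s1
  proof -
    note st = built_base[OF I(1)]
    have va: "wval w (vert_exp (WReg 13 [+] WConst 1)) s1 = ys ! a"
      "wval w (vert_exp (WReg 14 [+] WConst 1)) s1 = ys ! b"
      using st a b I kB base_regs[OF st(1)] w_pos by (auto intro!: wval_vert)
    have yn: "ys ! a < n" "ys ! b < n" using ys(2) a b by (auto simp: subset_iff)
    have ev: "wval w (edge_exp (vert_exp (WReg 13 [+] WConst 1)) (vert_exp (WReg 14 [+] WConst 1))) s1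
        = of_bool ({ys ! a, ys ! b} \<in> edges G)"
      using wval_edge[OF st(1) va yn] .
    note ev = ev[unfolded One_nat_def]
    have cost: "wcost (edge_exp (vert_exp (WReg 13 [+] WConst 1)) (vert_exp (WReg 14 [+] WConst 1))) \<le> 50"
      by (simp add: edge_exp_def vert_exp_def)
    note cost = cost[unfolded One_nat_def]
    show ?thesis
    proof (cases "{ys ! a, ys ! b} \<in> edges G")
      case False
      then show ?thesis using I cost by (simp add: ev build_cell_def)
    next
      case True
      let ?zs = "?pre a @ ?row a b"
      \<comment> \<open>At most \<open>a\<close> full rows and \<open>b\<close> further entries have
        been written, so there is room for one more within \<open>?k * ?k\<close> cells.\<close>
      have "length (?row a b) \<le> b" using length_filter_le[of _ "[0..<b]"] by simp
      moreover have "length (?pre a) \<le> a * ?k" using sub_off_le[of a ys] a by (simp add: sub_off_def)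
      moreover have "Suc a * ?k \<le> ?k * ?k" using a by (intro mult_right_mono) auto
      ultimately have zs: "Suc (length ?zs) \<le> ?k * ?k" using b by simp
      let ?s2 = "s1\<lparr>wmem := (wmem s1)(6 * B + (3 + ?k + length ?zs) := b), wreg := (wreg s1)(15 := Suc (length ?zs))\<rparr>"
      have pz: "3 + ?k + length ?zs < B" using pB zs by simp
      have "chg {13, 14, 15} {6} s ?s2"
        using I(1) pz by (auto simp: built_def chg_def simp del: add_Suc add_Suc_right)
      moreover have "wmem ?s2 (6 * B + (2 + v)) = sub_off ys v" if "v \<le> a" for v
        using I(1) that a by (simp add: built_def)
      moreover have "wmem ?s2 (6 * B + (3 + ?k + p)) = (?zs @ [b]) ! p" if "p < Suc (length ?zs)" for p
        using I(1) that by (auto simp: built_def nth_append less_Suc_eq)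
      moreover have "?row a (Suc b) = ?row a b @ [b]" using True by simp
      ultimately have "built ys s a (?pre a @ ?row a (Suc b)) ?s2"
        using I(1) unfolding built_def by simp
      then show ?thesis
        using I st cost base_regs[OF st(1)] pz b kB w_pos True B_ge by (simp add: ev built_def build_cell_def)
    qed
  qed
  have outer: "run w orc build_row s1
      (\<lambda>s' t. built ys s (Suc a) (?pre (Suc a)) s' \<and> wreg s' 13 = a \<and> t \<le> 90 * (K + 1))" (is "run _ _ _ _ ?L1")
    if a: "a < ?k" and I: "built ys s a (?pre a) s1" "wreg s1 13 = a" for a s1
    unfolding build_row_def
  proof (rule run_Seq_mono)
    show "run w orc (for_prog 14 (WConst 0) (WReg 11)
          build_cell) s1
       (\<lambda>s' t. (built ys s a (?pre a @ ?row a ?k) s' \<and> wreg s' 13 = a) \<and> wreg s' 14 = ?k \<and>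
          t \<le> (?k - 0) * (80 + 7 + wcost (WReg 11)) + 4 + wcost (WConst 0) + wcost (WReg 11))"
    proof (rule run_for)
      show "?k < 2 ^ w" using kB w_bound by simp
      show "built ys s a (?pre a @ ?row a 0) s1 \<and> wreg s1 13 = a" using I by simp
      show "built ys s a (?pre a @ ?row a b) (s'\<lparr>wreg := (wreg s')(14 := v)\<rparr>) \<and>
          wreg (s'\<lparr>wreg := (wreg s')(14 := v)\<rparr>) 13 = a"
        if "built ys s a (?pre a @ ?row a b) s' \<and> wreg s' 13 = a" for b s' v
        using that by (auto simp: built_def chg_def)
      show "wval w (WReg 11) s' = ?k" if "built ys s a (?pre a @ ?row a b) s' \<and> wreg s' 13 = a" for b s'
        using that built_base(3)[of a "?pre a @ ?row a b" s'] by simp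
    qed (use inner[OF a] w_pos in auto)
    fix s2 t2 assume s2: "(built ys s a (?pre a @ ?row a ?k) s2 \<and> wreg s2 13 = a) \<and> wreg s2 14 = ?k \<and>
          t2 \<le> (?k - 0) * (80 + 7 + wcost (WReg 11)) + 4 + wcost (WConst 0) + wcost (WReg 11)"
    have b2: "built ys s a (?pre a @ ?row a ?k) s2" "wreg s2 13 = a" using s2 by auto
    note st = built_base[OF b2(1)]
    have row: "?pre a @ ?row a ?k = ?pre (Suc a)" using a by (simp add: take_Suc_conv_app_nth sub_lists_def)
    have aB: "3 + a < B" using a ys(3) bds by simp
    let ?s3 = "s2\<lparr>wmem := (wmem s2)(6 * B + (3 + a) := length (?pre (Suc a)))\<rparr>"
    have "chg {13, 14, 15} {6} s ?s3"
      using b2 aB unfolding built_def chg_def by (auto simp del: add_Suc add_Suc_right)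
    moreover have "wmem ?s3 (6 * B + (2 + v)) = sub_off ys v" if "v \<le> Suc a" for v
      using b2(1) that by (auto simp: built_def sub_off_def le_Suc_eq)
    moreover have "wmem ?s3 (6 * B + (3 + ?k + p)) = ?pre (Suc a) ! p" if "p < length (?pre (Suc a))" for p
      using b2(1) that a unfolding row by (simp add: built_def)
    ultimately have "built ys s (Suc a) (?pre (Suc a)) ?s3"
      using b2(1) unfolding row built_def by simp
    then show "run w orc (WStore (addr 6 (WConst 3 [+] WReg 13)) (WReg 15)) s2
       (\<lambda>s' t. ?L1 s' (t2 + t))"
      using b2 s2 base_regs[OF st(1)] aB ys(3) B_ge unfolding row by (simp add: built_def)
  qed
  let ?s1 = "s\<lparr>wmem := (wmem s)(6 * B := ?k, 6 * B + 2 := 0), wreg := (wreg s)(15 := 0)\<rparr>"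
  have "chg {13, 14, 15} {6} s ?s1"
    using block_div(1)[of 2 6] B_ge by (auto simp: chg_def)
  then have b1: "built ys s 0 (?pre 0) ?s1" by (auto simp: built_def sub_off_def)
  have "run w orc (for_prog 13 (WConst 0) (WReg 11) build_row) ?s1
     (\<lambda>s' t. built ys s ?k (?pre ?k) s' \<and> wreg s' 13 = ?k \<and>
        t \<le> (?k - 0) * (90 * (K + 1) + 7 + wcost (WReg 11)) + 4 + wcost (WConst 0) + wcost (WReg 11))"
  proof (rule run_for)
    show "?k < 2 ^ w" using kB w_bound by simp
    show "built ys s a (?pre a) (s'\<lparr>wreg := (wreg s')(13 := v)\<rparr>)" if "built ys s a (?pre a) s'" for a s' v
      using that by (auto simp: built_def chg_def)
    show "wval w (WReg 11) s' = ?k" if "built ys s a (?pre a) s'" for a s'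
      using built_base(3)[OF that] by simp
  qed (use outer b1 w_pos in auto)
  moreover have "?pre ?k = concat (sub_lists ys)" by (simp add: sub_lists_def)
  moreover have "?k * (90 * (K + 1) + 8) + 30 \<le> 200 * (K + 1)\<^sup>2"
  proof -
    have "?k * (90 * (K + 1) + 8) \<le> K * (90 * (K + 1) + 8)" using ys(3) by (intro mult_right_mono) auto
    then show ?thesis by (simp add: power2_eq_square algebra_simps)
  qed
  ultimately show ?thesis
    unfolding build_prog_def using base_regs[OF base] B_ge w_pos reg
    by (auto elim!: run_mono)
qed

end

section \<open>The Moebius transform at one vertex set\<close>

definition tloop_prog :: com where
  "tloop_prog = enum_prog 5 11 12 (WReg 9) (WReg 9) (Seq build_prog query_prog)"

definition zero_prog :: com where
  "zero_prog = for_prog 16 (WConst 1) (WReg 1 [+] WConst 1) (CStore (WReg 16) (CConst 0))"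

text \<open>Complex register 0 is both start value and accumulator, so the same loop serves Newton's
  identities in both directions: \<open>CSub\<close> yields power sums, \<open>CAdd\<close> leads
  back to coefficients.\<close>

definition convolve_prog :: "cop \<Rightarrow> nat \<Rightarrow> com" where
  "convolve_prog f b = for_prog 17 (WConst 1) (WReg 16)
     (CAssign 0 (CBin f (CReg 0) (CBin CMul (CMem (addr b (WReg 17))) (CMem (WReg 16 [-] WReg 17)))))"

text \<open>Register 7 holds the length of the code, which is one less than the size of
  \<open>U\<close>, and register 9 the size of \<open>S\<close>. The parity test thus produces the
  sign of the term of \<open>S\<close> in the Moebius transform.\<close>

definition newton_prog :: com where
  "newton_prog = for_prog 16 (WConst 1) (WReg 1 [+] WConst 1)
     (Seq (CAssign 0 (CBin CMul (CWord (WReg 16)) (CMem (WReg 16))))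
     (Seq (convolve_prog CSub 2)
     (Seq (CStore (addr 2 (WReg 16)) (CReg 0))
       (If (WBin Mod (WReg 7 [+] WReg 9 [+] WConst 1) (WConst 2))
          (CStore (addr 3 (WReg 16)) (CBin CSub (CMem (addr 3 (WReg 16))) (CReg 0)))
          (CStore (addr 3 (WReg 16)) (CBin CAdd (CMem (addr 3 (WReg 16))) (CReg 0)))))))"

definition sbody_prog :: com where
  "sbody_prog = Seq zero_prog (Seq tloop_prog newton_prog)"

definition sloop_prog :: com where
  "sloop_prog = enum_prog 4 9 10 (WReg 7 [+] WConst 1) (WReg 7 [+] WConst 1) sbody_prog"

context ram_ctx
begin

definition term_of :: "nat \<Rightarrow> nat set \<Rightarrow> complex" where
  "term_of x T = (if card T \<le> A * x then Lam x T else 0)"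

definition upd_coeffs :: "(nat \<Rightarrow> complex) \<Rightarrow> (nat \<Rightarrow> complex) \<Rightarrow> nat \<Rightarrow> complex" where
  "upd_coeffs f g x = (if x \<in> {1..m} then f x + g x else f x)"

text \<open>Up to a constant factor this bounds the work for one set \<open>T\<close>: building the
  query and asking it for \<open>m\<close> indices, where each query is charged its length and the
  time of its answer.\<close>

definition unit_time :: nat where
  "unit_time = m * (K + 1)\<^sup>2 * (\<beta>m + 1)"

lemma unit_time_ge: "m * (K + 1)\<^sup>2 \<le> unit_time" "m \<le> unit_time" "(K + 1)\<^sup>2 \<le> unit_time" "m * \<beta>m \<le> unit_time" "1 \<le> unit_time"
proof -
  have 1: "1 \<le> (K + 1)\<^sup>2" by simp
  show a: "m * (K + 1)\<^sup>2 \<le> unit_time" by (simp add: unit_time_def)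
  have "m * 1 \<le> m * (K + 1)\<^sup>2" using 1 by (intro mult_left_mono) auto
  then show b: "m \<le> unit_time" using a by linarith
  have "1 * (K + 1)\<^sup>2 \<le> m * (K + 1)\<^sup>2" using pos by (intro mult_right_mono) auto
  then show "(K + 1)\<^sup>2 \<le> unit_time" using a by linarith
  have "m * 1 * \<beta>m \<le> m * (K + 1)\<^sup>2 * (\<beta>m + 1)" using 1 by (intro mult_mono) auto
  then show "m * \<beta>m \<le> unit_time" by (simp add: unit_time_def)
  show "1 \<le> unit_time" using b pos by simp
qed

lemma encode_sub_lists:
  "encode_lists (sub_lists ys) = map (sub_off ys) [0..<length ys + 1] @ concat (sub_lists ys)"
  by (simp add: encode_lists_def sub_off_def length_concat sub_lists_def del: upt_Suc)

lemma run_queries: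
  assumes base: "base s" and built: "built ys s0 (length ys) (concat (sub_lists ys)) s"
    and ys: "distinct ys" "set ys \<subseteq> {..<n}" "length ys \<le> K" and reg: "wreg s 11 = length ys"
  shows "run w orc query_prog s (\<lambda>s' t. chg {16} {6} s s' \<and>
    cmem s' = upd_coeffs (cmem s) (\<lambda>x. term_of x (set ys)) \<and> t \<le> 110 * unit_time)" (is "run _ _ _ _ ?Q")
proof -
  let ?k = "length ys" and ?len = "length (concat (sub_lists ys))"
  note bds = B_bounds B_ge w_pos
  have "?len = sub_off ys ?k" by (simp add: sub_off_def sub_lists_def)
  also have "\<dots> \<le> ?k * ?k" by (rule sub_off_le) simp
  also have "\<dots> \<le> K * K" using ys(3) by (intro mult_mono) auto
  finally have len: "?len \<le> K * K" .
  have r15: "wreg s 15 = ?len" using built by (simp add: built_def)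
  \<comment> \<open>Cell 1 is exempted because it holds the index of the current query.\<close>
  define I where "I j s' \<longleftrightarrow> chg {16} {6} s s' \<and>
      (\<forall>x<B. x \<noteq> 1 \<longrightarrow> wmem s' (6 * B + x) = wmem s (6 * B + x)) \<and>
      cmem s' = upd_coeffs (cmem s) (\<lambda>x. if x < j then term_of x (set ys) else 0)" for j s'
  have cd: "card (set ys) = ?k" using ys(1) by (rule distinct_card)
  let ?T = "60 + K + K * K + \<beta>m"
  have "run w orc query_prog s (\<lambda>s' t. I (m + 1) s' \<and> wreg s' 16 = m + 1 \<and>
      t \<le> (m + 1 - 1) * (?T + 7 + wcost (WReg 1 [+] WConst 1)) + 4 + wcost (WConst 1) + wcost (WReg 1 [+] WConst 1))" (is "run _ _ _ _ ?L1")
    unfolding query_prog_def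
  proof (rule run_for)
    show "m + 1 < 2 ^ w" using bds w_bound by linarith
    show "w > 0" by (rule w_pos)
    show "wval w (WConst 1) s = 1" using bds by simp
    show "1 \<le> m + 1" by simp
    show "I 1 s" by (auto simp: I_def upd_coeffs_def fun_eq_iff)
    show "I j (s'\<lparr>wreg := (wreg s')(16 := v)\<rparr>)" if "I j s'" for j s' v
      using that by (auto simp: I_def chg_def)
    show "wval w (WReg 1 [+] WConst 1) s' = m + 1" if "I j s'" for j s'
    proof -
      have "wreg s' 1 = m" using that base_regs[OF base] chg_wreg[of "{16}" "{6}" s s' 1] by (simp add: I_def)
      then show ?thesis using bds by simp
    qed
    fix i s1 assume i: "1 \<le> i" "i < m + 1" and I: "I i s1" and r16: "wreg s1 16 = i"
    have Ai: "A * i \<le> K" using i by (simp add: K_eq)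
    have chg1: "chg {16} {6} s s1" using I by (simp add: I_def)
    have regs: "wreg s1 3 = A" "wreg s1 5 = B" "wreg s1 11 = ?k" "wreg s1 15 = ?len"
      using chg_wreg[OF chg1] base_regs[OF base] reg r15 by auto
    have cond: "wval w (WReg 11 [<] (WReg 3 [*] WReg 16 [+] WConst 1)) s1 = (if ?k \<le> A * i then 1 else 0)"
      using regs r16 Ai bds by (simp add: less_Suc_eq_le)
    show "run w orc (If (WReg 11 [<] (WReg 3 [*] WReg 16 [+] WConst 1))
        (Seq (WStore (addr 6 (WConst 1)) (WReg 16))
          (Seq (Query 0 (addr 6 (WConst 0)) (WConst 3 [+] WReg 11 [+] WReg 15))
            (CStore (WReg 16) (CBin CAdd (CMem (WReg 16)) (CReg 0)))))
        Skip) s1 (\<lambda>s' t. I (Suc i) s' \<and> wreg s' 16 = i \<and> t \<le> ?T)"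
    proof (cases "?k \<le> A * i")
      case False
      then have "I (Suc i) s1"
        using I cd unfolding I_def by (auto simp: upd_coeffs_def fun_eq_iff term_of_def less_Suc_eq)
      then show ?thesis unfolding run_If cond using False r16 by simp
    next
      case True
      let ?s2 = "s1\<lparr>wmem := (wmem s1)(6 * B + 1 := i)\<rparr>"
      have mem: "wmem ?s2 (6 * B + x) = (if x = 1 then i else wmem s (6 * B + x))" if "x < B" for x
        using I that by (auto simp: I_def)
      have qlen: "3 + ?k + ?len < B" using len ys(3) bds by linarith
      \<comment> \<open>With the index in cell 1 and the offsets and lists written before, the block
        reads exactly as the input format of the procedure.\<close>
      have query: "map (\<lambda>j. wmem ?s2 ((6 * B + j) mod 2 ^ w)) [0..<3 + ?k + ?len]
          = [?k, i] @ encode_lists (sub_lists ys)"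
      proof (rule nth_equalityI)
        show "length (map (\<lambda>j. wmem ?s2 ((6 * B + j) mod 2 ^ w)) [0..<3 + ?k + ?len])
          = length ([?k, i] @ encode_lists (sub_lists ys))" by (simp add: encode_sub_lists)
        fix j assume "j < length (map (\<lambda>j. wmem ?s2 ((6 * B + j) mod 2 ^ w)) [0..<3 + ?k + ?len])"
        then have j: "j < 3 + ?k + ?len" by simp
        have "(6 * B + j) mod 2 ^ w = 6 * B + j" using j qlen by simp
        then have eq: "map (\<lambda>j. wmem ?s2 ((6 * B + j) mod 2 ^ w)) [0..<3 + ?k + ?len] ! j
            = (if j = 1 then i else wmem s (6 * B + j))"
          using mem[of j] j qlen by (simp del: fun_upd_apply)
        consider "j = 0" | "j = 1" | v where "j = 2 + v" "v \<le> ?k" | p where "j = 3 + ?k + p" "p < ?len"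
        proof -
          have "j = 0 \<or> j = 1 \<or> (j = 2 + (j - 2) \<and> j - 2 \<le> ?k) \<or> (j = 3 + ?k + (j - (3 + ?k)) \<and> j - (3 + ?k) < ?len)"
            using j by linarith
          then show thesis using that by blast
        qed
        then show "map (\<lambda>j. wmem ?s2 ((6 * B + j) mod 2 ^ w)) [0..<3 + ?k + ?len] ! j
          = ([?k, i] @ encode_lists (sub_lists ys)) ! j"
        proof cases
          case 3
          then have "([?k, i] @ encode_lists (sub_lists ys)) ! j = sub_off ys v"
            by (simp add: encode_sub_lists nth_append less_Suc_eq_le del: upt_Suc)
          moreover have "wmem s (6 * B + j) = sub_off ys v" using built 3 unfolding built_def by blast
          ultimately show ?thesis unfolding eq using 3 by simp
        next
          case 4
          then have "([?k, i] @ encode_lists (sub_lists ys)) ! j = concat (sub_lists ys) ! p"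
            by (simp add: encode_sub_lists nth_append nth_Cons' del: upt_Suc)
          moreover have "wmem s (6 * B + j) = concat (sub_lists ys) ! p" using built 4 unfolding built_def by blast
          ultimately show ?thesis unfolding eq using 4 by simp
        qed (use built eq in \<open>auto simp: built_def\<close>)
      qed
      obtain t where t: "t \<le> \<beta>m" "orc ([?k, i] @ encode_lists (sub_lists ys)) (Lam i (set ys)) t"
        using answers[of i ys] i ys True unfolding sub_lists_def by auto
      let ?s3 = "?s2\<lparr>creg := (creg ?s2)(0 := Lam i (set ys))\<rparr>"
      have iB: "i < B" using i bds by linarith
      have s3: "wreg ?s3 = wreg s1" "cmem ?s3 = cmem s1" by simp_all
      have I3: "I (Suc i) (?s3\<lparr>cmem := (cmem s1)(i := cmem s1 i + Lam i (set ys))\<rparr>)"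
      proof -
        have "chg {16} {6} s ?s2" using chg1 block_div(1)[of 1 6] bds by (auto simp: chg_def)
        then have "chg {16} {6} s (?s3\<lparr>cmem := (cmem s1)(i := cmem s1 i + Lam i (set ys))\<rparr>)"
          by (simp add: chg_def)
        moreover have "(cmem s1)(i := cmem s1 i + Lam i (set ys))
            = upd_coeffs (cmem s) (\<lambda>x. if x < Suc i then term_of x (set ys) else 0)"
          using I i True cd by (auto simp: I_def upd_coeffs_def term_of_def fun_eq_iff less_Suc_eq)
        ultimately show ?thesis using I unfolding I_def by simp
      qed
      have "run w orc (Query 0 (addr 6 (WConst 0)) (WConst 3 [+] WReg 11 [+] WReg 15)) ?s2
        (\<lambda>s' t'. s' = ?s3 \<and> t' \<le> 20 + (3 + ?k + ?len) + \<beta>m)"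
      proof (rule run_Query)
        have a: "wval w (addr 6 (WConst 0)) ?s2 = 6 * B" "wval w (WConst 3 [+] WReg 11 [+] WReg 15) ?s2 = 3 + ?k + ?len"
          using regs bds qlen by simp_all
        show "orc (map (\<lambda>j. wmem ?s2 ((wval w (addr 6 (WConst 0)) ?s2 + j) mod 2 ^ w))
            [0..<wval w (WConst 3 [+] WReg 11 [+] WReg 15) ?s2]) (Lam i (set ys)) t"
          unfolding a query by (rule t(2))
        show "?s3 = ?s3 \<and> 1 + wcost (addr 6 (WConst 0)) + wcost (WConst 3 [+] WReg 11 [+] WReg 15) +
            wval w (WConst 3 [+] WReg 11 [+] WReg 15) ?s2 + t \<le> 20 + (3 + ?k + ?len) + \<beta>m"
          unfolding a using t(1) by simp
      qed
      then have "run w orc (Seq (Query 0 (addr 6 (WConst 0)) (WConst 3 [+] WReg 11 [+] WReg 15))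
            (CStore (WReg 16) (CBin CAdd (CMem (WReg 16)) (CReg 0)))) ?s2
        (\<lambda>s' t'. (I (Suc i) s' \<and> wreg s' 16 = i) \<and> t' \<le> 30 + (3 + ?k + ?len) + \<beta>m)"
        by (rule run_Seq_mono) (use I3 r16 in auto)
      then have "run w orc (Seq (WStore (addr 6 (WConst 1)) (WReg 16))
          (Seq (Query 0 (addr 6 (WConst 0)) (WConst 3 [+] WReg 11 [+] WReg 15))
            (CStore (WReg 16) (CBin CAdd (CMem (WReg 16)) (CReg 0))))) s1
        (\<lambda>s' t'. (I (Suc i) s' \<and> wreg s' 16 = i) \<and> t' \<le> 40 + (3 + ?k + ?len) + \<beta>m)"
        unfolding run_Seq[of w orc "WStore (addr 6 (WConst 1)) (WReg 16)"] run_simps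
        using regs r16 bds by (auto elim!: run_mono)
      then show ?thesis
        unfolding run_If cond if_P[OF True] using len ys(3) by (auto elim!: run_mono)
    qed
  qed
  then show ?thesis
  proof (rule run_mono)
    fix s' t assume a: "?L1 s' t"
    have "K + K * K \<le> (K + 1)\<^sup>2" by (simp add: power2_eq_square)
    then have "m * (K + K * K) \<le> m * (K + 1)\<^sup>2" by (rule mult_left_mono) simp
    then have "m * K + m * (K * K) \<le> unit_time" using unit_time_ge(1) by (simp add: algebra_simps)
    moreover have "t \<le> 70 * m + (m * K + m * (K * K)) + m * \<beta>m + 10" using a by (simp add: algebra_simps)
    ultimately have "t \<le> 110 * unit_time" using unit_time_ge by linarith
    moreover have "cmem s' = upd_coeffs (cmem s) (\<lambda>x. term_of x (set ys))"
      using a by (auto simp: I_def upd_coeffs_def fun_eq_iff)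
    ultimately show "?Q s' t"
      using a by (simp add: I_def)
  qed
qed

lemma run_tbody:
  assumes base: "base s" and ys: "verts_at ys s" "distinct ys" "set ys \<subseteq> {..<n}" "length ys \<le> K"
    and reg: "wreg s 11 = length ys"
  shows "run w orc (Seq build_prog query_prog) s (\<lambda>s' t. chg {13..16} {6} s s' \<and>
    cmem s' = upd_coeffs (cmem s) (\<lambda>x. term_of x (set ys)) \<and> t \<le> 310 * unit_time)" (is "run _ _ _ _ ?Q")
proof (rule run_Seq_mono[OF run_build[OF base ys(1,3,4) reg]])
  fix s1 t1 assume 1: "built ys s (length ys) (concat (sub_lists ys)) s1 \<and> t1 \<le> 200 * (K + 1)\<^sup>2"
  then have c: "chg {13, 14, 15} {6} s s1" "cmem s1 = cmem s" by (auto simp: built_def)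
  have "base s1" "wreg s1 11 = length ys" using base_chg[OF c(1) _ _ _ base] chg_wreg[OF c(1), of 11] reg by auto
  with 1 have "run w orc query_prog s1 (\<lambda>s' t. chg {16} {6} s1 s' \<and>
    cmem s' = upd_coeffs (cmem s1) (\<lambda>x. term_of x (set ys)) \<and> t \<le> 110 * unit_time)" (is "run _ _ _ _ ?L1")
    using ys by (intro run_queries) auto
  then show "run w orc query_prog s1 (\<lambda>s2 t2. ?Q s2 (t1 + t2))"
  proof (rule run_mono)
    fix s2 t2 assume 2: "?L1 s2 t2"
    have "chg {13..16} {6} s s1" using c(1) by (rule chg_mono) auto
    then have "chg {13..16} {6} s s2" using 2 by (elim conjE, elim chg_trans) auto
    then show "?Q s2 (t1 + t2)"
      using 1 2 c(2) unit_time_ge(3) by simp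
  qed
qed

lemma incs_nth:
  assumes "xs \<in> set (incs u c 0)" "a < length xs"
  shows "1 \<le> xs ! a" "xs ! a \<le> u"
proof -
  have "xs ! a \<in> set xs" using assms(2) by (rule nth_mem)
  then show "1 \<le> xs ! a" "xs ! a \<le> u" using assms(1) by (auto simp: set_incs Suc_le_eq)
qed

text \<open>By \<open>coeffs_on_eq\<close> the sums accumulated over all subsets are the
  coefficients on the set presented by \<open>zs\<close>.\<close>

lemma run_tloop:
  assumes base: "base s" and zs: "stack 4 9 zs s" "zs \<in> set (incs (length U) (length U) 0)"
    and U: "vec 3 U s" "distinct U" "set U \<subseteq> {..<n}" "length U \<le> K"
  shows "run w orc tloop_prog s (\<lambda>s' t. chg {11..16} {5, 6} s s' \<and>
    cmem s' = upd_coeffs (cmem s) (\<lambda>x. \<Sum>T\<in>Pow (set (pick U zs)). term_of x T) \<and>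
    t \<le> 2 ^ length zs * (450 * unit_time))"
proof -
  let ?vs = "pick U zs" and ?E = "incs (length zs) (length zs) 0"
  define P where "P j s' \<longleftrightarrow> chg {11..16} {5, 6} s s' \<and>
      cmem s' = upd_coeffs (cmem s) (\<lambda>x. \<Sum>i<j. term_of x (set (pick ?vs (?E ! i))))" for j s'
  note vs = pick_props[OF U(2) zs(2)]
  have lzs: "length zs \<le> length U" using zs(2) by (simp add: set_incs)
  have lB: "length U < B" "length zs < B" using U(4) lzs B_bounds(1) by simp_all
  have "run w orc tloop_prog s (\<lambda>s' t. P (length ?E) s' \<and> t \<le> (\<Sum>xs\<leftarrow>?E. 310 * unit_time + 110) + 20)" (is "run _ _ _ _ ?L1")
    unfolding tloop_prog_def
  proof (rule run_enum)
    show "P 0 s" by (auto simp: P_def upd_coeffs_def)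
    show "wreg s 5 = B" using base_regs[OF base] by simp
    show "P j s''" if "P j s'" "chg {11, 12} {5} s' s''" "cmem s'' = cmem s'" for j s' s''
    proof -
      have "chg {11..16} {5, 6} s s''" using that(1,2) unfolding P_def by (elim conjE, elim chg_trans) auto
      then show ?thesis using that by (simp add: P_def)
    qed
    show "wreg s' 5 = B \<and> wval w (WReg 9) s' = length zs \<and> wval w (WReg 9) s' = length zs" if "P j s'" for j s'
      using that base_regs[OF base] zs(1) chg_wreg[of _ _ s s'] by (auto simp: P_def stack_def)
    fix j xs s1 assume j: "j < length ?E" "xs = ?E ! j" and P: "P j s1" and st: "stack 5 11 xs s1" and d: "wreg s1 12 = 1"
    have xs: "xs \<in> set ?E" using j by simp
    let ?ys = "pick ?vs xs"
    have xs': "xs \<in> set (incs (length ?vs) (length zs) 0)" using xs by simp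
    note ys = pick_props[OF vs(1) xs']
    have len: "length xs \<le> length zs" using xs by (simp add: set_incs)
    have c1: "chg {11..16} {5, 6} s s1" using P by (simp add: P_def)
    have base1: "base s1" using base_chg[OF c1 _ _ _ base] by simp
    have st4: "stack 4 9 zs s1" using chg_stack[OF c1, of 4 9 zs] zs(1) lB by simp
    have v3: "vec 3 U s1" using chg_vec[OF c1, of 3 U] U(1) lB by simp
    have "verts_at ?ys s1"
      unfolding verts_at_def
    proof (intro allI impI)
      fix a assume "a < length ?ys"
      then have a: "a < length xs" by simp
      have xa: "1 \<le> xs ! a" "xs ! a \<le> length zs" using incs_nth[OF xs a] by auto
      then have za: "1 \<le> zs ! (xs ! a - 1)" "zs ! (xs ! a - 1) \<le> length U"
        using incs_nth[OF zs(2), of "xs ! a - 1"] by auto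
      have m5: "wmem s1 (5 * B + (a + 1)) = xs ! a" using st a by (simp add: stack_def vec_def)
      have m4: "wmem s1 (4 * B + xs ! a) = zs ! (xs ! a - 1)"
        using stack_nth[OF st4, of "xs ! a"] xa by (simp add: nth_Cons')
      obtain z where z: "zs ! (xs ! a - 1) = Suc z" using za by (cases "zs ! (xs ! a - 1)") auto
      have m3: "wmem s1 (3 * B + zs ! (xs ! a - 1)) = U ! (zs ! (xs ! a - 1) - 1)"
        using v3 za z by (simp add: vec_def)
      show "wmem s1 (5 * B + (a + 1)) < B \<and> wmem s1 (4 * B + wmem s1 (5 * B + (a + 1))) < B \<and>
         wmem s1 (3 * B + wmem s1 (4 * B + wmem s1 (5 * B + (a + 1)))) = ?ys ! a"
        unfolding m5 m4 m3 using xa za lB a by (simp add: pick_def)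
    qed
    moreover have "wreg s1 11 = length ?ys" using st by (simp add: stack_def)
    moreover have "length ?ys \<le> K" using len lzs U(4) by simp
    moreover have "set ?ys \<subseteq> {..<n}" using ys(2) vs(2) U(3) by blast
    ultimately have "run w orc (Seq build_prog query_prog) s1 (\<lambda>s' t. chg {13..16} {6} s1 s' \<and>
        cmem s' = upd_coeffs (cmem s1) (\<lambda>x. term_of x (set ?ys)) \<and> t \<le> 310 * unit_time)" (is "run _ _ _ _ ?L2")
      using base1 ys(1) by (intro run_tbody)
    then show "run w orc (Seq build_prog query_prog) s1 (\<lambda>s' t. P (Suc j) s' \<and> stack 5 11 xs s' \<and> wreg s' 12 = 1 \<and>
        t \<le> 310 * unit_time)"
    proof (rule run_mono)
      fix s' t assume a: "?L2 s' t"
      have "chg {11..16} {5, 6} s s'" using a c1 by (elim conjE, elim chg_trans) auto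
      moreover have "stack 5 11 xs s'" using chg_stack[of "{13..16}" "{6}" s1 s' 5 11 xs] a st len lB by simp
      moreover have "wreg s' 12 = 1" using a d chg_wreg[of "{13..16}" "{6}" s1 s' 12] by simp
      ultimately show "P (Suc j) s' \<and> stack 5 11 xs s' \<and> wreg s' 12 = 1 \<and> t \<le> 310 * unit_time"
        using a P j(2) by (auto simp: P_def upd_coeffs_def fun_eq_iff)
    qed
  qed (use lB in auto)
  then show ?thesis
  proof (rule run_mono)
    fix s' t assume a: "?L1 s' t"
    have "(\<Sum>i<length ?E. term_of x (set (pick ?vs (?E ! i)))) = (\<Sum>T\<in>Pow (set ?vs). term_of x T)" for x
      using sum_pick[OF vs(1), of "term_of x"] by (simp add: sum_list_sum_nth atLeast0LessThan)
    moreover have "length ?E = 2 ^ length zs" using sum_power_length_incs[of 1 "length zs"] by (simp add: sum_list_triv numeral_2_eq_2)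
    moreover have "2 ^ length zs * (310 * unit_time + 110) + 20 \<le> 2 ^ length zs * (450 * unit_time)"
    proof -
      have "2 ^ length zs * (310 * unit_time + 110) + 1 * 20
          \<le> 2 ^ length zs * (310 * unit_time + 110 * unit_time) + 2 ^ length zs * (20 * unit_time)"
        using unit_time_ge(5) by (intro add_mono mult_mono) auto
      also have "\<dots> = 2 ^ length zs * (440 * unit_time)" by (simp add: algebra_simps)
      also have "\<dots> \<le> 2 ^ length zs * (450 * unit_time)" by simp
      finally show ?thesis by simp
    qed
    ultimately show "chg {11..16} {5, 6} s s' \<and>
      cmem s' = upd_coeffs (cmem s) (\<lambda>x. \<Sum>T\<in>Pow (set ?vs). term_of x T) \<and> t \<le> 2 ^ length zs * (450 * unit_time)"
      using a by (auto simp: P_def sum_list_triv)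
  qed
qed


definition coeff_series :: "nat set \<Rightarrow> complex fps" where
  "coeff_series S = Abs_fps (\<lambda>x. if x = 0 then 1 else \<Sum>T\<in>Pow S. term_of x T)"

definition power_sums :: "nat \<Rightarrow> nat set \<Rightarrow> complex" where
  "power_sums x S = fps_nth (psum (coeff_series S)) x"

lemma run_zero:
  assumes base: "base s"
  shows "run w orc zero_prog s (\<lambda>s' t. chg {16} {} s s' \<and>
    cmem s' = (\<lambda>x. if x \<in> {1..m} then 0 else cmem s x) \<and> t \<le> 30 * m)"
proof -
  define I where "I j s' \<longleftrightarrow> chg {16} {} s s' \<and> cmem s' = (\<lambda>x. if 1 \<le> x \<and> x < j then 0 else cmem s x)" for j s'
  have "run w orc zero_prog s (\<lambda>s' t. I (m + 1) s' \<and> wreg s' 16 = m + 1 \<and>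
      t \<le> (m + 1 - 1) * (3 + 7 + wcost (WReg 1 [+] WConst 1)) + 4 + wcost (WConst 1) + wcost (WReg 1 [+] WConst 1))"
    unfolding zero_prog_def
  proof (rule run_for)
    show "m + 1 < 2 ^ w" using B_bounds(1) w_bound by linarith
    show "w > 0" by (rule w_pos)
    show "wval w (WConst 1) s = 1" using B_ge w_pos by simp
    show "I 1 s" by (auto simp: I_def)
    show "I j (s'\<lparr>wreg := (wreg s')(16 := v)\<rparr>)" if "I j s'" for j s' v
      using that by (auto simp: I_def chg_def)
    show "wval w (WReg 1 [+] WConst 1) s' = m + 1" if "I j s'" for j s'
    proof -
      have "wreg s' 1 = m" using that base_regs[OF base] chg_wreg[of "{16}" "{}" s s' 1] by (simp add: I_def)
      then show ?thesis using B_bounds(1) B_ge w_pos by simp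
    qed
    show "run w orc (CStore (WReg 16) (CConst 0)) s1 (\<lambda>s' t. I (Suc i) s' \<and> wreg s' 16 = i \<and> t \<le> 3)"
      if "1 \<le> i" "I i s1" "wreg s1 16 = i" for i s1
      using that by (auto simp: I_def chg_def fun_eq_iff less_Suc_eq)
  qed simp
  then show ?thesis
    by (rule run_mono) (use pos in \<open>auto simp: I_def\<close>)
qed

text \<open>Only offsets from 1 to \<open>i - 1\<close> are read, so a caller may fill in its
  unknown values one index after the other.\<close>

lemma run_convolve:
  assumes reg: "wreg s 5 = B" "wreg s 16 = i" and i: "1 \<le> i" "i < B" and b: "b < 8" and f: "f = CAdd \<or> f = CSub"
  shows "run w orc (convolve_prog f b) s (\<lambda>s' t. chg {17} {} s s' \<and> cmem s' = cmem s \<and>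
    creg s' 0 = cop_val f (creg s 0) (\<Sum>l\<in>{1..<i}. cmem s (b * B + l) * cmem s (i - l)) \<and> t \<le> 28 * i)"
proof -
  define J where "J j s' \<longleftrightarrow> chg {17} {} s s' \<and> cmem s' = cmem s \<and>
      creg s' 0 = cop_val f (creg s 0) (\<Sum>l\<in>{1..<j}. cmem s (b * B + l) * cmem s (i - l))" for j s'
  have "run w orc (convolve_prog f b) s (\<lambda>s' t. J i s' \<and> wreg s' 17 = i \<and>
     t \<le> (i - 1) * (20 + 7 + wcost (WReg 16)) + 4 + wcost (WConst 1) + wcost (WReg 16))"
    unfolding convolve_prog_def
  proof (rule run_for)
    show "i < 2 ^ w" using i w_bound by linarith
    show "w > 0" by (rule w_pos)
    show "wval w (WConst 1) s = 1" using B_ge w_pos by simp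
    show "J 1 s" using f by (auto simp: J_def)
    show "J j (s'\<lparr>wreg := (wreg s')(17 := v)\<rparr>)" if "J j s'" for j s' v
      using that by (auto simp: J_def chg_def)
    show "wval w (WReg 16) s' = i" if "J j s'" for j s'
      using that reg chg_wreg[of "{17}" "{}" s s' 16] by (simp add: J_def)
    fix j s1 assume j: "1 \<le> j" "j < i" and J: "J j s1" and r17: "wreg s1 17 = j"
    have c1: "chg {17} {} s s1" using J by (simp add: J_def)
    have "wreg s1 5 = B" "wreg s1 16 = i" using chg_wreg[OF c1, of 5] chg_wreg[OF c1, of 16] reg by simp_all
    then have "wval w (addr b (WReg 17)) s1 = b * B + j" "wval w (WReg 16 [-] WReg 17) s1 = i - j"
      using r17 j i b B_ge w_pos by simp_all
    then show "run w orc (CAssign 0 (CBin f (CReg 0) (CBin CMul (CMem (addr b (WReg 17))) (CMem (WReg 16 [-] WReg 17))))) s1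
      (\<lambda>s' t. J (Suc j) s' \<and> wreg s' 17 = j \<and> t \<le> 20)"
      using J j r17 f by (auto simp: J_def chg_def)
  qed (use i in simp)
  then show ?thesis
    by (rule run_mono) (use i in \<open>auto simp: J_def\<close>)
qed

lemma run_newton:
  assumes base: "base s" and E: "fps_nth E 0 = 1" "\<And>x. x \<in> {1..m} \<Longrightarrow> cmem s x = fps_nth E x"
    and reg: "wreg s 7 + 1 = k" "wreg s 9 = l" "k \<le> K" "l \<le> K"
  shows "run w orc newton_prog s (\<lambda>s' t. chg {16, 17} {} s s' \<and>
    (\<forall>x\<in>{1..m}. cmem s' (3 * B + x) = cmem s (3 * B + x) + (-1) ^ (k + l) * fps_nth (psum E) x) \<and>
    t \<le> 110 * (m * m))" (is "run _ _ _ _ ?Q")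
proof -
  note bds = B_bounds B_ge w_pos
  define I where "I j s' \<longleftrightarrow> chg {16, 17} {} s s' \<and> (\<forall>x\<in>{1..m}. cmem s' x = fps_nth E x) \<and>
      (\<forall>x. 1 \<le> x \<and> x < j \<longrightarrow> cmem s' (2 * B + x) = fps_nth (psum E) x) \<and>
      (\<forall>x\<in>{1..m}. cmem s' (3 * B + x) = cmem s (3 * B + x) +
         (if x < j then (-1) ^ (k + l) * fps_nth (psum E) x else 0))" for j s'
  have mB: "m < B" using bds by simp
  have "run w orc newton_prog s (\<lambda>s' t. I (m + 1) s' \<and> wreg s' 16 = m + 1 \<and>
      t \<le> (m + 1 - 1) * ((28 * m + 60) + 7 + wcost (WReg 1 [+] WConst 1)) + 4 + wcost (WConst 1) + wcost (WReg 1 [+] WConst 1))" (is "run _ _ _ _ ?L1")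
    unfolding newton_prog_def
  proof (rule run_for)
    show "m + 1 < 2 ^ w" using bds w_bound by linarith
    show "w > 0" by (rule w_pos)
    show "wval w (WConst 1) s = 1" using bds by simp
    show "I 1 s" using E by (auto simp: I_def)
    show "I j (s'\<lparr>wreg := (wreg s')(16 := v)\<rparr>)" if "I j s'" for j s' v
      using that by (auto simp: I_def chg_def)
    show "wval w (WReg 1 [+] WConst 1) s' = m + 1" if "I j s'" for j s'
    proof -
      have "wreg s' 1 = m" using that base_regs[OF base] chg_wreg[of "{16, 17}" "{}" s s' 1] by (simp add: I_def)
      then show ?thesis using bds by simp
    qed
    fix i s1 assume i: "1 \<le> i" "i < m + 1" and I: "I i s1" and r16: "wreg s1 16 = i"
    have c1: "chg {16, 17} {} s s1" using I by (simp add: I_def)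
    have r5: "wreg s1 5 = B" "wreg s1 7 + 1 = k" "wreg s1 9 = l"
      using chg_wreg[OF c1] base_regs[OF base] reg by auto
    have iB: "i < B" using i mB by linarith
    let ?s2 = "s1\<lparr>creg := (creg s1)(0 := of_nat i * fps_nth E i)\<rparr>"
    define J where "J s' \<longleftrightarrow> chg {17} {} ?s2 s' \<and> cmem s' = cmem s1 \<and> creg s' 0 = fps_nth (psum E) i" for s'
    have inner: "run w orc (convolve_prog CSub 2) ?s2 (\<lambda>s' t. J s' \<and> t \<le> 28 * i)"
    proof -
      have "cmem s1 (2 * B + l) * cmem s1 (i - l) = fps_nth (psum E) l * fps_nth E (i - l)" if "l \<in> {1..<i}" for l
      proof -
        have "i - l \<in> {1..m}" using i that by auto
        then show ?thesis using I that by (simp add: I_def)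
      qed
      then have "(\<Sum>l\<in>{1..<i}. cmem s1 (2 * B + l) * cmem s1 (i - l)) = (\<Sum>l\<in>{1..<i}. fps_nth (psum E) l * fps_nth E (i - l))"
        by (rule sum.cong[OF refl])
      then show ?thesis
        using r5 r16 i iB psum_rec[OF E(1), of i]
        by (intro run_mono[OF run_convolve[of ?s2 i 2 CSub]]) (simp_all add: J_def)
    qed
    let ?tail = "Seq (CStore (addr 2 (WReg 16)) (CReg 0))
       (If (WBin Mod (WReg 7 [+] WReg 9 [+] WConst 1) (WConst 2))
          (CStore (addr 3 (WReg 16)) (CBin CSub (CMem (addr 3 (WReg 16))) (CReg 0)))
          (CStore (addr 3 (WReg 16)) (CBin CAdd (CMem (addr 3 (WReg 16))) (CReg 0))))"
    have tail: "run w orc ?tail s3 (\<lambda>s' t. (I (Suc i) s' \<and> wreg s' 16 = i) \<and> t \<le> 45)" if J: "J s3" for s3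
    proof -
      have c3: "chg {17} {} ?s2 s3" using J by (simp add: J_def)
      have r3: "wreg s3 5 = B" "wreg s3 16 = i" "wreg s3 7 + 1 = k" "wreg s3 9 = l"
        using chg_wreg[OF c3, of 5] chg_wreg[OF c3, of 16] chg_wreg[OF c3, of 7] chg_wreg[OF c3, of 9] r5 r16 by simp_all
      have ps: "creg s3 0 = fps_nth (psum E) i" using J by (simp add: J_def)
      have cm: "cmem s3 = cmem s1" using J by (simp add: J_def)
      let ?s4 = "s3\<lparr>cmem := (cmem s1)(2 * B + i := fps_nth (psum E) i)\<rparr>"
      have c4: "chg {16, 17} {} s s3" using c1 c3 by (auto simp: chg_def)
      have cond: "wval w (WBin Mod (WReg 7 [+] WReg 9 [+] WConst 1) (WConst 2)) s' = (k + l) mod 2"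
        if "wreg s' = wreg s3" for s'
      proof -
        have lt: "wreg s3 7 + l + 1 < 8 * B" "wreg s3 7 + l < 8 * B" and eq: "wreg s3 7 + l + 1 = k + l"
          using r3 reg bds by linarith+
        have "wval w (WBin Mod (WReg 7 [+] WReg 9 [+] WConst 1) (WConst 2)) s' = (wreg s3 7 + l + 1) mod 2"
          using lt that r3(4) bds by simp
        then show ?thesis unfolding eq .
      qed
      have a3: "wval w (addr 3 (WReg 16)) s' = 3 * B + i" "wval w (addr 2 (WReg 16)) s' = 2 * B + i"
        if "wreg s' = wreg s3" for s'
        using that r3 iB by simp_all
      have fin: "I (Suc i) (?s4\<lparr>cmem := (cmem ?s4)(3 * B + i := cmem s1 (3 * B + i) + (-1) ^ (k + l) * fps_nth (psum E) i)\<rparr>)"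
        using I i mB iB c4 unfolding I_def by (auto simp: chg_def less_Suc_eq)
      have eq3: "cmem ?s4 (3 * B + i) = cmem s1 (3 * B + i)" using iB by simp
      have cond4: "wval w (WBin Mod (WReg 7 [+] WReg 9 [+] WConst 1) (WConst 2)) ?s4 = (k + l) mod 2"
        by (rule cond) simp
      have "run w orc (If (WBin Mod (WReg 7 [+] WReg 9 [+] WConst 1) (WConst 2))
          (CStore (addr 3 (WReg 16)) (CBin CSub (CMem (addr 3 (WReg 16))) (CReg 0)))
          (CStore (addr 3 (WReg 16)) (CBin CAdd (CMem (addr 3 (WReg 16))) (CReg 0)))) ?s4
        (\<lambda>s' t. (I (Suc i) s' \<and> wreg s' 16 = i) \<and> t \<le> 30)"
      proof (cases "(k + l) mod 2 = 0")
        case True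
        then have "(-1::complex) ^ (k + l) = 1" by (simp add: minus_one_power_iff even_iff_mod_2_eq_zero)
        then show ?thesis
          unfolding run_If cond4 using True fin r3 ps cm eq3 by (simp add: a3)
      next
        case False
        then have "(-1::complex) ^ (k + l) = -1" by (simp add: minus_one_power_iff even_iff_mod_2_eq_zero)
        then show ?thesis
          unfolding run_If cond4 using False fin r3 ps cm eq3 by (simp add: a3)
      qed
      then show ?thesis
        unfolding run_Seq run_simps a3(2)[OF refl] cval.simps ps cm by (auto elim!: run_mono)
    qed
    have st2: "run w orc (CAssign 0 (CBin CMul (CWord (WReg 16)) (CMem (WReg 16)))) s1 (\<lambda>s' t. s' = ?s2 \<and> t \<le> 6)"
      using I i r16 by (simp add: I_def)
    show "run w orc (Seq (CAssign 0 (CBin CMul (CWord (WReg 16)) (CMem (WReg 16)))) (Seq (convolve_prog CSub 2) ?tail)) s1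
      (\<lambda>s' t. I (Suc i) s' \<and> wreg s' 16 = i \<and> t \<le> 28 * m + 60)"
    proof (rule run_Seq_mono[OF st2], elim conjE, hypsubst, rule run_Seq_mono[OF inner], elim conjE)
      fix t1 t3 :: nat and s3 :: state assume t: "t1 \<le> 6" "J s3" "t3 \<le> 28 * i"
      then have "t1 + (t3 + 45) \<le> 28 * m + 60" using i by simp
      then show "run w orc ?tail s3 (\<lambda>s2 t2. I (Suc i) s2 \<and> wreg s2 16 = i \<and> t1 + (t3 + t2) \<le> 28 * m + 60)"
        by (intro run_mono[OF tail[OF t(2)]]) auto
    qed
  qed simp
  then show ?thesis
  proof (rule run_mono)
    fix s' t assume a: "?L1 s' t"
    have "m * 1 \<le> m * m" "1 * 1 \<le> m * m" using pos by (intro mult_mono; simp)+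
    moreover have "t \<le> 28 * (m * m) + 70 * m + 8" using a by (simp add: algebra_simps)
    ultimately have "t \<le> 110 * (m * m)" by linarith
    then show "?Q s' t"
      using a by (simp add: I_def)
  qed
qed

lemma run_sbody:
  assumes base: "base s" and zs: "stack 4 9 zs s" "zs \<in> set (incs (length U) (length U) 0)"
    and U: "vec 3 U s" "distinct U" "set U \<subseteq> {..<n}" "length U \<le> K" "wreg s 7 + 1 = length U"
  shows "run w orc sbody_prog s (\<lambda>s' t. chg {11..17} {5, 6} s s' \<and>
    (\<forall>x\<in>{1..m}. cmem s' (3 * B + x) = cmem s (3 * B + x) +
       (-1) ^ (length U + length zs) * power_sums x (set (pick U zs))) \<and>
    t \<le> 2 ^ length zs * (600 * (m * unit_time)))" (is "run _ _ _ _ ?Q")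
  unfolding sbody_prog_def
proof (rule run_Seq_mono[OF run_zero[OF base]])
  fix s1 t1 assume 1: "chg {16} {} s s1 \<and> cmem s1 = (\<lambda>x. if x \<in> {1..m} then 0 else cmem s x) \<and> t1 \<le> 30 * m"
  have mB: "m < B" "K < B" using B_bounds by simp_all
  have lzs: "length zs \<le> length U" using zs(2) by (simp add: set_incs)
  have c1: "chg {16} {} s s1" using 1 by simp
  have base1: "base s1" using base_chg[OF c1 _ _ _ base] by simp
  have st1: "stack 4 9 zs s1" "vec 3 U s1"
    using chg_stack[OF c1, of 4 9 zs] chg_vec[OF c1, of 3 U] zs U lzs mB by simp_all
  have "run w orc tloop_prog s1 (\<lambda>s' t. chg {11..16} {5, 6} s1 s' \<and>
    cmem s' = upd_coeffs (cmem s1) (\<lambda>x. \<Sum>T\<in>Pow (set (pick U zs)). term_of x T) \<and>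
    t \<le> 2 ^ length zs * (450 * unit_time))" (is "run _ _ _ _ ?L1")
    using base1 st1 zs(2) U by (intro run_tloop)
  then show "run w orc (Seq tloop_prog newton_prog) s1 (\<lambda>s' t. ?Q s' (t1 + t))"
  proof (rule run_Seq_mono)
    fix s2 t2 assume 2: "?L1 s2 t2"
    have c2: "chg {11..16} {5, 6} s1 s2" using 2 by simp
    have c12: "chg {11..17} {5, 6} s s2"
      by (rule chg_trans[OF chg_mono[OF c1] c2]) auto
    have base2: "base s2" using base_chg[OF c2 _ _ _ base1] by simp
    have cm: "cmem s2 (3 * B + x) = cmem s (3 * B + x)" if "x \<in> {1..m}" for x
      using 1 2 mB that by (simp add: upd_coeffs_def)
    have "run w orc newton_prog s2 (\<lambda>s' t. chg {16, 17} {} s2 s' \<and>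
      (\<forall>x\<in>{1..m}. cmem s' (3 * B + x) = cmem s2 (3 * B + x) +
        (-1) ^ (length U + length zs) * fps_nth (psum (coeff_series (set (pick U zs)))) x) \<and>
      t \<le> 110 * (m * m))" (is "run _ _ _ _ ?L2")
    proof (rule run_newton[OF base2])
      show "cmem s2 x = fps_nth (coeff_series (set (pick U zs))) x" if "x \<in> {1..m}" for x
        using 1 2 that by (simp add: upd_coeffs_def coeff_series_def)
      show "wreg s2 7 + 1 = length U" "wreg s2 9 = length zs"
        using chg_wreg[OF c12] U(5) zs(1) by (auto simp: stack_def)
    qed (use U lzs in \<open>auto simp: coeff_series_def\<close>)
    then show "run w orc newton_prog s2 (\<lambda>s' t. ?Q s' (t1 + (t2 + t)))"
    proof (rule run_mono)
      fix s3 t3 assume 3: "?L2 s3 t3"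
      have "chg {11..17} {5, 6} s s3" using c12 3 by (elim conjE, elim chg_trans) auto
      moreover have "t1 + (t2 + t3) \<le> 2 ^ length zs * (600 * (m * unit_time))"
      proof -
        let ?q = "2 ^ length zs :: nat"
        have "1 * (30 * m) + (?q * (450 * (1 * unit_time)) + 1 * (110 * (m * m)))
          \<le> ?q * (30 * (m * unit_time)) + (?q * (450 * (m * unit_time)) + ?q * (110 * (m * unit_time)))"
          using unit_time_ge pos by (intro add_mono mult_mono) auto
        also have "\<dots> = ?q * (590 * (m * unit_time))" by (simp add: algebra_simps)
        also have "\<dots> \<le> ?q * (600 * (m * unit_time))" by simp
        finally show ?thesis using 1 2 3 by simp
      qed
      ultimately show "?Q s3 (t1 + (t2 + t3))"
        using 3 cm by (simp add: power_sums_def)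
    qed
  qed
qed

text \<open>Block 3 is only added to, so the transforms of successive sets accumulate there and none
  of them is stored.\<close>

lemma run_sloop:
  assumes base: "base s"
    and U: "vec 3 U s" "distinct U" "set U \<subseteq> {..<n}" "length U \<le> K" "wreg s 7 + 1 = length U"
  shows "run w orc sloop_prog s (\<lambda>s' t. chg {9..17} {4, 5, 6} s s' \<and>
    (\<forall>x\<in>{1..m}. cmem s' (3 * B + x) = cmem s (3 * B + x) + mob (power_sums x) (set U)) \<and>
    t \<le> 3 ^ length U * (800 * (m * unit_time)))"
proof -
  let ?k = "length U" and ?E = "incs (length U) (length U) 0"
  define P where "P j s' \<longleftrightarrow> chg {9..17} {4, 5, 6} s s' \<and>
      (\<forall>x\<in>{1..m}. cmem s' (3 * B + x) = cmem s (3 * B + x) +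
        (\<Sum>i<j. (-1) ^ (?k + length (?E ! i)) * power_sums x (set (pick U (?E ! i)))))" for j s'
  have kB: "Suc ?k < B" using U(4) B_bounds(1) by simp
  have mu: "1 \<le> m * unit_time" using mult_mono[of 1 m 1 unit_time] pos unit_time_ge(5) by simp
  have "run w orc sloop_prog s (\<lambda>s' t. P (length ?E) s' \<and> t \<le> (\<Sum>zs\<leftarrow>?E. 2 ^ length zs * (600 * (m * unit_time)) + 110) + 20)" (is "run _ _ _ _ ?L1")
    unfolding sloop_prog_def
  proof (rule run_enum)
    show "P 0 s" by (simp add: P_def)
    show "wreg s 5 = B" using base_regs[OF base] by simp
    show "P j s''" if "P j s'" "chg {9, 10} {4} s' s''" "cmem s'' = cmem s'" for j s' s''
    proof -
      have "chg {9..17} {4, 5, 6} s s''" using that(1,2) unfolding P_def by (elim conjE, elim chg_trans) auto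
      then show ?thesis using that by (simp add: P_def)
    qed
    show "wreg s' 5 = B \<and> wval w (WReg 7 [+] WConst 1) s' = ?k \<and> wval w (WReg 7 [+] WConst 1) s' = ?k" if "P j s'" for j s'
    proof -
      have "wreg s' 5 = B" "wreg s' 7 + 1 = ?k"
        using that base_regs[OF base] U(5) chg_wreg[of _ _ s s'] by (auto simp: P_def)
      then show ?thesis using kB w_pos by auto
    qed
    fix j zs s1 assume j: "j < length ?E" "zs = ?E ! j" and P: "P j s1" and st: "stack 4 9 zs s1" and d: "wreg s1 10 = 1"
    have zs: "zs \<in> set ?E" using j by simp
    have lzs: "length zs \<le> ?k" using zs by (simp add: set_incs)
    have c1: "chg {9..17} {4, 5, 6} s s1" using P by (simp add: P_def)
    have base1: "base s1" using base_chg[OF c1 _ _ _ base] by simp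
    have v3: "vec 3 U s1" using chg_vec[OF c1, of 3 U] U(1) kB by simp
    have r7: "wreg s1 7 + 1 = ?k" using chg_wreg[OF c1, of 7] U(5) by simp
    show "run w orc sbody_prog s1 (\<lambda>s' t. P (Suc j) s' \<and> stack 4 9 zs s' \<and> wreg s' 10 = 1 \<and>
        t \<le> 2 ^ length zs * (600 * (m * unit_time)))"
    proof (rule run_mono[OF run_sbody[OF base1 st zs v3 U(2-4) r7]])
      fix s' t assume a: "chg {11..17} {5, 6} s1 s' \<and>
        (\<forall>x\<in>{1..m}. cmem s' (3 * B + x) = cmem s1 (3 * B + x) +
           (-1) ^ (?k + length zs) * power_sums x (set (pick U zs))) \<and>
        t \<le> 2 ^ length zs * (600 * (m * unit_time))"
      have "chg {9..17} {4, 5, 6} s s'" using a c1 by (elim conjE, elim chg_trans) auto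
      moreover have "stack 4 9 zs s'" using chg_stack[of "{11..17}" "{5, 6}" s1 s' 4 9 zs] a st lzs kB by simp
      moreover have "wreg s' 10 = 1" using a d chg_wreg[of "{11..17}" "{5, 6}" s1 s' 10] by simp
      ultimately show "P (Suc j) s' \<and> stack 4 9 zs s' \<and> wreg s' 10 = 1 \<and> t \<le> 2 ^ length zs * (600 * (m * unit_time))"
        using a P j(2) by (simp add: P_def)
    qed
  qed (use kB in auto)
  then show ?thesis
  proof (rule run_mono)
    fix s' t assume a: "?L1 s' t"
    have "(\<Sum>i<length ?E. (-1) ^ (?k + length (?E ! i)) * power_sums x (set (pick U (?E ! i)))) = mob (power_sums x) (set U)" for x
    proof -
      have "(\<Sum>i<length ?E. (-1) ^ (?k + length (?E ! i)) * power_sums x (set (pick U (?E ! i))))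
        = (\<Sum>zs\<leftarrow>?E. (-1) ^ (?k + length zs) * power_sums x (set (pick U zs)))"
        by (simp add: sum_list_sum_nth atLeast0LessThan)
      also have "\<dots> = (\<Sum>zs\<leftarrow>?E. (-1) ^ (card (set U) + card (set (pick U zs))) * power_sums x (set (pick U zs)))"
        using pick_props(3)[OF U(2), of _ ?k] distinct_card[OF U(2)]
        by (intro arg_cong[where f = sum_list] map_cong refl) simp
      also have "\<dots> = mob (power_sums x) (set U)"
        unfolding mob_def by (rule sum_pick[OF U(2), of "\<lambda>S. (-1) ^ (card (set U) + card S) * power_sums x S"])
      finally show ?thesis .
    qed
    moreover have "(\<Sum>zs\<leftarrow>?E. 2 ^ length zs * (600 * (m * unit_time)) + 110) + 20 \<le> 3 ^ ?k * (800 * (m * unit_time))"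
    proof -
      have "(\<Sum>zs\<leftarrow>?E. 2 ^ length zs * (600 * (m * unit_time)) + 110) \<le> (\<Sum>zs\<leftarrow>?E. 2 ^ length zs * (710 * (m * unit_time)))"
      proof (rule sum_list_mono)
        fix zs :: "nat list"
        have "1 * 110 \<le> 2 ^ length zs * (110 * (m * unit_time))" using mu by (intro mult_mono) auto
        then show "2 ^ length zs * (600 * (m * unit_time)) + 110 \<le> 2 ^ length zs * (710 * (m * unit_time))"
          by (simp add: algebra_simps)
      qed
      also have "\<dots> = (\<Sum>zs\<leftarrow>?E. 2 ^ length zs) * (710 * (m * unit_time))" by (simp add: sum_list_mult_const)
      also have "(\<Sum>zs\<leftarrow>?E. (2::nat) ^ length zs) = 3 ^ ?k" using sum_power_length_incs[of 2 ?k] by simp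
      finally have 1: "(\<Sum>zs\<leftarrow>?E. 2 ^ length zs * (600 * (m * unit_time)) + 110) \<le> 3 ^ ?k * (710 * (m * unit_time))" .
      have "20 \<le> 90 * (m * unit_time)" using mu by linarith
      then have "1 * 20 \<le> 3 ^ ?k * (90 * (m * unit_time))" by (intro mult_mono) auto
      then show ?thesis using 1 by (simp add: algebra_simps)
    qed
    ultimately show "chg {9..17} {4, 5, 6} s s' \<and>
      (\<forall>x\<in>{1..m}. cmem s' (3 * B + x) = cmem s (3 * B + x) + mob (power_sums x) (set U)) \<and>
      t \<le> 3 ^ ?k * (800 * (m * unit_time))"
      using a by (auto simp: P_def)
  qed
qed

end

section \<open>Decoding, and the loops over codes and roots\<close>

definition check_prog :: com where
  "check_prog = If (fetch 3 (WReg 14 [+] WConst 1) [=] WReg 19) (WAssign 18 (WConst 0))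
     (If ((WReg 14 [<] WReg 16) [*] edge_exp (fetch 3 (WReg 14 [+] WConst 1)) (WReg 19)) (WAssign 18 (WConst 0)) Skip)"

definition extend_prog :: com where
  "extend_prog =
     Seq (WAssign 19 (WMem (WConst 5 [+] WReg 0 [+] WMem (WConst 4 [+] WReg 15) [+] WReg 17)))
     (Seq (WAssign 18 (WReg 6 [<] WReg 19))
     (Seq (for_prog 14 (WConst 0) (WReg 13 [+] WConst 1) check_prog)
       (WStore (addr 3 (WReg 13 [+] WConst 2)) (WReg 19))))"

text \<open>Register 18 is the success flag. Slots start at 1, so 1 is subtracted before dividing by
  \<open>D\<close>, which is in register 2.\<close>

definition decode_step :: com where
  "decode_step = If (WReg 18)
     (Seq (WAssign 19 (fetch 2 (WReg 13 [+] WConst 1) [-] WConst 1))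
     (Seq (WAssign 16 (WBin Div (WReg 19) (WReg 2)))
     (Seq (WAssign 17 (WBin Mod (WReg 19) (WReg 2)))
       (If (WReg 16 [<] (WReg 13 [+] WConst 1))
          (Seq (WAssign 15 (fetch 3 (WReg 16 [+] WConst 1)))
            (If (WReg 17 [<] (WMem (WConst 5 [+] WReg 15) [-] WMem (WConst 4 [+] WReg 15)))
               extend_prog (WAssign 18 (WConst 0))))
          (WAssign 18 (WConst 0))))))
     Skip"

definition decode_prog :: com where
  "decode_prog = Seq (WStore (addr 3 (WConst 1)) (WReg 6)) (Seq (WAssign 18 (WConst 1))
     (for_prog 13 (WConst 0) (WReg 7) decode_step))"

definition cloop_prog :: com where
  "cloop_prog = enum_prog 2 7 8 (WReg 4 [-] WConst 1) (WReg 4 [*] WReg 2)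
     (Seq decode_prog (If (WReg 18) sloop_prog Skip))"

definition vloop_prog :: com where
  "vloop_prog = for_prog 6 (WConst 0) (WReg 0) cloop_prog"

context ram_ctx
begin

text \<open>The flag enters with the outcome \<open>c\<close> of the comparison with the root and is
  only ever cleared. All positions are tested for equality with \<open>x\<close>, but only those
  before \<open>i\<close> for adjacency.\<close>

lemma run_check:
  assumes base: "base s" and L: "vec 3 L s" "set L \<subseteq> {..<n}" "length L \<le> K"
    and reg: "wreg s 13 + 1 = length L" "wreg s 16 = i" "wreg s 19 = x" "wreg s 18 = of_bool c"
    and i: "i < length L" and x: "x < n"
  shows "run w orc (for_prog 14 (WConst 0) (WReg 13 [+] WConst 1) check_prog) s (\<lambda>s' t. chg {14, 18} {} s s' \<and> cmem s' = cmem s \<and>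
    wreg s' 18 = of_bool (c \<and> x \<notin> set L \<and> (\<forall>i'<i. x \<notin> set (xss ! (L ! i')))) \<and> t \<le> 60 * (K + 1))" (is "run _ _ _ _ ?Q")
proof -
  note bds = B_bounds B_ge w_pos
  have LB: "length L < B" using L(3) bds by simp
  define I where "I b s' \<longleftrightarrow> chg {14, 18} {} s s' \<and> cmem s' = cmem s \<and>
      wreg s' 18 = of_bool (c \<and> (\<forall>i'<b. L ! i' \<noteq> x \<and> (i' < i \<longrightarrow> x \<notin> set (xss ! (L ! i')))))" for b s'
  have "run w orc (for_prog 14 (WConst 0) (WReg 13 [+] WConst 1) check_prog) s (\<lambda>s' t. I (length L) s' \<and> wreg s' 14 = length L \<and>
      t \<le> (length L - 0) * (40 + 7 + wcost (WReg 13 [+] WConst 1)) + 4 + wcost (WConst 0) + wcost (WReg 13 [+] WConst 1))" (is "run _ _ _ _ ?L1")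
  proof (rule run_for)
    show "length L < 2 ^ w" using LB w_bound by linarith
    show "w > 0" by (rule w_pos)
    show "I 0 s" using reg by (simp add: I_def)
    show "I j (s'\<lparr>wreg := (wreg s')(14 := v)\<rparr>)" if "I j s'" for j s' v
      using that by (auto simp: I_def chg_def)
    show "wval w (WReg 13 [+] WConst 1) s' = length L" if "I j s'" for j s'
    proof -
      have "wreg s' 13 + 1 = length L" using that reg chg_wreg[of "{14, 18}" "{}" s s' 13] by (simp add: I_def)
      then show ?thesis using LB w_pos by simp
    qed
    fix b s1 assume b: "b < length L" and I: "I b s1" and r14: "wreg s1 14 = b"
    have c1: "chg {14, 18} {} s s1" using I by (simp add: I_def)
    have base1: "base s1" using base_chg[OF c1 _ _ _ base] by simp
    have regs: "wreg s1 16 = i" "wreg s1 19 = x" "wreg s1 5 = B"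
      using chg_wreg[OF c1, of 16] chg_wreg[OF c1, of 19] reg base_regs[OF base1] by simp_all
    have v3: "vec 3 L s1" using chg_vec[OF c1, of 3 L] L(1) LB by simp
    have Lb: "L ! b < n" using subsetD[OF L(2) nth_mem[OF b]] by simp
    have f: "wval w (fetch 3 (WReg 14 [+] WConst 1)) s1 = L ! b"
      using v3 b r14 regs LB bds by (simp add: vec_def)
    have e: "wval w (edge_exp (fetch 3 (WReg 14 [+] WConst 1)) (WReg 19)) s1 = of_bool (x \<in> set (xss ! (L ! b)))"
    proof -
      have "wval w (edge_exp (fetch 3 (WReg 14 [+] WConst 1)) (WReg 19)) s1 = of_bool ({L ! b, x} \<in> edges G)"
        using regs by (intro wval_edge[OF base1 f _ Lb x]) simp
      then show ?thesis using set_nth[OF Lb] by (simp add: insert_commute)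
    qed
    have c: "wval w (fetch 3 (WReg 14 [+] WConst 1) [=] WReg 19) s1 = of_bool (L ! b = x)"
      using f regs w_pos by simp
    have d: "wval w ((WReg 14 [<] WReg 16) [*] edge_exp (fetch 3 (WReg 14 [+] WConst 1)) (WReg 19)) s1
        = of_bool (b < i \<and> x \<in> set (xss ! (L ! b)))"
      using e r14 regs w_pos by (simp del: One_nat_def)
    show "run w orc check_prog s1 (\<lambda>s' t. I (Suc b) s' \<and> wreg s' 14 = b \<and> t \<le> 40)"
      unfolding check_prog_def run_If c d
      using I r14 by (auto simp: I_def chg_def less_Suc_eq edge_exp_def)
  qed simp_all
  then show ?thesis
  proof (rule run_mono)
    fix s' t assume a: "?L1 s' t"
    have "(\<forall>i'<length L. L ! i' \<noteq> x \<and> (i' < i \<longrightarrow> x \<notin> set (xss ! (L ! i')))) \<longleftrightarrow>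
        x \<notin> set L \<and> (\<forall>i'<i. x \<notin> set (xss ! (L ! i')))"
    proof -
      have "x \<notin> set L \<longleftrightarrow> (\<forall>i'<length L. L ! i' \<noteq> x)" by (metis in_set_conv_nth)
      then show ?thesis using i by (metis less_trans)
    qed
    moreover have "t \<le> 60 * (K + 1)" using a L(3) by simp
    ultimately show "?Q s' t"
      using a by (simp add: I_def)
  qed
qed

definition decoded :: "nat list option \<Rightarrow> state \<Rightarrow> bool" where
  "decoded r s \<longleftrightarrow> (case r of None \<Rightarrow> wreg s 18 = 0 | Some L \<Rightarrow> wreg s 18 = 1 \<and> vec 3 L s)"

lemma run_decode_step:
  assumes base: "base s" and L: "vec 3 L s" "set L \<subseteq> {..<n}" "length L < K" "wreg s 18 = 1"
    and v: "wreg s 6 = v" and j: "wreg s 13 = j" "length L = Suc j"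
    and y: "wmem s (2 * B + (j + 1)) = y" "1 \<le> y" "y < B"
  shows "run w orc decode_step s (\<lambda>s' t. chg {14..19} {3} s s' \<and> cmem s' = cmem s \<and>
    decoded (bfs_step xss D v L y) s' \<and> t \<le> 200 * (K + 1))" (is "run _ _ _ _ ?Q")
proof -
  note bds = B_bounds B_ge w_pos
  define i where "i = (y - 1) div D"
  define k where "k = (y - 1) mod D"
  let ?s1 = "s\<lparr>wreg := (wreg s)(19 := y - 1, 16 := i, 17 := k)\<rparr>"
  note regs = base_regs[OF base]
  have KB: "K < B" "j + 2 < B" using L(3) j(2) bds by simp_all
  have chg1: "chg {14..19} {3} s ?s1" by (auto simp: chg_def)
  have val19: "wval w (fetch 2 (WReg 13 [+] WConst 1) [-] WConst 1) s = y - 1"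
    using j(1) regs y KB bds by simp
  let ?rest = "If (WReg 16 [<] (WReg 13 [+] WConst 1))
          (Seq (WAssign 15 (fetch 3 (WReg 16 [+] WConst 1)))
            (If (WReg 17 [<] (WMem (WConst 5 [+] WReg 15) [-] WMem (WConst 4 [+] WReg 15)))
               extend_prog (WAssign 18 (WConst 0))))
          (WAssign 18 (WConst 0))"
  have cond1: "wval w (WReg 16 [<] (WReg 13 [+] WConst 1)) ?s1 = of_bool (i < length L)"
    using j KB bds by simp
  have rest: "run w orc ?rest ?s1 (\<lambda>s' t. (chg {14..19} {3} s s' \<and> cmem s' = cmem s \<and>
    decoded (bfs_step xss D v L y) s') \<and> t \<le> 160 * (K + 1))"
  proof (cases "i < length L")
    case False
    then have "bfs_step xss D v L y = None" by (simp add: bfs_step_def i_def)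
    then show ?thesis
      unfolding run_If cond1 using False by (auto simp: decoded_def chg_def)
  next
    case True
    have Li: "L ! i < n" using L(2) nth_mem[OF True] by auto
    let ?s2 = "?s1\<lparr>wreg := (wreg ?s1)(15 := L ! i)\<rparr>"
    have val15: "wval w (fetch 3 (WReg 16 [+] WConst 1)) ?s1 = L ! i"
    proof -
      have "i + 1 < B" using True j(2) KB by simp
      then show ?thesis using True L(1) regs bds by (simp add: vec_def)
    qed
    have offs: "wmem s (4 + L ! i) = off (L ! i)" "wmem s (5 + L ! i) = off (L ! i) + length (xss ! (L ! i))"
    proof -
      have o: "wmem s (4 + u) = off u" if "u \<le> n" for u using base that by (simp add: base_def params_def)
      show "wmem s (4 + L ! i) = off (L ! i)" using o[of "L ! i"] Li by simp
      have "4 + Suc (L ! i) = 5 + L ! i" by simp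
      then show "wmem s (5 + L ! i) = off (L ! i) + length (xss ! (L ! i))"
        using o[of "Suc (L ! i)"] Li off_Suc[OF Li] by simp
    qed
    have offB: "off (L ! i) + length (xss ! (L ! i)) < B"
    proof -
      have "off (Suc (L ! i)) \<le> Suc (L ! i) * D" using Li by (intro off_le) simp
      also have "\<dots> \<le> n * D" using Li by (intro mult_right_mono) auto
      finally show ?thesis using bds off_Suc[OF Li] by linarith
    qed
    have cond2: "wval w (WReg 17 [<] (WMem (WConst 5 [+] WReg 15) [-] WMem (WConst 4 [+] WReg 15))) ?s2
        = of_bool (k < length (xss ! (L ! i)))"
      using offs offB Li bds by simp
    have "run w orc (If (WReg 17 [<] (WMem (WConst 5 [+] WReg 15) [-] WMem (WConst 4 [+] WReg 15)))
               extend_prog (WAssign 18 (WConst 0))) ?s2 (\<lambda>s' t. (chg {14..19} {3} s s' \<and> cmem s' = cmem s \<and>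
      decoded (bfs_step xss D v L y) s') \<and> t \<le> 140 * (K + 1))"
    proof (cases "k < length (xss ! (L ! i))")
      case False
      then have "bfs_step xss D v L y = None" by (simp add: bfs_step_def i_def k_def)
      then show ?thesis
        unfolding run_If cond2 using False by (auto simp: decoded_def chg_def)
    next
      case kl: True
      define x where "x = xss ! (L ! i) ! k"
      have xn: "x < n" unfolding x_def using Li kl by (rule nth_nth_less)
      let ?s3 = "?s2\<lparr>wreg := (wreg ?s2)(19 := x, 18 := of_bool (v < x))\<rparr>"
      have valx: "wval w (WMem (WConst 5 [+] WReg 0 [+] WMem (WConst 4 [+] WReg 15) [+] WReg 17)) ?s2 = x"
      proof -
        have "5 + n + off (L ! i) + k < B" using Li kl by (rule off_add_less)
        moreover have "wmem s (5 + n + off (L ! i) + k) = x"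
          using base Li kl by (simp add: base_def params_def x_def)
        moreover have "4 + L ! i < 8 * B" using Li bds by linarith
        ultimately show ?thesis using offs(1) regs bds by simp
      qed
      have c3: "chg {14..19} {3} s ?s3" by (auto simp: chg_def)
      have b3: "base ?s3" using base_chg[OF c3 _ _ _ base] by simp
      have v3: "vec 3 L ?s3" using L(1) by (simp add: vec_def)
      define ok where "ok \<longleftrightarrow> v < x \<and> x \<notin> set L \<and> (\<forall>i'<i. x \<notin> set (xss ! (L ! i')))"
      have step: "bfs_step xss D v L y = (if ok then Some (L @ [x]) else None)"
        unfolding bfs_step_def Let_def i_def[symmetric] k_def[symmetric] x_def[symmetric] ok_def
        using True kl by simp
      have chk: "run w orc (for_prog 14 (WConst 0) (WReg 13 [+] WConst 1) check_prog) ?s3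
        (\<lambda>s' t. chg {14, 18} {} ?s3 s' \<and> cmem s' = cmem ?s3 \<and> wreg s' 18 = of_bool ok \<and> t \<le> 60 * (K + 1))" (is "run _ _ _ _ ?L1")
        unfolding ok_def by (rule run_check[OF b3 v3 L(2) _ _ _ _ _ True xn]) (use j L(3) in auto)
      have "run w orc (Seq (for_prog 14 (WConst 0) (WReg 13 [+] WConst 1) check_prog)
          (WStore (addr 3 (WReg 13 [+] WConst 2)) (WReg 19))) ?s3
        (\<lambda>s' t. (chg {14..19} {3} s s' \<and> cmem s' = cmem s \<and> decoded (bfs_step xss D v L y) s') \<and> t \<le> 60 * (K + 1) + 20)" (is "run _ _ _ _ ?L2")
      proof (rule run_Seq_mono[OF chk])
        fix s4 t4 assume 4: "?L1 s4 t4"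
        then have c4: "chg {14, 18} {} ?s3 s4" by simp
        have r4: "wreg s4 13 = j" "wreg s4 19 = x" "wreg s4 5 = B"
          using chg_wreg[OF c4, of 13] chg_wreg[OF c4, of 19] chg_wreg[OF c4, of 5] j regs by simp_all
        let ?s5 = "s4\<lparr>wmem := (wmem s4)(3 * B + (j + 2) := x)\<rparr>"
        have "chg {14..19} {3} s s4" using c3 c4 by (rule chg_trans) auto
        then have "chg {14..19} {3} s ?s5"
          using block_div(1)[OF KB(2), of 3] unfolding chg_def by auto
        moreover have "vec 3 (L @ [x]) ?s5"
          using chg_vec[OF c4, of 3 L] v3 L(3) KB j(2) by (auto simp: vec_def nth_append less_Suc_eq)
        then have "decoded (bfs_step xss D v L y) ?s5"
          unfolding step decoded_def using 4 by auto
        moreover have "wval w (addr 3 (WReg 13 [+] WConst 2)) s4 = 3 * B + (j + 2)"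
          using r4 KB bds by simp
        ultimately show "run w orc (WStore (addr 3 (WReg 13 [+] WConst 2)) (WReg 19)) s4
          (\<lambda>s' t. ?L2 s' (t4 + t))"
          using 4 r4 by simp
      qed
      moreover have "wval w (WReg 6 [<] WReg 19) (?s2\<lparr>wreg := (wreg ?s2)(19 := x)\<rparr>) = of_bool (v < x)"
        using v w_pos by simp
      ultimately have "run w orc extend_prog ?s2 (\<lambda>s' t. (chg {14..19} {3} s s' \<and> cmem s' = cmem s \<and>
        decoded (bfs_step xss D v L y) s') \<and> t \<le> 60 * (K + 1) + 50)"
        unfolding extend_prog_def run_Seq[of w orc "WAssign _ _"] run_simps valx
        by (auto elim!: run_mono)
      then show ?thesis unfolding run_If cond2 using kl by (auto elim!: run_mono)
    qed
    then have "run w orc (Seq (WAssign 15 (fetch 3 (WReg 16 [+] WConst 1)))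
        (If (WReg 17 [<] (WMem (WConst 5 [+] WReg 15) [-] WMem (WConst 4 [+] WReg 15)))
               extend_prog (WAssign 18 (WConst 0)))) ?s1 (\<lambda>s' t. (chg {14..19} {3} s s' \<and> cmem s' = cmem s \<and>
      decoded (bfs_step xss D v L y) s') \<and> t \<le> 140 * (K + 1) + 10)"
      unfolding run_Seq[of w orc "WAssign _ _"] run_simps val15 by (auto elim!: run_mono)
    then have "run w orc (Seq (WAssign 15 (fetch 3 (WReg 16 [+] WConst 1)))
        (If (WReg 17 [<] (WMem (WConst 5 [+] WReg 15) [-] WMem (WConst 4 [+] WReg 15)))
               extend_prog (WAssign 18 (WConst 0)))) ?s1 (\<lambda>s' t. (chg {14..19} {3} s s' \<and> cmem s' = cmem s \<and>
      decoded (bfs_step xss D v L y) s') \<and> 1 + wcost (WReg 16 [<] (WReg 13 [+] WConst 1)) + t \<le> 160 * (K + 1))"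
      by (rule run_mono) simp
    then show ?thesis unfolding run_If[of w orc "WReg 16 [<] _"] cond1 using True by (simp only: of_bool_eq if_True if_False simp_thms one_neq_zero)
  qed
  let ?sa = "s\<lparr>wreg := (wreg s)(19 := y - 1)\<rparr>" and ?sb = "s\<lparr>wreg := (wreg s)(19 := y - 1, 16 := i)\<rparr>"
  have A1: "run w orc (WAssign 19 (fetch 2 (WReg 13 [+] WConst 1) [-] WConst 1)) s (\<lambda>s' t. s' = ?sa \<and> t \<le> 15)"
    unfolding run_simps val19 by simp
  have A2: "run w orc (WAssign 16 (WBin Div (WReg 19) (WReg 2))) ?sa (\<lambda>s' t. s' = ?sb \<and> t \<le> 5)"
    using regs by (simp add: i_def)
  have A3: "run w orc (WAssign 17 (WBin Mod (WReg 19) (WReg 2))) ?sb (\<lambda>s' t. s' = ?s1 \<and> t \<le> 5)"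
    using regs by (simp add: k_def)
  have "run w orc (Seq (WAssign 19 (fetch 2 (WReg 13 [+] WConst 1) [-] WConst 1))
     (Seq (WAssign 16 (WBin Div (WReg 19) (WReg 2)))
     (Seq (WAssign 17 (WBin Mod (WReg 19) (WReg 2))) ?rest))) s (\<lambda>s' t. (chg {14..19} {3} s s' \<and> cmem s' = cmem s \<and>
    decoded (bfs_step xss D v L y) s') \<and> t \<le> 160 * (K + 1) + 30)"
  proof (rule run_Seq_mono[OF A1], elim conjE, hypsubst, rule run_Seq_mono[OF A2], elim conjE, hypsubst,
      rule run_Seq_mono[OF A3], elim conjE, hypsubst, rule run_mono[OF rest])
  qed linarith
  then have "run w orc (Seq (WAssign 19 (fetch 2 (WReg 13 [+] WConst 1) [-] WConst 1))
     (Seq (WAssign 16 (WBin Div (WReg 19) (WReg 2)))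
     (Seq (WAssign 17 (WBin Mod (WReg 19) (WReg 2))) ?rest))) s (\<lambda>s' t. ?Q s' (1 + wcost (WReg 18) + t))"
    by (rule run_mono) simp
  moreover have "wval w (WReg 18) s \<noteq> 0" using L(4) by simp
  ultimately show ?thesis
    unfolding decode_step_def run_If[of w orc "WReg 18"] by (simp only: if_True not_False_eq_True)
qed

lemma run_decode:
  assumes base: "base s" and ys: "stack 2 7 ys s" "ys \<in> set (incs (K * D) (K - 1) 0)"
    and v: "wreg s 6 = v" "v < n" and K: "K \<ge> 1"
  shows "run w orc decode_prog s (\<lambda>s' t. chg {13..19} {3} s s' \<and> cmem s' = cmem s \<and>
    decoded (decode xss D v ys) s' \<and> t \<le> 250 * (K + 1)\<^sup>2)"
proof -
  note bds = B_bounds B_ge w_pos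
  have len: "length ys \<le> K - 1" using ys(2) by (simp add: set_incs)
  have KB: "K < B" using bds by simp
  define I where "I j s' \<longleftrightarrow> chg {13..19} {3} s s' \<and> cmem s' = cmem s \<and> decoded (decode xss D v (take j ys)) s'" for j s'
  let ?s1 = "s\<lparr>wmem := (wmem s)(3 * B + 1 := v), wreg := (wreg s)(18 := 1)\<rparr>"
  have c1: "chg {13..19} {3} s ?s1" using block_div(1)[of 1 3] B_ge by (auto simp: chg_def)
  have I0: "I 0 ?s1" using c1 by (auto simp: I_def decoded_def vec_def)
  have "run w orc (for_prog 13 (WConst 0) (WReg 7) decode_step) ?s1 (\<lambda>s' t. I (length ys) s' \<and> wreg s' 13 = length ys \<and>
      t \<le> (length ys - 0) * (200 * (K + 1) + 7 + wcost (WReg 7)) + 4 + wcost (WConst 0) + wcost (WReg 7))"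
  proof (rule run_for)
    show "length ys < 2 ^ w" using len KB w_bound by linarith
    show "w > 0" by (rule w_pos)
    show "I 0 ?s1" by (rule I0)
    show "I j (s'\<lparr>wreg := (wreg s')(13 := u)\<rparr>)" if "I j s'" for j s' u
      using that by (auto simp: I_def chg_def decoded_def vec_def split: option.splits)
    show "wval w (WReg 7) s' = length ys" if "I j s'" for j s'
      using that ys(1) chg_wreg[of "{13..19}" "{3}" s s' 7] by (simp add: I_def stack_def)
    fix j s2 assume j: "j < length ys" and I: "I j s2" and r13: "wreg s2 13 = j"
    have c2: "chg {13..19} {3} s s2" using I by (simp add: I_def)
    have tk: "decode xss D v (take (Suc j) ys) = Option.bind (decode xss D v (take j ys)) (\<lambda>L. bfs_step xss D v L (ys ! j))"
      using j by (simp add: take_Suc_conv_app_nth decode_snoc)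
    show "run w orc decode_step s2 (\<lambda>s' t. I (Suc j) s' \<and> wreg s' 13 = j \<and> t \<le> 200 * (K + 1))"
    proof (cases "decode xss D v (take j ys)")
      case None
      then have "I (Suc j) s2" "wreg s2 18 = 0" using I unfolding I_def tk by (auto simp: decoded_def)
      then show ?thesis unfolding decode_step_def run_If[of w orc "WReg 18"] using r13 by simp
    next
      case (Some L)
      have L: "vec 3 L s2" "wreg s2 18 = 1" using I Some by (auto simp: I_def decoded_def)
      have lenL: "length L = Suc j" using decode_props[OF Some] j by simp
      have y: "1 \<le> ys ! j" "ys ! j < B" using incs_nth[OF ys(2) j] bds by simp_all
      have base2: "base s2" using base_chg[OF c2 _ _ _ base] by simp
      have "wmem s2 (2 * B + (j + 1)) = ys ! j"
      proof -
        have "wmem s2 (2 * B + (j + 1)) = wmem s (2 * B + (j + 1))"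
          using j len KB by (intro chg_wmem[OF c2]) auto
        then show ?thesis using ys(1) j by (simp add: stack_def vec_def)
      qed
      moreover have "wreg s2 6 = v" using chg_wreg[OF c2, of 6] v by simp
      moreover have "length L < K" using lenL j len K by simp
      ultimately have "run w orc decode_step s2 (\<lambda>s' t. chg {14..19} {3} s2 s' \<and> cmem s' = cmem s2 \<and>
          decoded (bfs_step xss D v L (ys ! j)) s' \<and> t \<le> 200 * (K + 1))" (is "run _ _ _ _ ?L1")
        using base2 L decode_less[OF Some v(2)] r13 lenL y by (intro run_decode_step) auto
      then show ?thesis
      proof (rule run_mono)
        fix s' t assume a: "?L1 s' t"
        have "chg {13..19} {3} s s'" using c2 a by (elim conjE, elim chg_trans) auto
        moreover have "wreg s' 13 = j" using a r13 chg_wreg[of "{14..19}" "{3}" s2 s' 13] by simp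
        ultimately show "I (Suc j) s' \<and> wreg s' 13 = j \<and> t \<le> 200 * (K + 1)"
          using a I Some by (simp add: I_def tk)
      qed
    qed
  qed simp_all
  moreover have "length ys * (200 * (K + 1) + 8) + 20 \<le> 250 * (K + 1)\<^sup>2"
  proof -
    have "length ys * (200 * (K + 1) + 8) \<le> K * (200 * (K + 1) + 8)" using len by (intro mult_right_mono) auto
    then show ?thesis by (simp add: power2_eq_square algebra_simps)
  qed
  ultimately show ?thesis
    unfolding decode_prog_def using base_regs[OF base] v bds
    by (auto simp: I_def elim!: run_mono)
qed

definition contrib :: "nat \<Rightarrow> nat \<Rightarrow> nat list \<Rightarrow> complex" where
  "contrib x v ys = (case decode xss D v ys of None \<Rightarrow> 0 | Some L \<Rightarrow> mob (power_sums x) (set L))"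

lemma run_cbody:
  assumes base: "base s" and ys: "stack 2 7 ys s" "ys \<in> set (incs (K * D) (K - 1) 0)"
    and v: "wreg s 6 = v" "v < n" and K: "K \<ge> 1"
  shows "run w orc (Seq decode_prog (If (WReg 18) sloop_prog Skip)) s (\<lambda>s' t. chg {9..19} {3..6} s s' \<and>
    (\<forall>x\<in>{1..m}. cmem s' (3 * B + x) = cmem s (3 * B + x) + contrib x v ys) \<and>
    t \<le> 3 ^ K * (1100 * (m * unit_time)))" (is "run _ _ _ _ ?Q")
proof (rule run_Seq_mono[OF run_decode[OF assms]])
  fix s1 t1 assume 1: "chg {13..19} {3} s s1 \<and> cmem s1 = cmem s \<and> decoded (decode xss D v ys) s1 \<and> t1 \<le> 250 * (K + 1)\<^sup>2"
  have c1: "chg {13..19} {3} s s1" using 1 by simp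
  have c1': "chg {9..19} {3..6} s s1" using c1 by (rule chg_mono) auto
  have mu: "(K + 1)\<^sup>2 \<le> m * unit_time" "1 \<le> m * unit_time"
    using mult_mono[of 1 m "(K + 1)\<^sup>2" unit_time] mult_mono[of 1 m 1 unit_time] pos unit_time_ge by simp_all
  have t0: "250 * (m * unit_time) + 3 ^ K * (800 * (m * unit_time)) + 10 \<le> 3 ^ K * (1100 * (m * unit_time))"
  proof -
    have "250 * (m * unit_time) + 10 \<le> 250 * (m * unit_time) + 50 * (m * unit_time)" using mu by linarith
    then have "1 * (250 * (m * unit_time) + 10) \<le> 3 ^ K * (250 * (m * unit_time) + 50 * (m * unit_time))"
      by (rule mult_mono[rotated]) auto
    then show ?thesis by (simp add: algebra_simps)
  qed
  show "run w orc (If (WReg 18) sloop_prog Skip) s1 (\<lambda>s' t. ?Q s' (t1 + t))"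
  proof (cases "decode xss D v ys")
    case None
    moreover have "t1 + 3 \<le> 3 ^ K * (1100 * (m * unit_time))" using 1 mu t0 by linarith
    ultimately show ?thesis using 1 c1' by (simp add: decoded_def contrib_def numeral_3_eq_3)
  next
    case (Some L)
    have L: "wreg s1 18 = 1" "vec 3 L s1" using 1 Some by (auto simp: decoded_def)
    have lenL: "length L = Suc (length ys)" "distinct L" using decode_props[OF Some] by auto
    have "length ys \<le> K - 1" using ys(2) by (simp add: set_incs)
    then have lenK: "length L \<le> K" using lenL K by simp
    have base1: "base s1" using base_chg[OF c1 _ _ _ base] by simp
    have r7: "wreg s1 7 + 1 = length L" using chg_wreg[OF c1, of 7] ys(1) lenL by (simp add: stack_def)
    have "run w orc sloop_prog s1 (\<lambda>s' t. chg {9..17} {4, 5, 6} s1 s' \<and>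
      (\<forall>x\<in>{1..m}. cmem s' (3 * B + x) = cmem s1 (3 * B + x) + mob (power_sums x) (set L)) \<and>
      t \<le> 3 ^ length L * (800 * (m * unit_time)))" (is "run _ _ _ _ ?L1")
      using base1 L(2) lenL(2) decode_less[OF Some v(2)] lenK r7 by (rule run_sloop)
    then have "run w orc sloop_prog s1 (\<lambda>s' t. (chg {9..19} {3..6} s s' \<and>
      (\<forall>x\<in>{1..m}. cmem s' (3 * B + x) = cmem s (3 * B + x) + contrib x v ys)) \<and>
      t \<le> 3 ^ K * (800 * (m * unit_time)))" (is "run _ _ _ _ ?L2")
    proof (rule run_mono)
      fix s' t assume a: "?L1 s' t"
      have "chg {9..19} {3..6} s s'" using c1' a by (elim conjE, elim chg_trans) auto
      moreover have "3 ^ length L * (800 * (m * unit_time)) \<le> 3 ^ K * (800 * (m * unit_time))"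
        using lenK by (intro mult_right_mono power_increasing) auto
      then have "t \<le> 3 ^ K * (800 * (m * unit_time))" using a le_trans by blast
      ultimately show "?L2 s' t"
        using a 1 Some by (simp add: contrib_def)
    qed
    then have "run w orc sloop_prog s1 (\<lambda>s' t. chg {9..19} {3..6} s s' \<and>
      (\<forall>x\<in>{1..m}. cmem s' (3 * B + x) = cmem s (3 * B + x) + contrib x v ys) \<and>
      t1 + (1 + wcost (WReg 18) + t) \<le> 3 ^ K * (1100 * (m * unit_time)))" (is "run _ _ _ _ ?L3")
    proof (rule run_mono)
      fix s' t assume a: "?L2 s' t"
      have "t1 + (1 + wcost (WReg 18) + t) \<le> 3 ^ K * (1100 * (m * unit_time))"
        using a 1 mu t0 by (simp only: wcost.simps) linarith
      then show "?L3 s' t"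
        using a by blast
    qed
    moreover have "wval w (WReg 18) s1 \<noteq> 0" using L(1) by simp
    ultimately show ?thesis unfolding run_If[of w orc "WReg 18"] by (simp only: if_True not_False_eq_True)
  qed
qed

end

section \<open>The adjacency matrix and the way back to coefficients\<close>

definition matrix_row :: com where
  "matrix_row = for_prog 13 (WMem (WConst 4 [+] WReg 6)) (WMem (WConst 5 [+] WReg 6))
     (WStore (addr 7 (WReg 6 [*] WReg 0 [+] WMem (WConst 5 [+] WReg 0 [+] WReg 13))) (WConst 1))"

definition matrix_prog :: com where
  "matrix_prog = for_prog 6 (WConst 0) (WReg 0) matrix_row"

text \<open>Newton's identities solved for the coefficient. Block 0 may still hold values of the
  last subset, but round \<open>i\<close> reads only cells below \<open>i\<close>, which have been
  overwritten already.\<close>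

definition final_prog :: com where
  "final_prog = for_prog 16 (WConst 1) (WReg 1 [+] WConst 1)
     (Seq (CAssign 0 (CMem (addr 3 (WReg 16))))
     (Seq (convolve_prog CAdd 3) (CStore (WReg 16) (CBin CDiv (CReg 0) (CWord (WReg 16))))))"

context ram_ctx
begin

abbreviation codes :: "nat list list" where
  "codes \<equiv> incs (K * D) (K - 1) 0"

lemma m_unit: "1 \<le> m * unit_time"
  using mult_mono[of 1 m 1 unit_time] pos unit_time_ge(5) by simp

lemma run_cloop:
  assumes base: "base s" and v: "wreg s 6 = v" "v < n" and K: "K \<ge> 1"
  shows "run w orc cloop_prog s (\<lambda>s' t. chg {7..19} {2..6} s s' \<and>
    (\<forall>x\<in>{1..m}. cmem s' (3 * B + x) = cmem s (3 * B + x) + (\<Sum>ys\<leftarrow>codes. contrib x v ys)) \<and>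
    t \<le> length codes * (3 ^ K * (1300 * (m * unit_time))))" (is "run _ _ _ _ ?Q")
proof -
  define P where "P j s' \<longleftrightarrow> chg {7..19} {2..6} s s' \<and>
      (\<forall>x\<in>{1..m}. cmem s' (3 * B + x) = cmem s (3 * B + x) + (\<Sum>i<j. contrib x v (codes ! i)))" for j s'
  have KB: "K < B" "K * D < B" using B_bounds by simp_all
  have "run w orc cloop_prog s (\<lambda>s' t. P (length codes) s' \<and>
      t \<le> (\<Sum>ys\<leftarrow>codes. 3 ^ K * (1100 * (m * unit_time)) + 110) + 20)" (is "run _ _ _ _ ?L1")
    unfolding cloop_prog_def
  proof (rule run_enum)
    show "P 0 s" by (simp add: P_def)
    show "wreg s 5 = B" using base_regs[OF base] by simp
    show "P j s''" if "P j s'" "chg {7, 8} {2} s' s''" "cmem s'' = cmem s'" for j s' s''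
    proof -
      have "chg {7..19} {2..6} s s''" using that(1,2) unfolding P_def by (elim conjE, elim chg_trans) auto
      then show ?thesis using that by (simp add: P_def)
    qed
    show "wreg s' 5 = B \<and> wval w (WReg 4 [-] WConst 1) s' = K - 1 \<and> wval w (WReg 4 [*] WReg 2) s' = K * D" if "P j s'" for j s'
    proof -
      have "wreg s' 5 = B" "wreg s' 4 = K" "wreg s' 2 = D"
        using that base_regs[OF base] chg_wreg[of _ _ s s'] by (auto simp: P_def)
      then show ?thesis using KB K w_pos by simp
    qed
    fix j ys s1 assume j: "j < length codes" "ys = codes ! j" and P: "P j s1" and st: "stack 2 7 ys s1" and d: "wreg s1 8 = 1"
    have ys: "ys \<in> set codes" using j by simp
    have c1: "chg {7..19} {2..6} s s1" using P by (simp add: P_def)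
    have base1: "base s1" using base_chg[OF c1 _ _ _ base] by simp
    have r6: "wreg s1 6 = v" using chg_wreg[OF c1, of 6] v by simp
    have "length ys \<le> K - 1" using ys by (simp add: set_incs)
    then have len: "length ys < B" using KB by linarith
    show "run w orc (Seq decode_prog (If (WReg 18) sloop_prog Skip)) s1
        (\<lambda>s' t. P (Suc j) s' \<and> stack 2 7 ys s' \<and> wreg s' 8 = 1 \<and> t \<le> 3 ^ K * (1100 * (m * unit_time)))"
    proof (rule run_mono[OF run_cbody[OF base1 st ys r6 v(2) K]])
      fix s' t assume a: "chg {9..19} {3..6} s1 s' \<and>
        (\<forall>x\<in>{1..m}. cmem s' (3 * B + x) = cmem s1 (3 * B + x) + contrib x v ys) \<and> t \<le> 3 ^ K * (1100 * (m * unit_time))"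
      have "chg {7..19} {2..6} s s'" using a c1 by (elim conjE, elim chg_trans) auto
      moreover have "stack 2 7 ys s'" using chg_stack[of "{9..19}" "{3..6}" s1 s' 2 7 ys] a st len by simp
      moreover have "wreg s' 8 = 1" using a d chg_wreg[of "{9..19}" "{3..6}" s1 s' 8] by simp
      ultimately show "P (Suc j) s' \<and> stack 2 7 ys s' \<and> wreg s' 8 = 1 \<and> t \<le> 3 ^ K * (1100 * (m * unit_time))"
        using a P j(2) by (simp add: P_def)
    qed
  qed (use KB in auto)
  then show ?thesis
  proof (rule run_mono)
    fix s' t assume a: "?L1 s' t"
    have "(\<Sum>i<length codes. contrib x v (codes ! i)) = (\<Sum>ys\<leftarrow>codes. contrib x v ys)" for x
      by (simp add: sum_list_sum_nth atLeast0LessThan)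
    moreover have "t \<le> length codes * (3 ^ K * (1300 * (m * unit_time)))"
    proof -
      have "1 \<le> length codes" using incs_not_Nil[of "K * D" "K - 1" 0] by (simp add: Suc_le_eq)
      have "130 \<le> 200 * (m * unit_time)" using m_unit by linarith
      then have "1 * 130 \<le> 3 ^ K * (200 * (m * unit_time))" by (intro mult_mono) auto
      then have "length codes * (3 ^ K * (1100 * (m * unit_time)) + 130) \<le> length codes * (3 ^ K * (1300 * (m * unit_time)))"
        by (intro mult_left_mono) (simp_all add: algebra_simps)
      moreover have "t \<le> length codes * (3 ^ K * (1100 * (m * unit_time)) + 110) + 20 * length codes"
      proof -
        have "t \<le> length codes * (3 ^ K * (1100 * (m * unit_time)) + 110) + 20"
          using a by (simp only: sum_list_triv of_nat_id)
        moreover have "20 * 1 \<le> 20 * length codes" using \<open>1 \<le> length codes\<close> by (rule mult_left_mono) simp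
        ultimately show ?thesis by linarith
      qed
      then have "t \<le> length codes * (3 ^ K * (1100 * (m * unit_time)) + 130)" by (simp add: distrib_left)
      ultimately show ?thesis by (rule order.trans[rotated])
    qed
    ultimately show "?Q s' t"
      using a by (simp add: P_def)
  qed
qed

lemma run_vloop:
  assumes base: "base s" and K: "K \<ge> 1"
  shows "run w orc vloop_prog s (\<lambda>s' t. chg {6..19} {2..6} s s' \<and>
    (\<forall>x\<in>{1..m}. cmem s' (3 * B + x) = cmem s (3 * B + x) + (\<Sum>v<n. \<Sum>ys\<leftarrow>codes. contrib x v ys)) \<and>
    t \<le> n * (length codes * (3 ^ K * (1400 * (m * unit_time)))))" (is "run _ _ _ _ ?Q")
proof -
  define I where "I j s' \<longleftrightarrow> chg {6..19} {2..6} s s' \<and>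
      (\<forall>x\<in>{1..m}. cmem s' (3 * B + x) = cmem s (3 * B + x) + (\<Sum>v<j. \<Sum>ys\<leftarrow>codes. contrib x v ys))" for j s'
  let ?T = "length codes * (3 ^ K * (1300 * (m * unit_time)))"
  have "run w orc vloop_prog s (\<lambda>s' t. I n s' \<and> wreg s' 6 = n \<and>
      t \<le> (n - 0) * (?T + 7 + wcost (WReg 0)) + 4 + wcost (WConst 0) + wcost (WReg 0))" (is "run _ _ _ _ ?L1")
    unfolding vloop_prog_def
  proof (rule run_for)
    show "n < 2 ^ w" using B_bounds(1) w_bound by linarith
    show "w > 0" by (rule w_pos)
    show "I 0 s" by (simp add: I_def)
    show "I j (s'\<lparr>wreg := (wreg s')(6 := u)\<rparr>)" if "I j s'" for j s' u
      using that by (auto simp: I_def chg_def)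
    show "wval w (WReg 0) s' = n" if "I j s'" for j s'
      using that base_regs[OF base] chg_wreg[of "{6..19}" "{2..6}" s s' 0] by (simp add: I_def)
    fix v s1 assume v: "v < n" and I: "I v s1" and r6: "wreg s1 6 = v"
    have c1: "chg {6..19} {2..6} s s1" using I by (simp add: I_def)
    have base1: "base s1" using base_chg[OF c1 _ _ _ base] by simp
    show "run w orc cloop_prog s1 (\<lambda>s' t. I (Suc v) s' \<and> wreg s' 6 = v \<and> t \<le> ?T)"
    proof (rule run_mono[OF run_cloop[OF base1 r6 v K]])
      fix s' t assume a: "chg {7..19} {2..6} s1 s' \<and>
        (\<forall>x\<in>{1..m}. cmem s' (3 * B + x) = cmem s1 (3 * B + x) + (\<Sum>ys\<leftarrow>codes. contrib x v ys)) \<and> t \<le> ?T"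
      have "chg {6..19} {2..6} s s'" using a c1 by (elim conjE, elim chg_trans) auto
      moreover have "wreg s' 6 = v" using a r6 chg_wreg[of "{7..19}" "{2..6}" s1 s' 6] by simp
      ultimately show "I (Suc v) s' \<and> wreg s' 6 = v \<and> t \<le> ?T" using a I by (simp add: I_def)
    qed
  qed simp_all
  then show ?thesis
  proof (rule run_mono)
    fix s' t assume a: "?L1 s' t"
    have "1 \<le> length codes" using incs_not_Nil[of "K * D" "K - 1" 0] by (simp add: Suc_le_eq)
    then have "1 * (1 * (100 * 1)) \<le> length codes * (3 ^ K * (100 * (m * unit_time)))"
      by (intro mult_mono m_unit) auto
    then have "n * (?T + 100) \<le> n * (length codes * (3 ^ K * (1400 * (m * unit_time))))"
      by (intro mult_left_mono) (simp_all add: algebra_simps)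
    moreover have "t \<le> n * (?T + 100)"
    proof -
      have "t \<le> n * ?T + 8 * n + 6" using a by (simp add: algebra_simps)
      also have "\<dots> \<le> n * ?T + 100 * n" using pos by simp
      finally show ?thesis by (simp add: algebra_simps)
    qed
    ultimately have "t \<le> n * (length codes * (3 ^ K * (1400 * (m * unit_time))))" by (rule order.trans[rotated])
    then show "?Q s' t"
      using a unfolding I_def by blast
  qed
qed

text \<open>\<open>N x\<close> is the part of the neighbourhood of \<open>x\<close> entered so far,
  which makes this usable as a loop invariant.\<close>

definition matrix :: "(nat \<Rightarrow> nat set) \<Rightarrow> state \<Rightarrow> bool" where
  "matrix N s \<longleftrightarrow> (\<forall>x<n. \<forall>y<n. wmem s (7 * B + (x * n + y)) = of_bool (y \<in> N x))"

lemma params_regs: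
  assumes "params s"
  shows "wreg s 0 = n" "wreg s (Suc 0) = m" "wreg s 2 = D" "wreg s 3 = A" "wreg s 4 = K" "wreg s 5 = B"
  using assms by (simp_all add: params_def)

lemma pair_eq: "y < n \<Longrightarrow> y' < n \<Longrightarrow> x * n + y = x' * n + y' \<longleftrightarrow> x = x' \<and> y = y'"
proof
  assume a: "y < n" "y' < n" "x * n + y = x' * n + y'"
  have "x = (x * n + y) div n" "y = (x * n + y) mod n" using a(1) by auto
  moreover have "x' = (x' * n + y') div n" "y' = (x' * n + y') mod n" using a(2) by auto
  ultimately show "x = x' \<and> y = y'" using a(3) by metis
qed simp

lemma run_matrix_row:
  assumes par: "params s" and v: "wreg s 6 = v" "v < n" and N: "matrix N s" "N v = {}"
  shows "run w orc matrix_row s (\<lambda>s' t. chg {13} {7} s s' \<and> cmem s' = cmem s \<and>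
    matrix (N(v := set (xss ! v))) s' \<and> t \<le> 60 * D)" (is "run _ _ _ _ ?Q")
proof -
  note bds = B_bounds B_ge w_pos
  let ?d = "length (xss ! v)"
  have dD: "?d \<le> D" using length_nth_le[OF v(2)] .
  have offB: "off v + ?d < B"
  proof -
    have "off (Suc v) \<le> Suc v * D" using v(2) by (intro off_le) simp
    also have "\<dots> \<le> n * D" using v(2) by (intro mult_right_mono) auto
    finally show ?thesis using bds off_Suc[OF v(2)] by linarith
  qed
  define I where "I j s' \<longleftrightarrow> chg {13} {7} s s' \<and> cmem s' = cmem s \<and>
      matrix (N(v := set (take (j - off v) (xss ! v)))) s'" for j s'
  have par': "params s'" if "I j s'" for j s'
    using that params_chg[of "{13}" "{7}" s s'] par by (simp add: I_def)
  have offs: "wmem s' (4 + v) = off v" "wmem s' (5 + v) = off v + ?d" if "params s'" for s'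
  proof -
    have o: "wmem s' (4 + u) = off u" if "u \<le> n" for u using \<open>params s'\<close> that by (simp add: params_def)
    show "wmem s' (4 + v) = off v" using o[of v] v by simp
    have "4 + Suc v = 5 + v" by simp
    then show "wmem s' (5 + v) = off v + ?d" using o[of "Suc v"] v off_Suc[OF v(2)] by simp
  qed
  have vB: "5 + v < 8 * B" "4 + v < 8 * B" using v(2) bds by linarith+
  have "run w orc matrix_row s (\<lambda>s' t. I (off v + ?d) s' \<and> wreg s' 13 = off v + ?d \<and>
      t \<le> (off v + ?d - off v) * (30 + 7 + wcost (WMem (WConst 5 [+] WReg 6))) + 4 +
        wcost (WMem (WConst 4 [+] WReg 6)) + wcost (WMem (WConst 5 [+] WReg 6)))" (is "run _ _ _ _ ?L1")
    unfolding matrix_row_def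
  proof (rule run_for)
    show "off v + ?d < 2 ^ w" using offB w_bound by linarith
    show "w > 0" by (rule w_pos)
    show "wval w (WMem (WConst 4 [+] WReg 6)) s = off v" using offs(1)[OF par] v vB bds by simp
    show "I (off v) s" using N by (simp add: I_def fun_upd_idem)
    show "I j (s'\<lparr>wreg := (wreg s')(13 := u)\<rparr>)" if "I j s'" for j s' u
      using that by (auto simp: I_def chg_def matrix_def)
    show "wval w (WMem (WConst 5 [+] WReg 6)) s' = off v + ?d" if "I j s'" for j s'
    proof -
      have "wreg s' 6 = v" using that v chg_wreg[of "{13}" "{7}" s s' 6] by (simp add: I_def)
      then show ?thesis using offs(2)[OF par'[OF that]] vB bds by simp
    qed
    fix j s1 assume j: "off v \<le> j" "j < off v + ?d" and I: "I j s1" and r13: "wreg s1 13 = j"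
    define i where "i = j - off v"
    have i: "i < ?d" "j = off v + i" using j by (auto simp: i_def)
    define x where "x = xss ! v ! i"
    have xn: "x < n" unfolding x_def using v(2) i(1) by (rule nth_nth_less)
    have c1: "chg {13} {7} s s1" using I by (simp add: I_def)
    have r6: "wreg s1 6 = v" using chg_wreg[OF c1, of 6] v by simp
    note regs = params_regs[OF par'[OF I]]
    have "wmem s1 (5 + n + off v + i) = x" using par'[OF I] v(2) i(1) by (simp add: params_def x_def)
    moreover have "5 + n + off v + i < B" using v(2) i(1) by (rule off_add_less)
    moreover have "v * n + x < B" "v * n < B" using pair_less[OF v(2) xn] by simp_all
    ultimately have ad: "wval w (addr 7 (WReg 6 [*] WReg 0 [+] WMem (WConst 5 [+] WReg 0 [+] WReg 13))) s1 = 7 * B + (v * n + x)"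
      using regs r6 r13 i(2) bds by (simp add: add.assoc)
    have "matrix (N(v := set (take (Suc j - off v) (xss ! v)))) (s1\<lparr>wmem := (wmem s1)(7 * B + (v * n + x) := 1)\<rparr>)"
    proof -
      have "take (Suc j - off v) (xss ! v) = take (j - off v) (xss ! v) @ [x]"
        using i by (simp add: take_Suc_conv_app_nth x_def Suc_diff_le)
      then show ?thesis using I pair_eq xn unfolding I_def matrix_def by (auto simp: of_bool_def)
    qed
    moreover have "chg {13} {7} s (s1\<lparr>wmem := (wmem s1)(7 * B + (v * n + x) := 1)\<rparr>)"
      using c1 block_div(1)[OF \<open>v * n + x < B\<close>, of 7] by (auto simp: chg_def)
    ultimately have fin: "I (Suc j) (s1\<lparr>wmem := (wmem s1)(7 * B + (v * n + x) := 1)\<rparr>)" using I by (simp add: I_def)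
    have one: "wval w (WConst 1) s1 = 1" using bds by simp
    show "run w orc (WStore (addr 7 (WReg 6 [*] WReg 0 [+] WMem (WConst 5 [+] WReg 0 [+] WReg 13))) (WConst 1)) s1
      (\<lambda>s' t. I (Suc j) s' \<and> wreg s' 13 = j \<and> t \<le> 30)"
      unfolding run_simps ad one using fin r13 by simp
  qed simp
  then show ?thesis
  proof (rule run_mono)
    fix s' t assume a: "?L1 s' t"
    then have "t \<le> 41 * ?d + 12" by simp
    then have "t \<le> 60 * D" using dD pos by linarith
    then show "?Q s' t"
      using a by (simp add: I_def)
  qed
qed

lemma run_matrix:
  assumes par: "params s" and zero: "\<And>a. a < B \<Longrightarrow> wmem s (7 * B + a) = 0"
  shows "run w orc matrix_prog s (\<lambda>s' t. base s' \<and> cmem s' = cmem s \<and> t \<le> 80 * (n * D))"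
proof -
  define I where "I v s' \<longleftrightarrow> chg {6, 13} {7} s s' \<and> cmem s' = cmem s \<and>
      matrix (\<lambda>x. if x < v then set (xss ! x) else {}) s'" for v s'
  have par': "params s'" if "I j s'" for j s'
    using that params_chg[of "{6, 13}" "{7}" s s'] par by (simp add: I_def)
  have "run w orc matrix_prog s (\<lambda>s' t. I n s' \<and> wreg s' 6 = n \<and>
      t \<le> (n - 0) * (60 * D + 7 + wcost (WReg 0)) + 4 + wcost (WConst 0) + wcost (WReg 0))" (is "run _ _ _ _ ?L1")
    unfolding matrix_prog_def
  proof (rule run_for)
    show "n < 2 ^ w" using B_bounds(1) w_bound by linarith
    show "w > 0" by (rule w_pos)
    show "I 0 s" using zero pair_less by (simp add: I_def matrix_def)
    show "I j (s'\<lparr>wreg := (wreg s')(6 := u)\<rparr>)" if "I j s'" for j s' u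
      using that by (auto simp: I_def chg_def matrix_def)
    show "wval w (WReg 0) s' = n" if "I j s'" for j s'
      using params_regs[OF par'[OF that]] by simp
    fix v s1 assume v: "v < n" and I: "I v s1" and r6: "wreg s1 6 = v"
    have upd: "(\<lambda>x. if x < v then set (xss ! x) else {})(v := set (xss ! v)) = (\<lambda>x. if x < Suc v then set (xss ! x) else {})"
      by (auto simp: fun_eq_iff less_Suc_eq)
    have "matrix (\<lambda>x. if x < v then set (xss ! x) else {}) s1" using I by (simp add: I_def)
    from run_matrix_row[OF par'[OF I] r6 v this]
    show "run w orc matrix_row s1 (\<lambda>s' t. I (Suc v) s' \<and> wreg s' 6 = v \<and> t \<le> 60 * D)"
    proof (rule run_mono)
      fix s' t assume a: "chg {13} {7} s1 s' \<and> cmem s' = cmem s1 \<and>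
        matrix ((\<lambda>x. if x < v then set (xss ! x) else {})(v := set (xss ! v))) s' \<and> t \<le> 60 * D"
      have "chg {6, 13} {7} s s'" using a I unfolding I_def by (elim conjE, elim chg_trans) auto
      moreover have "wreg s' 6 = v" using a r6 chg_wreg[of "{13}" "{7}" s1 s' 6] by simp
      ultimately show "I (Suc v) s' \<and> wreg s' 6 = v \<and> t \<le> 60 * D"
        using a I unfolding upd I_def by simp
    qed simp
  qed simp_all
  then show ?thesis
  proof (rule run_mono)
    fix s' t assume a: "?L1 s' t"
    have "n * 1 \<le> n * D" "1 * 1 \<le> n * D" using pos by (intro mult_mono; simp)+
    moreover have "t \<le> 60 * (n * D) + 8 * n + 6" using a by (simp add: algebra_simps)
    ultimately have "t \<le> 80 * (n * D)" by linarith
    moreover have "base s'"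
    proof -
      have "matrix (\<lambda>x. if x < n then set (xss ! x) else {}) s'" using a by (simp add: I_def)
      then show ?thesis
        using par'[of n s'] a set_nth unfolding base_def matrix_def by (auto simp: insert_commute)
    qed
    ultimately show "base s' \<and> cmem s' = cmem s \<and> t \<le> 80 * (n * D)" using a by (simp add: I_def)
  qed
qed

lemma run_final:
  assumes reg: "wreg s 1 = m" "wreg s 5 = B" and E: "fps_nth E 0 = 1"
    and tot: "\<And>x. x \<in> {1..m} \<Longrightarrow> cmem s (3 * B + x) = fps_nth (psum E) x"
  shows "run w orc final_prog s (\<lambda>s' t. (\<forall>x\<in>{1..m}. cmem s' x = fps_nth E x) \<and> t \<le> 110 * (m * m))" (is "run _ _ _ _ ?Q")
proof -
  note bds = B_bounds B_ge w_pos
  have mB: "m < B" using bds by simp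
  define I where "I j s' \<longleftrightarrow> chg {16, 17} {} s s' \<and> (\<forall>x. 1 \<le> x \<and> x < j \<longrightarrow> cmem s' x = fps_nth E x) \<and>
      (\<forall>x\<in>{1..m}. cmem s' (3 * B + x) = fps_nth (psum E) x)" for j s'
  have "run w orc final_prog s (\<lambda>s' t. I (m + 1) s' \<and> wreg s' 16 = m + 1 \<and>
      t \<le> (m + 1 - 1) * ((28 * m + 60) + 7 + wcost (WReg 1 [+] WConst 1)) + 4 + wcost (WConst 1) + wcost (WReg 1 [+] WConst 1))" (is "run _ _ _ _ ?L1")
    unfolding final_prog_def
  proof (rule run_for)
    show "m + 1 < 2 ^ w" using bds w_bound by linarith
    show "w > 0" by (rule w_pos)
    show "wval w (WConst 1) s = 1" using bds by simp
    show "I 1 s" using tot by (auto simp: I_def)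
    show "I j (s'\<lparr>wreg := (wreg s')(16 := v)\<rparr>)" if "I j s'" for j s' v
      using that by (auto simp: I_def chg_def)
    show "wval w (WReg 1 [+] WConst 1) s' = m + 1" if "I j s'" for j s'
    proof -
      have "wreg s' 1 = m" using that reg chg_wreg[of "{16, 17}" "{}" s s' 1] by (simp add: I_def)
      then show ?thesis using bds by simp
    qed
    fix i s1 assume i: "1 \<le> i" "i < m + 1" and I: "I i s1" and r16: "wreg s1 16 = i"
    have c1: "chg {16, 17} {} s s1" using I by (simp add: I_def)
    have r5: "wreg s1 5 = B" using chg_wreg[OF c1] reg by auto
    have iB: "i < B" using i mB by linarith
    let ?s2 = "s1\<lparr>creg := (creg s1)(0 := fps_nth (psum E) i)\<rparr>"
    define J where "J s' \<longleftrightarrow> chg {17} {} ?s2 s' \<and> cmem s' = cmem s1 \<and> creg s' 0 = of_nat i * fps_nth E i" for s'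
    have inner: "run w orc (convolve_prog CAdd 3) ?s2 (\<lambda>s' t. J s' \<and> t \<le> 28 * i)"
    proof -
      have "cmem s1 (3 * B + l) * cmem s1 (i - l) = fps_nth (psum E) l * fps_nth E (i - l)" if "l \<in> {1..<i}" for l
      proof -
        have "l \<in> {1..m}" "1 \<le> i - l \<and> i - l < i" using i that by auto
        then show ?thesis using I by (simp add: I_def)
      qed
      then have "(\<Sum>l\<in>{1..<i}. cmem s1 (3 * B + l) * cmem s1 (i - l)) = (\<Sum>l\<in>{1..<i}. fps_nth (psum E) l * fps_nth E (i - l))"
        by (rule sum.cong[OF refl])
      then show ?thesis
        using r5 r16 i iB psum_rec[OF E, of i]
        by (intro run_mono[OF run_convolve[of ?s2 i 3 CAdd]]) (simp_all add: J_def)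
    qed
    let ?tail = "CStore (WReg 16) (CBin CDiv (CReg 0) (CWord (WReg 16)))"
    have tail: "run w orc ?tail s3 (\<lambda>s' t. (I (Suc i) s' \<and> wreg s' 16 = i) \<and> t \<le> 45)" if J: "J s3" for s3
    proof -
      have c3: "chg {17} {} ?s2 s3" using J by (simp add: J_def)
      have r3: "wreg s3 16 = i" using chg_wreg[OF c3, of 16] r16 by simp
      have "creg s3 0 / of_nat i = fps_nth E i" using J i by (simp add: J_def)
      moreover have "chg {16, 17} {} s s3" using c1 c3 by (auto simp: chg_def)
      ultimately show ?thesis using J I r3 iB mB by (auto simp: I_def J_def chg_def less_Suc_eq)
    qed
    have st2: "run w orc (CAssign 0 (CMem (addr 3 (WReg 16)))) s1 (\<lambda>s' t. s' = ?s2 \<and> t \<le> 10)"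
      using I i r16 r5 iB by (simp add: I_def)
    show "run w orc (Seq (CAssign 0 (CMem (addr 3 (WReg 16)))) (Seq (convolve_prog CAdd 3) ?tail)) s1
      (\<lambda>s' t. I (Suc i) s' \<and> wreg s' 16 = i \<and> t \<le> 28 * m + 60)"
    proof (rule run_Seq_mono[OF st2], elim conjE, hypsubst, rule run_Seq_mono[OF inner], elim conjE)
      fix t1 t3 :: nat and s3 :: state
      assume t: "t1 \<le> 10" "J s3" "t3 \<le> 28 * i"
      then have "t1 + (t3 + 45) \<le> 28 * m + 60" using i by simp
      then show "run w orc ?tail s3 (\<lambda>s2 t2. I (Suc i) s2 \<and> wreg s2 16 = i \<and> t1 + (t3 + t2) \<le> 28 * m + 60)"
        by (intro run_mono[OF tail[OF t(2)]]) auto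
    qed
  qed simp
  then show ?thesis
  proof (rule run_mono)
    fix s' t assume a: "?L1 s' t"
    have "m * 1 \<le> m * m" "1 * 1 \<le> m * m" using pos by (intro mult_mono; simp)+
    moreover have "t \<le> 28 * (m * m) + 70 * m + 8" using a by (simp add: algebra_simps)
    ultimately have "t \<le> 110 * (m * m)" by linarith
    then show "?Q s' t" using a by (simp add: I_def)
  qed
qed

end

section \<open>The whole program and its correctness\<close>

definition init_prog :: com where
  "init_prog = Seq (WAssign 0 (WMem (WConst 0))) (Seq (WAssign 1 (WMem (WConst 1))) (Seq (WAssign 2 (WMem (WConst 2)))
     (Seq (WAssign 3 (WMem (WConst 3))) (Seq (WAssign 4 (WReg 3 [*] WReg 1))
       (WAssign 5 ((WReg 0 [+] WReg 1 [+] WReg 2 [+] WReg 4 [+] WConst 4) [*]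
                   (WReg 0 [+] WReg 1 [+] WReg 2 [+] WReg 4 [+] WConst 4)))))))"

text \<open>For \<open>K = 0\<close> all power sums are 0, the initial content of block 3, and the
  target running time contains no factor \<Delta>, so even building the matrix would be too slow.
  The test also keeps \<open>K - 1\<close> from wrapping around.\<close>

definition main_prog :: com where
  "main_prog = Seq init_prog (Seq (If (WReg 4) (Seq matrix_prog vloop_prog) Skip) final_prog)"

lemma nth_concat:
  assumes "v < length xss" "j < length (xss ! v)"
  shows "concat xss ! (sum_list (map length (take v xss)) + j) = xss ! v ! j"
proof -
  have "concat xss = concat (take v xss) @ xss ! v @ concat (drop (Suc v) xss)"
    using id_take_nth_drop[OF assms(1)] by (metis concat.simps(2) concat_append)
  then show ?thesis using assms(2) by (simp add: length_concat nth_append)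
qed

context ram_ctx
begin

definition input :: "nat list" where
  "input = [n, m, D, A] @ encode_lists xss"

lemma length_input: "length input = 5 + n + off n"
  using length_xss by (simp add: input_def encode_lists_def off_def length_concat)

lemma input_off: "v \<le> n \<Longrightarrow> input ! (4 + v) = off v"
  by (simp add: input_def encode_lists_def off_def length_xss nth_append del: upt_Suc)

lemma input_list: "v < n \<Longrightarrow> j < length (xss ! v) \<Longrightarrow> input ! (5 + n + off v + j) = xss ! v ! j"
  using nth_concat[of v xss j]
  by (simp add: input_def encode_lists_def off_def length_xss nth_append nth_Cons' del: upt_Suc)

lemma off_n_less: "5 + n + off n < B"
  using off_le[of n] B_bounds(5) by simp

lemma run_init:
  "run w orc init_prog (init_state w input) (\<lambda>s t. params s \<and> (\<forall>a<B. wmem s (7 * B + a) = 0) \<and>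
     cmem s = (\<lambda>_. 0) \<and> t \<le> 60)"
proof -
  note bds = B_bounds B_ge w_pos
  let ?ini = "init_state w input"
  let ?fin = "?ini\<lparr>wreg := (wreg ?ini)(0 := n, 1 := m, 2 := D, 3 := A, 4 := K, 5 := B)\<rparr>"
  have mem: "wmem ?ini a = input ! a" if "a < length input" "input ! a < 8 * B" for a
    using that by (simp add: init_state_def)
  have len: "4 \<le> length input" by (simp add: length_input)
  have "wmem ?ini 0 = n" "wmem ?ini 1 = m" "wmem ?ini 2 = D" "wmem ?ini 3 = A"
    using mem[of 0] mem[of 1] mem[of 2] mem[of 3] len bds by (simp_all add: input_def)
  note m0 = this this(2)[unfolded One_nat_def]
  have BB: "B = (n + m + D + K + 4) * (n + m + D + K + 4)" by (simp add: B_eq power2_eq_square)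
  have KA: "A * m = K" by (simp add: K_eq)
  have run: "run w orc init_prog ?ini (\<lambda>s t. s = ?fin \<and> t \<le> 60)"
  proof -
    let ?sum = "WReg 0 [+] WReg 1 [+] WReg 2 [+] WReg 4 [+] WConst 4"
    have "wval w ?sum (?ini\<lparr>wreg := (wreg ?ini)(0 := n, 1 := m, 2 := D, 3 := A, 4 := K)\<rparr>) = n + m + D + K + 4"
      using bds by simp
    note sum = this
    have sq: "wval w ((WReg 0 [+] WReg 1 [+] WReg 2 [+] WReg 4 [+] WConst 4) [*]
        (WReg 0 [+] WReg 1 [+] WReg 2 [+] WReg 4 [+] WConst 4)) (?ini\<lparr>wreg := (wreg ?ini)(0 := n, 1 := m, 2 := D, 3 := A, 4 := K)\<rparr>) = B"
      unfolding wval.simps(4)[of _ Mul] sum wop_val.simps BB[symmetric] using bds by simp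
    have k: "wval w (WReg 3 [*] WReg 1) (?ini\<lparr>wreg := (wreg ?ini)(0 := n, 1 := m, 2 := D, 3 := A)\<rparr>) = K"
      using bds KA by simp
    have A0: "run w orc (WAssign 0 (WMem (WConst 0))) ?ini (\<lambda>s t. s = ?ini\<lparr>wreg := (wreg ?ini)(0 := n)\<rparr> \<and> t \<le> 3)"
      using m0 by simp
    have A1: "run w orc (WAssign 1 (WMem (WConst 1))) (?ini\<lparr>wreg := (wreg ?ini)(0 := n)\<rparr>)
        (\<lambda>s t. s = ?ini\<lparr>wreg := (wreg ?ini)(0 := n, 1 := m)\<rparr> \<and> t \<le> 3)"
      using m0 bds by simp
    have A2: "run w orc (WAssign 2 (WMem (WConst 2))) (?ini\<lparr>wreg := (wreg ?ini)(0 := n, 1 := m)\<rparr>)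
        (\<lambda>s t. s = ?ini\<lparr>wreg := (wreg ?ini)(0 := n, 1 := m, 2 := D)\<rparr> \<and> t \<le> 3)"
      using m0 bds by simp
    have A3: "run w orc (WAssign 3 (WMem (WConst 3))) (?ini\<lparr>wreg := (wreg ?ini)(0 := n, 1 := m, 2 := D)\<rparr>)
        (\<lambda>s t. s = ?ini\<lparr>wreg := (wreg ?ini)(0 := n, 1 := m, 2 := D, 3 := A)\<rparr> \<and> t \<le> 3)"
      using m0 bds by simp
    have A4: "run w orc (WAssign 4 (WReg 3 [*] WReg 1)) (?ini\<lparr>wreg := (wreg ?ini)(0 := n, 1 := m, 2 := D, 3 := A)\<rparr>)
        (\<lambda>s t. s = ?ini\<lparr>wreg := (wreg ?ini)(0 := n, 1 := m, 2 := D, 3 := A, 4 := K)\<rparr> \<and> t \<le> 4)"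
      unfolding run_simps k by simp
    have A5: "run w orc (WAssign 5 ((WReg 0 [+] WReg 1 [+] WReg 2 [+] WReg 4 [+] WConst 4) [*]
        (WReg 0 [+] WReg 1 [+] WReg 2 [+] WReg 4 [+] WConst 4))) (?ini\<lparr>wreg := (wreg ?ini)(0 := n, 1 := m, 2 := D, 3 := A, 4 := K)\<rparr>)
        (\<lambda>s t. s = ?fin \<and> t \<le> 30)"
      unfolding run_simps sq by simp
    show ?thesis
      unfolding init_prog_def
    proof (rule run_Seq_mono[OF A0], elim conjE, hypsubst, rule run_Seq_mono[OF A1], elim conjE, hypsubst,
        rule run_Seq_mono[OF A2], elim conjE, hypsubst, rule run_Seq_mono[OF A3], elim conjE, hypsubst,
        rule run_Seq_mono[OF A4], elim conjE, hypsubst, rule run_mono[OF A5])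
    qed auto
  qed
  show ?thesis
  proof (rule run_mono[OF run])
    fix s and t :: nat assume st: "s = ?fin \<and> t \<le> 60"
    have 1: "wmem ?ini (4 + v) = off v" if "v \<le> n" for v
    proof -
      have "off v \<le> v * D" "v * D \<le> n * D" using off_le[OF that] that by (auto intro: mult_right_mono)
      then have "off v < 8 * B" using bds by linarith
      then show ?thesis using mem[of "4 + v"] input_off[OF that] that length_input by simp
    qed
    have 2: "wmem ?ini (5 + n + off v + j) = xss ! v ! j" if "v < n" "j < length (xss ! v)" for v j
    proof -
      have "off (Suc v) \<le> off n"
      proof -
        have "take n xss = take (Suc v) xss @ take (n - Suc v) (drop (Suc v) xss)"
          using that(1) take_add[of "Suc v" "n - Suc v" xss] by simp
        then show ?thesis by (simp add: off_def)
      qed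
      then have "5 + n + off v + j < length input" using that off_Suc[OF that(1)] length_input by simp
      moreover have "xss ! v ! j < 8 * B" using nth_nth_less[OF that] bds by linarith
      ultimately show ?thesis using mem[of "5 + n + off v + j"] input_list[OF that] by simp
    qed
    \<comment> \<open>The input ends inside block 0, so block 7 is still zero, as the matrix
      construction requires.\<close>
    have 3: "wmem ?ini (7 * B + a) = 0" for a
    proof -
      have "\<not> 7 * B + a < length input" using off_n_less length_input by simp
      then show ?thesis by (simp add: init_state_def)
    qed
    have wm: "wmem ?fin = wmem ?ini" by simp
    have "wreg ?fin 0 = n" "wreg ?fin 1 = m" "wreg ?fin 2 = D" "wreg ?fin 3 = A" "wreg ?fin 4 = K" "wreg ?fin 5 = B"
      by simp_all
    then have p: "params ?fin" unfolding params_def wm using 1 2 by blast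
    have z: "\<forall>a<B. wmem ?fin (7 * B + a) = 0" unfolding wm using 3 by blast
    have c: "cmem ?fin = (\<lambda>_. 0)" by (simp add: init_state_def)
    show "params s \<and> (\<forall>a<B. wmem s (7 * B + a) = 0) \<and> cmem s = (\<lambda>_. 0) \<and> t \<le> 60"
      unfolding conjunct1[OF st] by (rule conjI[OF p conjI[OF z conjI[OF c conjunct2[OF st]]]])
  qed
qed

definition time_bound :: nat where
  "time_bound = 90 * (m * m) + 110 * (m * m) +
     (if K = 0 then 0 else 80 * (n * D) + n * (length codes * (3 ^ K * (1400 * (m * unit_time)))))"

lemma run_main:
  assumes E: "fps_nth E 0 = 1"
    and tot: "\<And>x. x \<in> {1..m} \<Longrightarrow>
      fps_nth (psum E) x = (if K = 0 then 0 else \<Sum>v<n. \<Sum>ys\<leftarrow>codes. contrib x v ys)"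
  shows "run w orc main_prog (init_state w input) (\<lambda>s t. (\<forall>x\<in>{1..m}. cmem s x = fps_nth E x) \<and> t \<le> time_bound)" (is "run _ _ _ _ ?Q")
  unfolding main_prog_def
proof (rule run_Seq_mono[OF run_init])
  fix s1 and t1 :: nat assume 1: "params s1 \<and> (\<forall>a<B. wmem s1 (7 * B + a) = 0) \<and> cmem s1 = (\<lambda>_. 0) \<and> t1 \<le> 60"
  then have r4: "wval w (WReg 4) s1 = K" using params_regs[of s1] by simp
  let ?T = "if K = 0 then 0 else 80 * (n * D) + n * (length codes * (3 ^ K * (1400 * (m * unit_time))))"
  have mid: "run w orc (If (WReg 4) (Seq matrix_prog vloop_prog) Skip) s1 (\<lambda>s2 t2. params s2 \<and>
      (\<forall>x\<in>{1..m}. cmem s2 (3 * B + x) = fps_nth (psum E) x) \<and> t2 \<le> 3 + ?T)" (is "run _ _ _ _ ?L1")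
  proof (cases "K = 0")
    case True
    then show ?thesis using 1 r4 tot by simp
  next
    case False
    have "run w orc (Seq matrix_prog vloop_prog) s1 (\<lambda>s2 t2. ?L1 s2 (1 + wcost (WReg 4) + t2))"
    proof (rule run_Seq_mono[OF run_matrix])
      show "params s1" "\<And>a. a < B \<Longrightarrow> wmem s1 (7 * B + a) = 0" using 1 by auto
      fix s2 t2 assume 2: "base s2 \<and> cmem s2 = cmem s1 \<and> t2 \<le> 80 * (n * D)"
      then have b2: "base s2" by simp
      have "K \<ge> 1" using False by simp
      from run_vloop[OF b2 this]
      show "run w orc vloop_prog s2 (\<lambda>s' t. ?L1 s' (1 + wcost (WReg 4) + (t2 + t)))"
      proof (rule run_mono)
        fix s3 t3 assume 3: "chg {6..19} {2..6} s2 s3 \<and>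
          (\<forall>x\<in>{1..m}. cmem s3 (3 * B + x) = cmem s2 (3 * B + x) + (\<Sum>v<n. \<Sum>ys\<leftarrow>codes. contrib x v ys)) \<and>
          t3 \<le> n * (length codes * (3 ^ K * (1400 * (m * unit_time))))"
        have "params s2" using b2 by (simp add: base_def)
        then have "params s3" using 3 params_chg[of "{6..19}" "{2..6}" s2 s3] by simp
        moreover have "1 + wcost (WReg 4) + (t2 + t3) \<le> 3 + ?T"
          unfolding if_not_P[OF False] using 2 3 by (simp only: wcost.simps) linarith
        ultimately show "?L1 s3 (1 + wcost (WReg 4) + (t2 + t3))"
          using 1 2 3 tot False by auto
      qed
    qed
    then show ?thesis
      unfolding run_If[of w orc "WReg 4"] r4 using False by (simp only: if_True not_False_eq_True)
  qed
  show "run w orc (Seq (If (WReg 4) (Seq matrix_prog vloop_prog) Skip) final_prog) s1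
    (\<lambda>s t. ?Q s (t1 + t))"
  proof (rule run_Seq_mono[OF mid])
    fix s2 t2 assume 2: "?L1 s2 t2"
    have "run w orc final_prog s2 (\<lambda>s t. (\<forall>x\<in>{1..m}. cmem s x = fps_nth E x) \<and> t \<le> 110 * (m * m))" (is "run _ _ _ _ ?L2")
      using 2 params_regs[of s2] E by (intro run_final) auto
    then show "run w orc final_prog s2 (\<lambda>s t. ?Q s (t1 + (t2 + t)))"
    proof (rule run_mono)
      fix s t assume a: "?L2 s t"
      have "1 * 1 \<le> m * m" using pos by (intro mult_mono) auto
      then have "t1 + (t2 + t) \<le> time_bound" unfolding time_bound_def using a 1 2 by linarith
      then show "?Q s (t1 + (t2 + t))" using a by blast
    qed
  qed
qed

text \<open>No set is counted twice: its minimum is the root, and \<open>decode_inj\<close> recovers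
  the code. Codes that fail contribute 0.\<close>

lemma sum_contrib:
  assumes "K \<ge> 1"
  shows "(\<Sum>v<n. \<Sum>ys\<leftarrow>codes. contrib x v ys) =
    (\<Sum>U\<in>{set L | L v ys. v < n \<and> ys \<in> set codes \<and> decode xss D v ys = Some L}. mob (power_sums x) U)"
proof -
  define Z where "Z = {(v, ys). v < n \<and> ys \<in> set codes \<and> decode xss D v ys \<noteq> None}"
  define f where "f = (\<lambda>(v, ys). set (the (decode xss D v ys)))"
  have Min: "Min (set L) = v" if "decode xss D v ys = Some L" for v ys L
    using decode_props[OF that] by (intro Min_eqI) auto
  have "inj_on f Z"
  proof (rule inj_onI)
    fix z z' assume "z \<in> Z" "z' \<in> Z" "f z = f z'"
    then obtain v ys L v' ys' L' where z: "z = (v, ys)" "z' = (v', ys')" "v < n"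
      "ys \<in> set codes" "ys' \<in> set codes" "decode xss D v ys = Some L" "decode xss D v' ys' = Some L'"
      "set L = set L'" by (auto simp: Z_def f_def)
    then have "v = v'" using Min by metis
    then show "z = z'" using z decode_inj[of v ys L ys' L'] by (simp add: set_incs)
  qed
  have img: "f ` Z = {set L | L v ys. v < n \<and> ys \<in> set codes \<and> decode xss D v ys = Some L}"
    unfolding f_def Z_def by force
  have "(\<Sum>v<n. \<Sum>ys\<leftarrow>codes. contrib x v ys) = (\<Sum>v<n. \<Sum>ys\<in>set codes. contrib x v ys)"
    by (simp add: sum_list_distinct_conv_sum_set distinct_incs)
  also have "\<dots> = (\<Sum>(v, ys)\<in>{..<n} \<times> set codes. contrib x v ys)" by (simp add: sum.cartesian_product)
  also have "\<dots> = (\<Sum>(v, ys)\<in>Z. contrib x v ys)"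
    by (intro sum.mono_neutral_right) (auto simp: Z_def contrib_def split: option.splits)
  also have "\<dots> = (\<Sum>z\<in>Z. mob (power_sums x) (f z))"
    by (intro sum.cong) (auto simp: Z_def f_def contrib_def)
  also have "\<dots> = (\<Sum>U\<in>f ` Z. mob (power_sums x) U)" using \<open>inj_on f Z\<close> by (simp add: sum.reindex)
  finally show ?thesis unfolding img .
qed

text \<open>Joins the program to the algebra: the series assembled from answers agree with those of
  the induced subgraphs, and by \<open>decode_exists\<close> the decoded sets form a family
  admissible in \<open>power_sum_verts\<close>. For \<open>K = 0\<close> the empty family is
  admissible.\<close>

lemma power_sum_total:
  assumes "bigcp \<kappa> A \<beta> p lam Q G" and Lam: "Lam = (\<lambda>i T. lam (induced G T) i)" and x: "x \<in> {1..m}"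
  shows "bigcp.power_sum p G x (verts G) = (if K = 0 then 0 else \<Sum>v<n. \<Sum>ys\<leftarrow>codes. contrib x v ys)"
proof -
  interpret b: bigcp \<kappa> A \<beta> p lam Q G by fact
  have Ax: "A * x \<le> K" using x by (simp add: K_eq)
  have L: "Lam i T = lam (induced G T) i" for i T using Lam by simp
  have "term_of i T = (if card T \<le> A * i then lam (induced G T) i else 0)" for i T
    by (cases "card T \<le> A * i") (simp_all add: term_of_def L)
  note tm = this
  have series: "coeff_series S = b.coeffs_on S" if "S \<subseteq> verts G" for S
  proof (rule fps_ext)
    show "fps_nth (coeff_series S) i = fps_nth (b.coeffs_on S) i" for i
      using that b.coeffs_on_0[OF that] b.coeffs_on_eq[OF that, of i]
      by (auto simp: coeff_series_def tm)
  qed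
  have ps: "power_sums x S = b.power_sum x S" if "S \<subseteq> verts G" for S
    using series[OF that] by (simp add: power_sums_def b.power_sum_def)
  show ?thesis
  proof (cases "K = 0")
    case True
    have "b.power_sum x (verts G) = (\<Sum>U\<in>{}. mob (b.power_sum x) U)"
    proof (rule b.power_sum_verts[where K = K])
      show "A * x \<le> K" by (rule Ax)
      fix U assume "U \<subseteq> verts G" "U \<noteq> {}" "card U \<le> K"
      then have False using True b.finite_verts by (metis card_gt_0_iff finite_subset le_zero_eq less_irrefl)
      then show "U \<in> {}" by simp
    qed simp
    then show ?thesis using True by simp
  next
    case False
    let ?F = "{set L | L v ys. v < n \<and> ys \<in> set codes \<and> decode xss D v ys = Some L}"
    have F: "?F \<subseteq> Pow (verts G)" using decode_less by (fastforce simp: verts_eq)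
    have "b.power_sum x (verts G) = (\<Sum>U\<in>?F. mob (b.power_sum x) U)"
    proof (rule b.power_sum_verts[OF F Ax])
      fix U assume U: "U \<subseteq> verts G" "U \<noteq> {}" "card U \<le> K" "indecomposable G U"
      have "Min U \<in> U" using U b.finite_verts by (intro Min_in) (auto intro: finite_subset)
      then have "Min U < n" using U(1) by (auto simp: verts_eq)
      moreover obtain ys L where "ys \<in> set codes" "decode xss D (Min U) ys = Some L" "set L = U"
        using decode_exists[OF _ U(2,3,4)] U(1) by (auto simp: verts_eq)
      ultimately show "U \<in> ?F" by blast
    qed
    also have "\<dots> = (\<Sum>U\<in>?F. mob (power_sums x) U)"
    proof (intro sum.cong refl mob_cong)
      fix U S assume US: "U \<in> ?F" "S \<subseteq> U"
      have "U \<subseteq> verts G" using subsetD[OF F US(1)] by (rule PowD)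
      then show "b.power_sum x S = power_sums x S" using US(2) by (intro ps[symmetric]) (rule order.trans)
    qed
    also have "\<dots> = (\<Sum>v<n. \<Sum>ys\<leftarrow>codes. contrib x v ys)" using False by (intro sum_contrib[symmetric]) simp
    finally show ?thesis using False by simp
  qed
qed

end

section \<open>Estimates for the running time\<close>

lemma exec_time_pos: "exec w orc c s s' t \<Longrightarrow> t \<ge> 1"
  by (induction rule: exec.induct) auto

text \<open>The exponential series at \<open>(K + 1) * ln (4 / 3)\<close> dominates its cubic term,
  which bounds \<open>(K + 1) ^ 3\<close> by a multiple of \<open>(4 / 3) ^ K\<close>.\<close>

lemma cube_le_exponential:
  obtains C :: real where "C \<ge> 0" "\<And>K. real K * (real K + 1)\<^sup>2 * 3 ^ K \<le> C * 4 ^ K"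
proof
  let ?l = "ln (4 / 3 :: real)"
  have l: "?l > 0" by simp
  show "0 \<le> 8 / ?l ^ 3" using l by simp
  fix K :: nat
  have "((real K + 1) * ?l) ^ 3 \<le> fact 3 * exp ((real K + 1) * ?l)"
    using l by (intro power_le_fact_exp) simp
  also have "exp ((real K + 1) * ?l) = (4 / 3) ^ Suc K"
    using exp_of_nat_mult[of "Suc K" ?l] by (simp add: add.commute)
  \<comment> \<open>The 8 is \<open>fact 3 * (4 / 3)\<close>, with one factor \<open>4 / 3\<close>
    split off from the power \<open>Suc K\<close>.\<close>
  finally have "(real K + 1) ^ 3 * ?l ^ 3 \<le> 8 * (4 / 3) ^ K" by (simp add: power_mult_distrib fact_numeral)
  then have "(real K + 1) ^ 3 \<le> 8 / ?l ^ 3 * (4 / 3) ^ K" using l by (simp add: field_simps)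
  moreover have "real K * (real K + 1)\<^sup>2 \<le> (real K + 1) ^ 3"
    by (simp add: power3_eq_cube power2_eq_square mult_right_mono)
  ultimately have "real K * (real K + 1)\<^sup>2 \<le> 8 / ?l ^ 3 * (4 / 3) ^ K" by linarith
  then have "real K * (real K + 1)\<^sup>2 * 3 ^ K \<le> 8 / ?l ^ 3 * (4 / 3) ^ K * 3 ^ K" by (rule mult_right_mono) simp
  also have "\<dots> = 8 / ?l ^ 3 * 4 ^ K" by (simp add: power_divide)
  finally show "real K * (real K + 1)\<^sup>2 * 3 ^ K \<le> 8 / ?l ^ 3 * 4 ^ K" .
qed

text \<open>As \<open>\<beta> \<ge> 1\<close>, \<open>\<beta> + 1 \<le> 2 * \<beta>\<close> turns
  1400 into 2800. The matrix costs \<open>80 * n * D\<close>, absorbed by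
  \<open>D \<le> (e D) ^ K\<close> for \<open>K \<ge> 1\<close>; with the \<open>200 * m ^ 2\<close>
  of the other stages this gives 280.\<close>

lemma time_bound_le:
  fixes m n D K \<beta> t T :: nat and c :: real
  assumes pos: "m \<ge> 1" "n \<ge> 1" "D \<ge> 1" "\<beta> \<ge> 1"
    and c: "c \<ge> 0" "real K * (real K + 1)\<^sup>2 * 3 ^ K \<le> c * 4 ^ K"
    and T: "K \<ge> 1 \<Longrightarrow> real T \<le> real K * (exp 1 * real D) ^ K"
    and t: "t \<le> 90 * (m * m) + 110 * (m * m) +
     (if K = 0 then 0 else 80 * (n * D) + n * (T * (3 ^ K * (1400 * (m * (m * (K + 1)\<^sup>2 * (\<beta> + 1)))))))"
  shows "real t \<le> (2800 * c + 280) * real m ^ 2 * (real n * (exp 1 * real D) ^ K * real \<beta> * 4 ^ K)"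
proof -
  let ?e = "(exp 1 * real D) ^ K"
  let ?R = "real m ^ 2 * (real n * ?e * real \<beta> * 4 ^ K)"
  have e1: "(1::real) \<le> exp 1" by simp
  have eD: "1 \<le> exp 1 * real D" "real D \<le> exp 1 * real D"
    using mult_mono[of 1 "exp 1" 1 "real D"] mult_right_mono[OF e1, of "real D"] pos by auto
  have e: "1 \<le> ?e" using eD(1) by (rule one_le_power)
  have four: "(1::real) \<le> 4 ^ K" by simp
  have m2: "1 \<le> real m ^ 2" using pos by simp
  have b1: "1 \<le> real n * ?e * real \<beta> * 4 ^ K"
    using mult_mono[OF mult_mono[OF mult_mono[of 1 "real n" 1 ?e] _, of 1 "real \<beta>"] four] e pos by auto
  have M: "real m ^ 2 \<le> ?R" using mult_left_mono[OF b1, of "real m ^ 2"] by simp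
  have m_part: "200 * (real m * real m) \<le> 200 * ?R" using M by (simp add: power2_eq_square)
  show ?thesis
  proof (cases "K = 0")
    case True
    have "real t \<le> 200 * (real m * real m)"
      using of_nat_mono[OF t, where 'a = real] True by simp
    also have "\<dots> \<le> 200 * ?R" by (rule m_part)
    also have "\<dots> \<le> (2800 * c + 280) * ?R" using c(1) M m2 by (intro mult_right_mono) auto
    finally show ?thesis by (simp only: mult.assoc)
  next
    case False
    have D_part: "80 * (real n * real D) \<le> 80 * ?R"
    proof -
      have "real D \<le> (exp 1 * real D) ^ 1" using eD(2) by simp
      also have "\<dots> \<le> ?e" using eD(1) False by (intro power_increasing) auto
      finally have De: "real D \<le> ?e" .
      have "1 * (real n * real D * 1 * 1) \<le> real m ^ 2 * (real n * ?e * real \<beta> * 4 ^ K)"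
        using De m2 four pos e by (intro mult_mono) auto
      then show ?thesis by simp
    qed
    have main: "real n * (real T * (3 ^ K * (1400 * (real m * (real m * (real K + 1)\<^sup>2 * (real \<beta> + 1)))))) \<le> 2800 * c * ?R"
    proof -
      have "real n * (real T * (3 ^ K * (1400 * (real m * (real m * (real K + 1)\<^sup>2 * (real \<beta> + 1))))))
        \<le> real n * ((real K * ?e) * (3 ^ K * (1400 * (real m * (real m * (real K + 1)\<^sup>2 * (2 * real \<beta>))))))"
        using T False pos by (intro mult_mono mult_nonneg_nonneg) auto
      also have "\<dots> = (2800 * real m ^ 2 * real n * ?e * real \<beta>) * (real K * (real K + 1)\<^sup>2 * 3 ^ K)"
        by (simp add: power2_eq_square mult_ac)
      also have "\<dots> \<le> (2800 * real m ^ 2 * real n * ?e * real \<beta>) * (c * 4 ^ K)"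
        using c(2) e by (intro mult_left_mono) auto
      also have "\<dots> = 2800 * c * ?R" by (simp add: mult_ac)
      finally show ?thesis .
    qed
    have "real t \<le> 200 * (real m * real m) + (80 * (real n * real D) +
        real n * (real T * (3 ^ K * (1400 * (real m * (real m * (real K + 1)\<^sup>2 * (real \<beta> + 1)))))))"
    proof -
      have "real t \<le> real (90 * (m * m) + 110 * (m * m) +
          (80 * (n * D) + n * (T * (3 ^ K * (1400 * (m * (m * (K + 1)\<^sup>2 * (\<beta> + 1))))))))"
        using t unfolding if_not_P[OF False] by (rule of_nat_mono)
      then show ?thesis
        by (simp only: of_nat_add of_nat_mult of_nat_power of_nat_numeral of_nat_1)
    qed
    also have "\<dots> \<le> 200 * ?R + (80 * ?R + 2800 * c * ?R)" by (intro add_mono m_part D_part main)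
    also have "\<dots> = (2800 * c + 280) * ?R" by (simp only: distrib_right)
    finally show ?thesis by (simp only: mult.assoc)
  qed
qed

section \<open>Word length, answered queries and conclusion\<close>

lemma log_sized_mono:
  assumes "log_sized \<kappa> N w" "1 \<le> N'" "N' \<le> N"
  shows "log_sized \<kappa> N' w"
proof -
  have "log 2 (real N') \<le> log 2 (real N)" using assms by simp
  then have "real \<kappa> * log 2 (real N') \<le> real \<kappa> * log 2 (real N)" by (rule mult_left_mono) simp
  then show ?thesis using assms(1) by (simp add: log_sized_def)
qed

lemma log_sized_power:
  assumes "log_sized \<kappa> N w" "1 \<le> N" "e \<le> \<kappa>"
  shows "N ^ e \<le> 2 ^ w"
proof -
  have "0 \<le> log 2 (real N)" using assms(2) by simp
  then have "real e * log 2 (real N) \<le> real \<kappa> * log 2 (real N)" using assms(3) by (intro mult_right_mono) auto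
  then have "log 2 (real N ^ e) \<le> real w" using assms by (simp add: log_sized_def log_nat_power)
  then have "real N ^ e \<le> 2 powr real w" using assms(2) by (simp add: log_le_iff)
  then have "real (N ^ e) \<le> real (2 ^ w)" by (simp add: powr_realpow)
  then show ?thesis by (simp only: of_nat_le_iff)
qed

text \<open>The procedure must answer the query about the empty graph, and every run takes positive
  time.\<close>

lemma BIGCP_beta_ge_1:
  assumes "BIGCP \<kappa> \<alpha> \<beta> p lam Q" "i \<ge> 1" "log_sized \<kappa> (i + \<alpha> * i + \<beta> i) w"
  shows "\<beta> i \<ge> 1"
proof -
  have "simple_graph empty_graph" "card (verts empty_graph) \<le> \<alpha> * i" "adjacency_lists empty_graph []"
    by (simp_all add: simple_graph_def empty_graph_def adjacency_lists_def)
  then obtain t where "t \<le> \<beta> i" "procedure w Q ([length ([] :: nat list list), i] @ encode_lists []) (lam empty_graph i) t"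
    using assms unfolding BIGCP_def computes_coefficients_def by blast
  then show ?thesis using exec_time_pos unfolding procedure_def by (meson le_trans)
qed

text \<open>Adjacency lists describe graphs on an initial segment of the naturals. Renaming the
  vertices of the induced subgraph by their positions in \<open>ys\<close> gives an isomorphic graph
  of this kind, and \<open>lam\<close> does not distinguish the two.\<close>

lemma query_answered:
  assumes bigcp: "BIGCP \<kappa> \<alpha> \<beta> p lam Q" and G: "simple_graph G"
    and i: "1 \<le> i" "log_sized \<kappa> (i + \<alpha> * i + \<beta> i) w"
    and ys: "distinct ys" "set ys \<subseteq> verts G" "length ys \<le> \<alpha> * i"
  shows "\<exists>t\<le>\<beta> i. procedure w Q ([length ys, i] @ encode_lists
    (map (\<lambda>a. filter (\<lambda>b. {ys ! a, ys ! b} \<in> edges G) [0..<length ys]) [0..<length ys])) (lam (induced G (set ys)) i) t"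
proof -
  let ?k = "length ys"
  define X where "X = map (\<lambda>a. filter (\<lambda>b. {ys ! a, ys ! b} \<in> edges G) [0..<?k]) [0..<?k]"
  define H where "H = Graph {..<?k} {{a, b} | a b. a < ?k \<and> b < ?k \<and> {ys ! a, ys ! b} \<in> edges G}"
  have neq: "u \<noteq> v" if "{u, v} \<in> edges G" for u v
    using that G unfolding simple_graph_def by (fastforce simp: doubleton_eq_iff)
  have H_edge: "{a, b} \<in> edges H \<longleftrightarrow> a < ?k \<and> b < ?k \<and> {ys ! a, ys ! b} \<in> edges G" for a b
  proof
    assume "{a, b} \<in> edges H"
    then obtain a' b' where ab: "{a, b} = {a', b'}" "a' < ?k" "b' < ?k" "{ys ! a', ys ! b'} \<in> edges G"
      unfolding H_def graph.sel by blast
    from ab(1) have "a = a' \<and> b = b' \<or> a = b' \<and> b = a'" unfolding doubleton_eq_iff .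
    then show "a < ?k \<and> b < ?k \<and> {ys ! a, ys ! b} \<in> edges G"
      using ab(2-4) insert_commute[of "ys ! a'" "ys ! b'" "{}"] by metis
  qed (unfold H_def graph.sel, blast)
  have "simple_graph H"
    unfolding simple_graph_def
  proof (intro conjI ballI)
    show "finite (verts H)" by (simp add: H_def)
    fix e assume "e \<in> edges H"
    then obtain a b where "e = {a, b}" "a < ?k" "b < ?k" "{ys ! a, ys ! b} \<in> edges G"
      unfolding H_def graph.sel by blast
    then show "\<exists>u\<in>verts H. \<exists>v\<in>verts H. u \<noteq> v \<and> e = {u, v}"
      using neq[of "ys ! a" "ys ! b"] by (intro bexI[of _ a] bexI[of _ b]) (auto simp: H_def)
  qed
  moreover have "card (verts H) \<le> \<alpha> * i" using ys(3) by (simp add: H_def)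
  moreover have "adjacency_lists H X"
    unfolding adjacency_lists_def
  proof (intro conjI allI impI)
    show "verts H = {..<length X}" by (simp add: H_def X_def)
    fix v assume "v < length X"
    then have v: "v < ?k" by (simp add: X_def)
    show "distinct (X ! v)" using v by (simp add: X_def)
    have "{u, v} \<in> edges H \<longleftrightarrow> u < ?k \<and> {ys ! v, ys ! u} \<in> edges G" for u
      using v H_edge[of u v] insert_commute[of "ys ! u" "ys ! v" "{}"] by simp
    then show "set (X ! v) = nbrs H v" using v by (auto simp: X_def nbrs_def)
  qed
  ultimately have "\<exists>t\<le>\<beta> i. procedure w Q ([length X, i] @ encode_lists X) (lam H i) t"
    using bigcp i unfolding BIGCP_def computes_coefficients_def by blast
  moreover have "lam H = lam (induced G (set ys))"
  proof -
    have "iso H (induced G (set ys))"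
      unfolding iso_def
    proof (intro exI[of _ "(!) ys"] conjI ballI)
      show "bij_betw ((!) ys) (verts H) (verts (induced G (set ys)))"
        using ys(1) by (simp add: H_def bij_betw_nth)
      fix u v assume "u \<in> verts H" "v \<in> verts H"
      then show "{u, v} \<in> edges H \<longleftrightarrow> {ys ! u, ys ! v} \<in> edges (induced G (set ys))"
        using H_edge[of u v] by (simp add: H_def induced_def)
    qed
    then show ?thesis
      using bigcp \<open>simple_graph H\<close> simple_graph_induced[OF G ys(2)] unfolding BIGCP_def by blast
  qed
  ultimately show ?thesis by (simp add: X_def)
qed

text \<open>The program and the constants are chosen before \<open>p\<close>, \<open>lam\<close> and
  \<open>Q\<close>, which expresses that the polynomial is accessible through queries only.\<close>

theorem theorem2p2:
  shows "\<exists>(M :: com) (\<kappa>\<^sub>0 :: nat) (C :: real) (d :: nat).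
    \<forall>(n :: nat) (m :: nat) (\<Delta> :: nat) (\<kappa> :: nat) (\<alpha> :: nat) (\<beta> :: nat \<Rightarrow> nat)
      (p :: graph \<Rightarrow> complex poly) (lam :: graph \<Rightarrow> nat \<Rightarrow> complex) (Q :: com).
      n \<ge> 1 \<longrightarrow> m \<ge> 1 \<longrightarrow> \<Delta> \<ge> 1 \<longrightarrow> \<kappa> \<ge> \<kappa>\<^sub>0 \<longrightarrow> BIGCP \<kappa> \<alpha> \<beta> p lam Q \<longrightarrow>
      (\<forall>(G :: graph) (xss :: nat list list) (w :: nat).
        simple_graph G \<longrightarrow> card (verts G) = n \<longrightarrow> max_degree_at_most G \<Delta> \<longrightarrow>
        adjacency_lists G xss \<longrightarrow> log_sized \<kappa> (n + m + \<Delta> + \<alpha> * m + \<beta> m) w \<longrightarrow>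
        (\<exists>s t. exec w (procedure w Q) M (init_state w ([n, m, \<Delta>, \<alpha>] @ encode_lists xss)) s t \<and>
          (\<forall>i\<in>{1..m}. cmem s i = coeff (p G) i) \<and>
          real t \<le> C * real m ^ d *
            (real n * (exp 1 * real \<Delta>) ^ (\<alpha> * m) * real (\<beta> m) * 4 ^ (\<alpha> * m))))"
proof -
  obtain c :: real where c: "c \<ge> 0" "\<And>K. real K * (real K + 1)\<^sup>2 * 3 ^ K \<le> c * 4 ^ K"
    using cube_le_exponential by blast
  show ?thesis
  \<comment> \<open>The 6 is the power of the size parameter that the address space has to exceed;
    the last two witnesses come from \<open>time_bound_le\<close>.\<close>
  proof (rule exI[of _ main_prog], rule exI[of _ 6], rule exI[of _ "2800 * c + 280"], rule exI[of _ 2],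
      intro allI impI)
    fix n m \<Delta> \<kappa> \<alpha> :: nat and \<beta> :: "nat \<Rightarrow> nat" and p :: "graph \<Rightarrow> complex poly"
      and lam :: "graph \<Rightarrow> nat \<Rightarrow> complex" and Q :: com and G :: graph and xss :: "nat list list" and w :: nat
    assume pos: "n \<ge> 1" "m \<ge> 1" "\<Delta> \<ge> 1" and kappa: "\<kappa> \<ge> 6" and bigcp: "BIGCP \<kappa> \<alpha> \<beta> p lam Q"
      and G: "simple_graph G" "card (verts G) = n" "max_degree_at_most G \<Delta>" "adjacency_lists G xss"
      and w: "log_sized \<kappa> (n + m + \<Delta> + \<alpha> * m + \<beta> m) w"
    define K where "K = \<alpha> * m"
    define B where "B = (n + m + \<Delta> + K + 4)\<^sup>2"
    define N where "N = n + m + \<Delta> + \<alpha> * m + \<beta> m"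
    have verts: "verts G = {..<n}" using G(2,4) by (auto simp: adjacency_lists_def)
    have \<beta>: "\<beta> i \<le> \<beta> m" "log_sized \<kappa> (i + \<alpha> * i + \<beta> i) w" if "1 \<le> i" "i \<le> m" for i
    proof -
      have "mono \<beta>" using bigcp by (simp add: BIGCP_def)
      then show "\<beta> i \<le> \<beta> m" using that(2) by (rule monoD)
      moreover have "\<alpha> * i \<le> \<alpha> * m" using that(2) by (rule mult_left_mono) simp
      ultimately show "log_sized \<kappa> (i + \<alpha> * i + \<beta> i) w" using that by (intro log_sized_mono[OF w]) linarith+
    qed
    have \<beta>1: "\<beta> m \<ge> 1" using BIGCP_beta_ge_1[OF bigcp pos(2) \<beta>(2)[OF pos(2)]] by simp
    have blocks: "8 * B < 2 ^ w"
    proof -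
      \<comment> \<open>Each of these summands is at least 1, so \<open>N \<ge> 4\<close>. Then
        \<open>N ^ 4\<close> swallows the constant 32, and with the square in \<open>B\<close> the
        exponent becomes 6.\<close>
      have "4 \<le> n + m + \<Delta> + \<beta> m" using pos \<beta>1 by linarith
      then have N: "4 \<le> N" "n + m + \<Delta> + K + 4 \<le> 2 * N" unfolding N_def K_def by simp_all
      have "B \<le> (2 * N)\<^sup>2" unfolding B_def using N(2) by (rule power_mono) simp
      then have "8 * B \<le> 32 * N\<^sup>2" by (simp add: power_mult_distrib)
      also have "\<dots> < 4 ^ 4 * N\<^sup>2" using N by simp
      also have "\<dots> \<le> N ^ 4 * N\<^sup>2" using N by (intro mult_right_mono power_mono) auto
      also have "\<dots> = N ^ 6" by (simp flip: power_add)
      also have "\<dots> \<le> 2 ^ w" using w N(1) kappa by (intro log_sized_power) (auto simp: N_def)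
      finally show ?thesis .
    qed
    interpret r: ram_ctx G xss \<Delta> n w B m \<alpha> K "\<beta> m" "procedure w Q" "\<lambda>i T. lam (induced G T) i"
    proof
      show "16 \<le> B" using power_mono[of 4 "n + m + \<Delta> + K + 4" 2] by (simp add: B_def)
      fix i and ys :: "nat list"
      assume "i \<in> {1..m}" and ys: "distinct ys" "set ys \<subseteq> {..<n}" "length ys \<le> \<alpha> * i"
      then have i: "1 \<le> i" "i \<le> m" by auto
      show "\<exists>t\<le>\<beta> m. procedure w Q ([length ys, i] @ encode_lists
          (map (\<lambda>a. filter (\<lambda>b. {ys ! a, ys ! b} \<in> edges G) [0..<length ys]) [0..<length ys])) (lam (induced G (set ys)) i) t"
        using query_answered[OF bigcp G(1) i(1) \<beta>(2)[OF i] ys(1) _ ys(3)] ys(2) \<beta>(1)[OF i] verts le_trans by blast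
    qed (use pos G blocks in \<open>simp_all add: B_def K_def\<close>)
    interpret b: bigcp \<kappa> \<alpha> \<beta> p lam Q G
      by unfold_locales (use bigcp G in auto)
    have "run w (procedure w Q) main_prog (init_state w r.input)
      (\<lambda>s t. (\<forall>i\<in>{1..m}. cmem s i = fps_nth (b.coeffs_on (verts G)) i) \<and> t \<le> r.time_bound)"
    proof (rule r.run_main)
      show "fps_nth (b.coeffs_on (verts G)) 0 = 1" by (rule b.coeffs_on_0) simp
      show "fps_nth (psum (b.coeffs_on (verts G))) x
          = (if K = 0 then 0 else \<Sum>v<n. \<Sum>ys\<leftarrow>incs (K * \<Delta>) (K - 1) 0. r.contrib x v ys)" if "x \<in> {1..m}" for x
        using r.power_sum_total[OF b.bigcp_axioms refl that] by (simp add: b.power_sum_def)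
    qed
    then obtain s t where st: "exec w (procedure w Q) main_prog (init_state w r.input) s t"
      "\<forall>i\<in>{1..m}. cmem s i = coeff (p G) i" "t \<le> r.time_bound"
      unfolding run_def by (auto simp: b.coeff_eq)
    have "real t \<le> (2800 * c + 280) * real m ^ 2 * (real n * (exp 1 * real \<Delta>) ^ K * real (\<beta> m) * 4 ^ K)"
    proof (rule time_bound_le)
      show "real (length (incs (K * \<Delta>) (K - 1) 0)) \<le> real K * (exp 1 * real \<Delta>) ^ K" if "K \<ge> 1"
        using that pos(3) by (rule length_incs_le)
      show "t \<le> 90 * (m * m) + 110 * (m * m) + (if K = 0 then 0 else 80 * (n * \<Delta>) +
          n * (length (incs (K * \<Delta>) (K - 1) 0) * (3 ^ K * (1400 * (m * (m * (K + 1)\<^sup>2 * (\<beta> m + 1)))))))"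
        using st(3) unfolding r.time_bound_def r.unit_time_def .
    qed (use pos \<beta>1 c in auto)
    then show "\<exists>s t. exec w (procedure w Q) main_prog (init_state w ([n, m, \<Delta>, \<alpha>] @ encode_lists xss)) s t \<and>
        (\<forall>i\<in>{1..m}. cmem s i = coeff (p G) i) \<and>
        real t \<le> (2800 * c + 280) * real m ^ 2 *
          (real n * (exp 1 * real \<Delta>) ^ (\<alpha> * m) * real (\<beta> m) * 4 ^ (\<alpha> * m))"
      using st unfolding r.input_def K_def by blast
  qed
qed

end
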